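(* Let $\mathbf{P}$ be a class of regex UCQs with string equalities. If the regex formulas in the UCQs of $\mathbf{P}$ belong to a polynomially bounded class of regex formulas, and $\mathbf{P}$ maps to a tractable class of relational UCQs, then UCQs in $\mathbf{P}$ can be evaluated in polynomial total time; that is, there is an algorithm that, given $q\in\mathbf{P}$ and a string $\mathbf{s}$, outputs every tuple of $[\![q]\!](\mathbf{s})$ exactly once in total time polynomial in the size of $(q,\mathbf{s})$ plus $|[\![q]\!](\mathbf{s})|$.
   Context: Strings and spans. $\Sigma$ is a finite alphabet with $|\Sigma|\ge 2$. A span of $\mathbf{s}=\sigma_1\cdots\sigma_\ell\in\Sigma^*$ is an expression $[i,j\rangle$ with $1\le i\le j\le \ell+1$; $\mathbf{s}_{[i,j\rangle}=\sigma_i\cdots\sigma_{j-1}$. $\mathsf{Vars}$ is an infinite set of variables, disjoint from $\Sigma$. For finite $V\subset\mathsf{Vars}$, a $(V,\mathbf{s})$-tuple is a function from $V$ to the spans of $\mathbf{s}$. Ref-words. For finite $V\subset\mathsf{Vars}$ let $\Gamma_V=\{x{\vdash},\ {\dashv}x \mid x\in V\}$, disjoint from $\Sigma$. A word $\mathbf{r}\in(\Sigma\cup\Gamma_V)^*$ is valid for $V$ if for each $x\in V$ it contains exactly one $x{\vdash}$ and exactly one ${\dashv}x$, the former to the left of the latter. $\mathsf{clr}$ is the morphism erasing $\Gamma_V$ and fixing $\Sigma$. A valid $\mathbf{r}$ with $\mathsf{clr}(\mathbf{r})=\mathbf{s}$ defines the $(V,\mathbf{s})$-tuple $\mu^{\mathbf{r}}$: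 writing $\mathbf{r}=\mathbf{r}'_x\, x{\vdash}\,\mathbf{r}_x\,{\dashv}x\,\mathbf{r}''_x$, $\mu^{\mathbf{r}}(x)=[i,j\rangle$ with $i=|\mathsf{clr}(\mathbf{r}'_x)|+1$, $j=i+|\mathsf{clr}(\mathbf{r}_x)|$. Regex formulas. Syntax: $\alpha ::= \emptyset\mid\epsilon\mid\sigma\mid(\alpha\vee\alpha)\mid(\alpha\cdot\alpha)\mid\alpha^*\mid x\{\alpha\}$ with $\sigma\in\Sigma$, $x\in\mathsf{Vars}$. $\mathsf{Vars}(\alpha)$ is the set of variables occurring in $\alpha$. $\mathcal{R}(\alpha)$ is defined as the language of a regular expression, with $\mathcal{R}(x\{\beta\})=x{\vdash}\,\mathcal{R}(\beta)\,{\dashv}x$. $[\![\alpha]\!](\mathbf{s})=\{\mu^{\mathbf{r}}\mid \mathbf{r}\in\mathcal{R}(\alpha)\text{ valid for }\mathsf{Vars}(\alpha),\ \mathsf{clr}(\mathbf{r})=\mathbf{s}\}$. Regex formulas are assumed functional: every word in $\mathcal{R}(\alpha)$ is valid for $\mathsf{Vars}(\alpha)$. Queries. A regex CQ with string equalities is $q=\pi_Y\bigl(\zeta^{=}_{x_1,y_1}\cdots\zeta^{=}_{x_l,y_l}(\alpha_1\bowtie\cdots\bowtie\alpha_k)\bigr)$ with $k\ge1$, $l\ge0$, regex formulas $\alpha_i$, and $Y$ and all $x_j,y_j$ contained in $W=\bigcup_i\mathsf{Vars}(\alpha_i)$. $[\![q]\!](\mathbf{s})$ is the set of restrictions to $Y$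 of those $(W,\mathbf{s})$-tuples $\mu$ with $\mu|_{\mathsf{Vars}(\alpha_i)}\in[\![\alpha_i]\!](\mathbf{s})$ for all $i$ and $\mathbf{s}_{\mu(x_j)}=\mathbf{s}_{\mu(y_j)}$ for all $j$. The atoms of $q$ are the regex formulas $\alpha_i$ and the selections $\zeta^{=}_{x_j,y_j}$, where $\mathsf{Vars}(\zeta^{=}_{x_j,y_j})=\{x_j,y_j\}$. A regex UCQ with string equalities is a union of regex CQs with string equalities having the same output variables, with union semantics. Relational queries. A relational CQ is $Q(y_1,\dots,y_m)\mathrel{:-}\varphi_1,\dots,\varphi_k$ where each atom $\varphi_i$ has the form $R(x_1,\dots,x_r)$ with $R$ an $r$-ary relation symbol and variables $x_j$; a relational UCQ is a union of relational CQs with the same output variables. A regex CQ with string equalities $q$ with output variables $y_1,\dots,y_m$ maps to a relational CQ $Q(y_1,\dots,y_m)$ if no relation symbol occurs more than once in $Q$ and there is a bijection from the atoms of $q$ (regex and equality atoms) to the atoms of $Q$ preserving the sets of variables. A regex UCQ with string equalities $\bigcup_{i=1}^k q_i$ maps to a relational UCQ $\bigcup_{i=1}^{l}Q_i$ (with the same output variables) if $k=l$ and each $q_i$ maps to $Q_i$. A class $\mathbf{P}$ of such queries maps to a class $\mathbf{Q}$ of relational UCQs if each member of $\mathbf{P}$ maps to one or more UCQs in $\mathbf{Q}$. A class of relational (U)CQs is tractable if its members can be evaluated (given query and database) in polynomial total time, i.e., all answers produced, each exactly once, in time polynomial in input size plus number of answers. A class $\mathbf{A}$ of regex formulas is polynomially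 bounded if there is a positive integer $d$ such that for every $\alpha\in\mathbf{A}$ and string $\mathbf{s}$, $|[\![\alpha]\!](\mathbf{s})|$ is $O(|\mathbf{s}|^d)$ (hidden constant depending only on the class $\mathbf{A}$).
   Formalization: The tractable class of relational UCQs is also assumed closed under changes of presentation (relation symbol names, atom order, order and repetition of arguments); without this the claim fails unless P = NP, as disjuncts sharing a symbol can make a hard union tractable. *)

theory Defs
  imports Main "HOL-Library.Countable"
begin

section \<open>Machine model\<close>

text \<open>
  Algorithms are programs of Jones's WHILE language (N. D. Jones, Computability and Complexity
  from a Programming Perspective): registers hold binary trees, and the only operations are
  pairing, the two projections and a while loop testing for a non-empty tree. Reading a register
  is charged with the size of its contents (as if the tree were copied), so that no tree can be
  built in less time than its size, and running times agree with those of multi-tape Turing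
  machines up to a polynomial, for functions with output as well as for decision problems.
\<close>

datatype tree = Tip | Bin tree tree

datatype expr = Reg nat | ETip | EBin expr expr | EFst expr | ESnd expr

datatype com = Assign nat expr | Seq com com | While expr com

type_synonym store = "nat \<Rightarrow> tree"

fun tfst :: "tree \<Rightarrow> tree" where
  "tfst Tip = Tip"
| "tfst (Bin l r) = l"

fun tsnd :: "tree \<Rightarrow> tree" where
  "tsnd Tip = Tip"
| "tsnd (Bin l r) = r"

fun eval_expr :: "expr \<Rightarrow> store \<Rightarrow> tree" where
  "eval_expr (Reg n) \<sigma> = \<sigma> n"
| "eval_expr ETip \<sigma> = Tip"
| "eval_expr (EBin e f) \<sigma> = Bin (eval_expr e \<sigma>) (eval_expr f \<sigma>)"
| "eval_expr (EFst e) \<sigma> = tfst (eval_expr e \<sigma>)"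
| "eval_expr (ESnd e) \<sigma> = tsnd (eval_expr e \<sigma>)"

text \<open>The datatype function \<^const>\<open>size\<close> counts the \<^const>\<open>Bin\<close> nodes of a tree.\<close>

fun cost_expr :: "expr \<Rightarrow> store \<Rightarrow> nat" where
  "cost_expr (Reg n) \<sigma> = 1 + size (\<sigma> n)"
| "cost_expr ETip \<sigma> = 1"
| "cost_expr (EBin e f) \<sigma> = 1 + cost_expr e \<sigma> + cost_expr f \<sigma>"
| "cost_expr (EFst e) \<sigma> = 1 + cost_expr e \<sigma>"
| "cost_expr (ESnd e) \<sigma> = 1 + cost_expr e \<sigma>"

inductive exec :: "com \<Rightarrow> store \<Rightarrow> nat \<Rightarrow> store \<Rightarrow> bool" where
  Assign: "exec (Assign n e) \<sigma> (1 + cost_expr e \<sigma>) (\<sigma>(n := eval_expr e \<sigma>))"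
| Seq: "exec c \<sigma> t \<sigma>' \<Longrightarrow> exec d \<sigma>' u \<sigma>'' \<Longrightarrow> exec (Seq c d) \<sigma> (1 + t + u) \<sigma>''"
| WhileStop: "eval_expr e \<sigma> = Tip \<Longrightarrow> exec (While e c) \<sigma> (1 + cost_expr e \<sigma>) \<sigma>"
| WhileStep: "eval_expr e \<sigma> \<noteq> Tip \<Longrightarrow> exec c \<sigma> t \<sigma>' \<Longrightarrow> exec (While e c) \<sigma>' u \<sigma>''
    \<Longrightarrow> exec (While e c) \<sigma> (1 + cost_expr e \<sigma> + t + u) \<sigma>''"

text \<open>Register 0 carries the input and the output.\<close>

definition runs :: "com \<Rightarrow> tree \<Rightarrow> nat \<Rightarrow> tree \<Rightarrow> bool" where
  "runs c d t d' \<longleftrightarrow> (\<exists>\<sigma>. exec c ((\<lambda>_. Tip)(0 := d)) t \<sigma> \<and> \<sigma> 0 = d')"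

section \<open>Names, encodings and polynomial total time\<close>

text \<open>
  Variables, relation symbols and database constants are binary words; the size of a name is
  its length.
\<close>

type_synonym name = "bool list"

fun enc_nat :: "nat \<Rightarrow> tree" where
  "enc_nat 0 = Tip"
| "enc_nat (Suc n) = Bin Tip (enc_nat n)"

definition enc_bool :: "bool \<Rightarrow> tree" where
  "enc_bool b = (if b then Bin Tip Tip else Tip)"

definition enc_pair :: "('a \<Rightarrow> tree) \<Rightarrow> ('b \<Rightarrow> tree) \<Rightarrow> 'a \<times> 'b \<Rightarrow> tree" where
  "enc_pair f g p = Bin (f (fst p)) (g (snd p))"

fun enc_list :: "('a \<Rightarrow> tree) \<Rightarrow> 'a list \<Rightarrow> tree" where
  "enc_list f [] = Tip"
| "enc_list f (x # xs) = Bin (f x) (enc_list f xs)"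

definition enc_name :: "name \<Rightarrow> tree" where
  "enc_name = enc_list enc_bool"

text \<open>
  An evaluation problem has inputs \<open>I\<close>, encoded by \<open>ei\<close>, and a set \<open>A i\<close> of answers for each
  \<open>i \<in> I\<close>, an answer being a tuple indexed by variables with values encoded by \<open>ev\<close>. The program
  outputs a list in which each answer occurs exactly once, written as a list of pairs
  (variable, value) in any order.
\<close>

definition poly_total_time ::
  "('i \<Rightarrow> tree) \<Rightarrow> ('v \<Rightarrow> tree) \<Rightarrow> 'i set \<Rightarrow> ('i \<Rightarrow> (name \<rightharpoonup> 'v) set) \<Rightarrow> bool" where
  "poly_total_time ei ev I A \<longleftrightarrow>
     (\<exists>c C k. \<forall>i\<in>I. \<exists>out t.
        runs c (ei i) t (enc_list (enc_list (enc_pair enc_name ev)) out) \<and>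
        (\<forall>a\<in>set out. distinct (map fst a)) \<and>
        distinct (map map_of out) \<and>
        set (map map_of out) = A i \<and>
        t \<le> C * (size (ei i) + card (A i)) ^ k + C)"

section \<open>Spans, ref-words and regex formulas\<close>

text \<open>The pair \<open>(i, j)\<close> is the span \<open>[i,j\<rangle>\<close>, with positions counted from 1.\<close>

type_synonym span = "nat \<times> nat"

definition spans :: "'a list \<Rightarrow> span set" where
  "spans s = {(i, j). 1 \<le> i \<and> i \<le> j \<and> j \<le> length s + 1}"

definition substring :: "'a list \<Rightarrow> span \<Rightarrow> 'a list" where
  "substring s p = take (snd p - fst p) (drop (fst p - 1) s)"

datatype 'a letter = Sym 'a | Open name | Close name

fun clr :: "'a letter list \<Rightarrow> 'a list" where
  "clr [] = []"
| "clr (Sym a # r) = a # clr r"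
| "clr (Open x # r) = clr r"
| "clr (Close x # r) = clr r"

definition valid :: "name set \<Rightarrow> 'a letter list \<Rightarrow> bool" where
  "valid V r \<longleftrightarrow>
     set r \<subseteq> range Sym \<union> Open ` V \<union> Close ` V \<and>
     (\<forall>x\<in>V. count_list r (Open x) = 1 \<and> count_list r (Close x) = 1 \<and>
        (\<exists>u v w. r = u @ Open x # v @ Close x # w))"

text \<open>
  Tuples over \<open>V\<close> are partial maps with domain \<open>V\<close>. For \<open>r\<close> valid for \<open>V\<close> there is exactly one
  \<open>\<mu>\<close> with \<open>is_tuple_of V r \<mu>\<close>.
\<close>

definition is_tuple_of :: "name set \<Rightarrow> 'a letter list \<Rightarrow> (name \<rightharpoonup> span) \<Rightarrow> bool" where
  "is_tuple_of V r \<mu> \<longleftrightarrow>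
     dom \<mu> = V \<and>
     (\<forall>x\<in>V. \<exists>u v w. r = u @ Open x # v @ Close x # w \<and>
        (let i = length (clr u) + 1 in \<mu> x = Some (i, i + length (clr v))))"

datatype 'a regex =
    Empty
  | Eps
  | Lit 'a
  | Or "'a regex" "'a regex"
  | Cat "'a regex" "'a regex"
  | Star "'a regex"
  | Capt name "'a regex"

fun vars :: "'a regex \<Rightarrow> name set" where
  "vars Empty = {}"
| "vars Eps = {}"
| "vars (Lit a) = {}"
| "vars (Or \<alpha> \<beta>) = vars \<alpha> \<union> vars \<beta>"
| "vars (Cat \<alpha> \<beta>) = vars \<alpha> \<union> vars \<beta>"
| "vars (Star \<alpha>) = vars \<alpha>"
| "vars (Capt x \<alpha>) = insert x (vars \<alpha>)"

fun ref_lang :: "'a regex \<Rightarrow> 'a letter list set" where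
  "ref_lang Empty = {}"
| "ref_lang Eps = {[]}"
| "ref_lang (Lit a) = {[Sym a]}"
| "ref_lang (Or \<alpha> \<beta>) = ref_lang \<alpha> \<union> ref_lang \<beta>"
| "ref_lang (Cat \<alpha> \<beta>) = {u @ v | u v. u \<in> ref_lang \<alpha> \<and> v \<in> ref_lang \<beta>}"
| "ref_lang (Star \<alpha>) = {concat us | us. set us \<subseteq> ref_lang \<alpha>}"
| "ref_lang (Capt x \<alpha>) = {Open x # u @ [Close x] | u. u \<in> ref_lang \<alpha>}"

definition functional :: "'a regex \<Rightarrow> bool" where
  "functional \<alpha> \<longleftrightarrow> (\<forall>r\<in>ref_lang \<alpha>. valid (vars \<alpha>) r)"

definition regex_eval :: "'a regex \<Rightarrow> 'a list \<Rightarrow> (name \<rightharpoonup> span) set" where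
  "regex_eval \<alpha> s =
     {\<mu>. \<exists>r\<in>ref_lang \<alpha>. valid (vars \<alpha>) r \<and> clr r = s \<and> is_tuple_of (vars \<alpha>) r \<mu>}"

text \<open>
  The bound is \<open>O(|s|^d)\<close> with a constant that depends only on the class. The summand 1 matters
  for the empty string only, on which a formula has at most one tuple anyway.
\<close>

definition polynomially_bounded :: "'a regex set \<Rightarrow> bool" where
  "polynomially_bounded \<A> \<longleftrightarrow>
     (\<exists>d>0. \<exists>C. \<forall>\<alpha>\<in>\<A>. \<forall>s. card (regex_eval \<alpha> s) \<le> C * (length s + 1) ^ d)"

section \<open>Regex UCQs with string equalities\<close>

datatype 'a regex_cq =
  RegexCQ (out_vars: "name list") (equalities: "(name \<times> name) list") (formulas: "'a regex list")

type_synonym 'a regex_ucq = "'a regex_cq list"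

definition all_vars :: "'a regex_cq \<Rightarrow> name set" where
  "all_vars q = (\<Union>\<alpha>\<in>set (formulas q). vars \<alpha>)"

definition wf_regex_cq :: "'a regex_cq \<Rightarrow> bool" where
  "wf_regex_cq q \<longleftrightarrow>
     formulas q \<noteq> [] \<and>
     (\<forall>\<alpha>\<in>set (formulas q). functional \<alpha>) \<and>
     distinct (out_vars q) \<and> set (out_vars q) \<subseteq> all_vars q \<and>
     (\<forall>(x, y)\<in>set (equalities q). x \<in> all_vars q \<and> y \<in> all_vars q)"

definition wf_regex_ucq :: "'a regex_ucq \<Rightarrow> bool" where
  "wf_regex_ucq u \<longleftrightarrow>
     u \<noteq> [] \<and> (\<forall>q\<in>set u. wf_regex_cq q) \<and>
     (\<forall>q\<in>set u. \<forall>q'\<in>set u. set (out_vars q) = set (out_vars q'))"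

definition regex_cq_eval :: "'a regex_cq \<Rightarrow> 'a list \<Rightarrow> (name \<rightharpoonup> span) set" where
  "regex_cq_eval q s =
     {\<mu> |` set (out_vars q) | \<mu>.
        dom \<mu> = all_vars q \<and> ran \<mu> \<subseteq> spans s \<and>
        (\<forall>\<alpha>\<in>set (formulas q). \<mu> |` vars \<alpha> \<in> regex_eval \<alpha> s) \<and>
        (\<forall>(x, y)\<in>set (equalities q). substring s (the (\<mu> x)) = substring s (the (\<mu> y)))}"

definition regex_ucq_eval :: "'a regex_ucq \<Rightarrow> 'a list \<Rightarrow> (name \<rightharpoonup> span) set" where
  "regex_ucq_eval u s = (\<Union>q\<in>set u. regex_cq_eval q s)"

section \<open>Relational UCQs\<close>

text \<open>
  An atom \<open>(R, xs)\<close> stands for \<open>R(xs)\<close>. Atoms of arity 0 are allowed; they correspond to regex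
  formulas without variables.
\<close>

datatype rel_cq = RelCQ (head: "name list") (body: "(name \<times> name list) list")

type_synonym rel_ucq = "rel_cq list"

definition body_vars :: "rel_cq \<Rightarrow> name set" where
  "body_vars Q = (\<Union>(R, xs)\<in>set (body Q). set xs)"

definition wf_rel_cq :: "rel_cq \<Rightarrow> bool" where
  "wf_rel_cq Q \<longleftrightarrow> body Q \<noteq> [] \<and> distinct (head Q) \<and> set (head Q) \<subseteq> body_vars Q"

definition rel_atoms :: "rel_ucq \<Rightarrow> (name \<times> name list) set" where
  "rel_atoms U = (\<Union>Q\<in>set U. set (body Q))"

definition wf_rel_ucq :: "rel_ucq \<Rightarrow> bool" where
  "wf_rel_ucq U \<longleftrightarrow>
     U \<noteq> [] \<and> (\<forall>Q\<in>set U. wf_rel_cq Q) \<and>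
     (\<forall>Q\<in>set U. \<forall>Q'\<in>set U. set (head Q) = set (head Q')) \<and>
     (\<forall>(R, xs)\<in>rel_atoms U. \<forall>(R', xs')\<in>rel_atoms U. R = R' \<longrightarrow> length xs = length xs')"

type_synonym db = "(name \<times> name list list) list"

definition db_rel :: "db \<Rightarrow> name \<Rightarrow> name list set" where
  "db_rel D R = (\<Union>(R', ts)\<in>set D. if R' = R then set ts else {})"

text \<open>\<open>D\<close> is a database over the schema of \<open>U\<close>: each relation is listed once, without repetition.\<close>

definition db_for :: "rel_ucq \<Rightarrow> db \<Rightarrow> bool" where
  "db_for U D \<longleftrightarrow>
     distinct (map fst D) \<and> set (map fst D) = fst ` rel_atoms U \<and>
     (\<forall>(R, ts)\<in>set D. distinct ts) \<and>
     (\<forall>(R, xs)\<in>rel_atoms U. \<forall>t\<in>db_rel D R. length t = length xs)"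

definition rel_cq_eval :: "rel_cq \<Rightarrow> db \<Rightarrow> (name \<rightharpoonup> name) set" where
  "rel_cq_eval Q D =
     {\<nu> |` set (head Q) | \<nu>.
        dom \<nu> = body_vars Q \<and> (\<forall>(R, xs)\<in>set (body Q). map (the \<circ> \<nu>) xs \<in> db_rel D R)}"

definition rel_ucq_eval :: "rel_ucq \<Rightarrow> db \<Rightarrow> (name \<rightharpoonup> name) set" where
  "rel_ucq_eval U D = (\<Union>Q\<in>set U. rel_cq_eval Q D)"

section \<open>Mapping regex UCQs to relational UCQs\<close>

text \<open>The lists give the variable set of each atom; the bijection is between atom occurrences.\<close>

definition atoms_match :: "name set list \<Rightarrow> name set list \<Rightarrow> bool" where
  "atoms_match As Bs \<longleftrightarrow>
     (\<exists>f. bij_betw f {..<length As} {..<length Bs} \<and> (\<forall>i<length As. Bs ! f i = As ! i))"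

definition regex_cq_atoms :: "'a regex_cq \<Rightarrow> name set list" where
  "regex_cq_atoms q = map vars (formulas q) @ map (\<lambda>(x, y). {x, y}) (equalities q)"

definition rel_cq_atoms :: "rel_cq \<Rightarrow> name set list" where
  "rel_cq_atoms Q = map (\<lambda>(R, xs). set xs) (body Q)"

definition self_join_free :: "rel_cq \<Rightarrow> bool" where
  "self_join_free Q \<longleftrightarrow> distinct (map fst (body Q))"

definition cq_maps_to :: "'a regex_cq \<Rightarrow> rel_cq \<Rightarrow> bool" where
  "cq_maps_to q Q \<longleftrightarrow>
     set (head Q) = set (out_vars q) \<and> self_join_free Q \<and>
     atoms_match (regex_cq_atoms q) (rel_cq_atoms Q)"

definition ucq_maps_to :: "'a regex_ucq \<Rightarrow> rel_ucq \<Rightarrow> bool" where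
  "ucq_maps_to u U \<longleftrightarrow> list_all2 cq_maps_to u U"

definition class_maps_to :: "'a regex_ucq set \<Rightarrow> rel_ucq set \<Rightarrow> bool" where
  "class_maps_to \<P> \<Q> \<longleftrightarrow> (\<forall>u\<in>\<P>. \<exists>U\<in>\<Q>. ucq_maps_to u U)"

text \<open>
  Mapping a regex CQ determines only the output variables and the variable sets of the atoms of
  its image. What it leaves open is the presentation: the names of the relation symbols (in
  particular, whether two disjuncts share a symbol), the order of the atoms and of the output
  variables, and the order and multiplicity of the arguments in an atom. A class of relational
  UCQs is understood to be independent of the presentation, just as a class of graphs is
  understood to be closed under isomorphism.

  The convention is needed, unless P = NP. Without it, let \<open>\<Q>\<close> consist of unions of a Boolean clique query
  and a Boolean query whose only atom occurs verbatim in the clique query. The second disjunct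
  subsumes the first, so \<open>\<Q>\<close> is tractable; but a union of two regex CQs over unrelated formulas
  maps to it, and evaluating the first of them is NP-hard.
\<close>

definition same_cq_up_to_presentation :: "rel_cq \<Rightarrow> rel_cq \<Rightarrow> bool" where
  "same_cq_up_to_presentation Q Q' \<longleftrightarrow>
     set (head Q) = set (head Q') \<and> self_join_free Q \<and> self_join_free Q' \<and>
     atoms_match (rel_cq_atoms Q) (rel_cq_atoms Q')"

definition rel_ucq_class :: "rel_ucq set \<Rightarrow> bool" where
  "rel_ucq_class \<Q> \<longleftrightarrow>
     (\<forall>U\<in>\<Q>. wf_rel_ucq U) \<and>
     (\<forall>U\<in>\<Q>. \<forall>U'. wf_rel_ucq U' \<and> list_all2 same_cq_up_to_presentation U U' \<longrightarrow> U' \<in> \<Q>)"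

section \<open>Evaluation problems\<close>

definition enc_rel_cq :: "rel_cq \<Rightarrow> tree" where
  "enc_rel_cq Q = Bin (enc_list enc_name (head Q))
     (enc_list (enc_pair enc_name (enc_list enc_name)) (body Q))"

definition enc_db :: "db \<Rightarrow> tree" where
  "enc_db = enc_list (enc_pair enc_name (enc_list (enc_list enc_name)))"

definition tractable :: "rel_ucq set \<Rightarrow> bool" where
  "tractable \<Q> \<longleftrightarrow>
     poly_total_time (enc_pair (enc_list enc_rel_cq) enc_db) enc_name
       {(U, D). U \<in> \<Q> \<and> db_for U D} (\<lambda>(U, D). rel_ucq_eval U D)"

text \<open>
  The alphabet is a fixed finite type, so any injective encoding of its letters will do; the one
  chosen by \<^const>\<open>to_nat\<close> has bounded size.
\<close>

definition enc_letter :: "'a::finite \<Rightarrow> tree" where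
  "enc_letter a = enc_nat (to_nat a)"

fun enc_regex :: "'a::finite regex \<Rightarrow> tree" where
  "enc_regex Empty = Bin (enc_nat 0) Tip"
| "enc_regex Eps = Bin (enc_nat 1) Tip"
| "enc_regex (Lit a) = Bin (enc_nat 2) (enc_letter a)"
| "enc_regex (Or \<alpha> \<beta>) = Bin (enc_nat 3) (Bin (enc_regex \<alpha>) (enc_regex \<beta>))"
| "enc_regex (Cat \<alpha> \<beta>) = Bin (enc_nat 4) (Bin (enc_regex \<alpha>) (enc_regex \<beta>))"
| "enc_regex (Star \<alpha>) = Bin (enc_nat 5) (enc_regex \<alpha>)"
| "enc_regex (Capt x \<alpha>) = Bin (enc_nat 6) (Bin (enc_name x) (enc_regex \<alpha>))"

definition enc_regex_cq :: "'a::finite regex_cq \<Rightarrow> tree" where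
  "enc_regex_cq q = Bin (enc_list enc_name (out_vars q))
     (Bin (enc_list (enc_pair enc_name enc_name) (equalities q))
        (enc_list enc_regex (formulas q)))"

text \<open>
  Span positions are output in unary; they are at most \<open>|s| + 1\<close>, so this is no restriction.
\<close>

definition evaluable_in_poly_total_time :: "'a::finite regex_ucq set \<Rightarrow> bool" where
  "evaluable_in_poly_total_time \<P> \<longleftrightarrow>
     poly_total_time (enc_pair (enc_list enc_regex_cq) (enc_list enc_letter))
       (enc_pair enc_nat enc_nat) (\<P> \<times> UNIV) (\<lambda>(u, s). regex_ucq_eval u s)"

end

theory Submission
  imports Defs
begin

text \<open>
  Since the class of relational UCQs is closed under changes of presentation, a regex UCQ maps to a
  relational UCQ of the class that gives every atom its own relation symbol. The relation of a
  formula holds its tuples and the relation of an equality selection all pairs of spans with equal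
  contents, spans being named by words, so that the relational answers are the answers of the
  regex UCQ under a renaming of values.

  The tuples of a formula are computed bottom-up: for each subformula and each span, all partial
  tuples of ref-words that spell the span. A word of a subformula that occurs in some ref-word of
  the whole formula extends, in a context of length at most the size of the formula, to such a
  ref-word, and this extension is injective on tuples. Hence the polynomial bound of the class also
  bounds the intermediate tables. Tables of subformulas that occur in no ref-word may be larger,
  but they are not needed and can be cut off at the bound.
\<close>

section \<open>Subroutines of WHILE programs\<close>

text \<open>The claim is about concrete programs, so much of the work is a calculus of
  polynomial-time functions on encoded data. \<open>polytime\<close> speaks about total functions on
  a whole type, without a promise on the input. Every iteration therefore needs a size bound that
  holds even for ill-formed input, which is why tables are cut off by force and why destructors get
  default values; correctness is proved separately, under the promise. The machine has no recursion,
  so a formula is processed by a loop over the list of its subformulas with an explicit stack. The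
  relational query provided by the mapping is never searched for: the program always emits the same
  canonical query, and the mapping only serves to show that this query lies in the tractable class.
  Star is the one constructor without an evident bound on the number of rounds.\<close>

fun expr_reg_bound :: "expr \<Rightarrow> nat" where
  "expr_reg_bound (Reg n) = Suc n"
| "expr_reg_bound ETip = 0"
| "expr_reg_bound (EBin e f) = max (expr_reg_bound e) (expr_reg_bound f)"
| "expr_reg_bound (EFst e) = expr_reg_bound e"
| "expr_reg_bound (ESnd e) = expr_reg_bound e"

text \<open>A strict upper bound on the register numbers mentioned, so that a caller can place its
  own data above it.\<close>

fun reg_bound :: "com \<Rightarrow> nat" where
  "reg_bound (Assign n e) = max (Suc n) (expr_reg_bound e)"
| "reg_bound (Seq c d) = max (reg_bound c) (reg_bound d)"
| "reg_bound (While e c) = max (expr_reg_bound e) (reg_bound c)"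

lemma eval_expr_cong:
  "(\<And>r. r < expr_reg_bound e \<Longrightarrow> \<sigma> r = \<tau> r) \<Longrightarrow> eval_expr e \<sigma> = eval_expr e \<tau>"
  by (induction e) auto

lemma cost_expr_cong:
  "(\<And>r. r < expr_reg_bound e \<Longrightarrow> \<sigma> r = \<tau> r) \<Longrightarrow> cost_expr e \<sigma> = cost_expr e \<tau>"
  by (induction e) auto

text \<open>Registers from \<open>m\<close> on are neither read nor written, so a run, including its
  time, depends on the lower ones only. Any \<open>m\<close> above the register bound is allowed, so
  that both halves of a \<open>Seq\<close> can be treated with the same \<open>m\<close>.\<close>

lemma exec_frame:
  assumes "exec c \<sigma> t \<sigma>'" and "reg_bound c \<le> m" and "\<forall>r<m. \<tau> r = \<sigma> r"
  shows "\<exists>\<tau>'. exec c \<tau> t \<tau>' \<and> (\<forall>r<m. \<tau>' r = \<sigma>' r) \<and> (\<forall>r\<ge>m. \<tau>' r = \<tau> r)"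
  using assms
proof (induction arbitrary: \<tau> rule: exec.induct)
  case (Assign n e \<sigma>)
  have "eval_expr e \<tau> = eval_expr e \<sigma>" "cost_expr e \<tau> = cost_expr e \<sigma>"
    using Assign.prems by (auto intro!: eval_expr_cong cost_expr_cong)
  then have "exec (Assign n e) \<tau> (1 + cost_expr e \<sigma>) (\<tau>(n := eval_expr e \<sigma>))"
    by (metis exec.Assign)
  then show ?case using Assign.prems
    by (intro exI[of _ "\<tau>(n := eval_expr e \<sigma>)"] conjI) (assumption, simp_all)
next
  case (Seq c \<sigma> t \<sigma>' d u \<sigma>'')
  obtain \<tau>' where 1: "exec c \<tau> t \<tau>'" "\<forall>r<m. \<tau>' r = \<sigma>' r" "\<forall>r\<ge>m. \<tau>' r = \<tau> r"
    using Seq.IH(1)[OF _ Seq.prems(2)] Seq.prems(1) by auto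
  obtain \<tau>'' where "exec d \<tau>' u \<tau>''" "\<forall>r<m. \<tau>'' r = \<sigma>'' r" "\<forall>r\<ge>m. \<tau>'' r = \<tau>' r"
    using Seq.IH(2)[OF _ 1(2)] Seq.prems by auto
  with 1 show ?case by (intro exI[of _ \<tau>''] conjI exec.Seq) auto
next
  case (WhileStop e \<sigma> c)
  have "eval_expr e \<tau> = eval_expr e \<sigma>" "cost_expr e \<tau> = cost_expr e \<sigma>"
    using WhileStop.prems by (auto intro!: eval_expr_cong cost_expr_cong)
  then show ?case using exec.WhileStop[of e \<tau> c] WhileStop by (intro exI[of _ \<tau>]) auto
next
  case (WhileStep e \<sigma> c t \<sigma>' u \<sigma>'')
  have e: "eval_expr e \<tau> = eval_expr e \<sigma>" "cost_expr e \<tau> = cost_expr e \<sigma>"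
    using WhileStep.prems by (auto intro!: eval_expr_cong cost_expr_cong)
  obtain \<tau>' where 1: "exec c \<tau> t \<tau>'" "\<forall>r<m. \<tau>' r = \<sigma>' r" "\<forall>r\<ge>m. \<tau>' r = \<tau> r"
    using WhileStep.IH(1)[OF _ WhileStep.prems(2)] WhileStep.prems(1) by auto
  obtain \<tau>'' where 2: "exec (While e c) \<tau>' u \<tau>''" "\<forall>r<m. \<tau>'' r = \<sigma>'' r" "\<forall>r\<ge>m. \<tau>'' r = \<tau>' r"
    using WhileStep.IH(2)[OF WhileStep.prems(1)] 1 by blast
  have "exec (While e c) \<tau> (1 + cost_expr e \<tau> + t + u) \<tau>''"
    using exec.WhileStep[of e \<tau> c t \<tau>' u \<tau>''] e 1 2 WhileStep.hyps by simp
  with 1 2 e show ?case by (intro exI[of _ \<tau>'']) auto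
qed

lemma size_tfst_le: "size (tfst d) \<le> size d" and size_tsnd_le: "size (tsnd d) \<le> size d"
  by (cases d; simp)+

lemma size_eval_expr_le: "size (eval_expr e \<sigma>) \<le> cost_expr e \<sigma>"
proof (induction e)
  case (EFst e)
  then show ?case using size_tfst_le[of "eval_expr e \<sigma>"] by simp
next
  case (ESnd e)
  then show ?case using size_tsnd_le[of "eval_expr e \<sigma>"] by simp
qed auto

text \<open>A stored value is no larger than the cost of computing it, because reads are charged by
  size. Time bounds therefore double as bounds on output size.\<close>

lemma exec_size: "exec c \<sigma> t \<sigma>' \<Longrightarrow> size (\<sigma>' r) \<le> size (\<sigma> r) + t"
  by (induction rule: exec.induct)
    (auto simp: le_SucI trans_le_add2 size_eval_expr_le)

lemma runs_size: "runs c x t y \<Longrightarrow> size y \<le> size x + t"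
  unfolding runs_def using exec_size[of c _ t _ 0] by (metis fun_upd_same)

section \<open>Calling a program as a subroutine\<close>

fun clear :: "nat \<Rightarrow> com" where
  "clear 0 = Assign 0 ETip"
| "clear (Suc m) = Seq (clear m) (Assign (Suc m) ETip)"

lemma exec_clear: "exec (clear m) \<sigma> (3 * m + 2) (\<lambda>r. if r \<le> m then Tip else \<sigma> r)"
proof (induction m)
  case 0
  have "\<sigma>(0 := Tip) = (\<lambda>r. if r \<le> 0 then Tip else \<sigma> r)" by auto
  with exec.Assign[of 0 ETip \<sigma>] show ?case by (simp add: numeral_eq_Suc)
next
  case (Suc m)
  have "(\<lambda>r. if r \<le> m then Tip else \<sigma> r)(Suc m := Tip) = (\<lambda>r. if r \<le> Suc m then Tip else \<sigma> r)"
    by auto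
  with exec.Seq[OF Suc exec.Assign[of "Suc m" ETip]] show ?case
    by (simp add: numeral_eq_Suc)
qed

text \<open>\<open>runs\<close> presumes that all registers but the input are empty, so the scratch
  area up to \<open>m\<close> is wiped before each call; a loop may call the same program many
  times. The registers \<open>a\<close> and \<open>b\<close> are meant to lie above
  \<open>m\<close>.\<close>

definition call :: "com \<Rightarrow> nat \<Rightarrow> nat \<Rightarrow> nat \<Rightarrow> com" where
  "call c m a b = Seq (clear m) (Seq (Assign 0 (Reg a)) (Seq c (Assign b (Reg 0))))"

text \<open>The run costs \<open>t\<close>, copying the argument costs
  \<open>size (\<sigma> a)\<close>, and copying the result costs at most their sum.\<close>

lemma exec_call:
  assumes "runs c (\<sigma> a) t y" and "reg_bound c \<le> Suc m" and "m < a" "m < b"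
  shows "\<exists>t' \<sigma>'. exec (call c m a b) \<sigma> t' \<sigma>' \<and> t' \<le> 2 * (t + size (\<sigma> a)) + 3 * m + 9 \<and>
    \<sigma>' b = y \<and> (\<forall>r>m. r \<noteq> b \<longrightarrow> \<sigma>' r = \<sigma> r)"
proof -
  define \<sigma>1 where "\<sigma>1 = (\<lambda>r. if r \<le> m then Tip else \<sigma> r)"
  define \<sigma>2 where "\<sigma>2 = \<sigma>1(0 := \<sigma> a)"
  have 1: "exec (clear m) \<sigma> (3 * m + 2) \<sigma>1"
    unfolding \<sigma>1_def by (rule exec_clear)
  have a: "\<sigma>1 a = \<sigma> a" using \<open>m < a\<close> by (simp add: \<sigma>1_def)
  then have 2: "exec (Assign 0 (Reg a)) \<sigma>1 (2 + size (\<sigma> a)) \<sigma>2"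
    using exec.Assign[of 0 "Reg a" \<sigma>1] by (simp add: \<sigma>2_def)
  obtain \<rho> where \<rho>: "exec c ((\<lambda>_. Tip)(0 := \<sigma> a)) t \<rho>" "\<rho> 0 = y"
    using assms by (auto simp: runs_def)
  obtain \<sigma>3 where 3: "exec c \<sigma>2 t \<sigma>3" "\<forall>r<Suc m. \<sigma>3 r = \<rho> r" "\<forall>r\<ge>Suc m. \<sigma>3 r = \<sigma>2 r"
    using exec_frame[OF \<rho>(1) assms(2), of \<sigma>2] by (force simp: \<sigma>2_def \<sigma>1_def less_Suc_eq_le)
  have y: "\<sigma>3 0 = y" using 3 \<rho> by simp
  have 4: "exec (Assign b (Reg 0)) \<sigma>3 (2 + size y) (\<sigma>3(b := y))"
    using exec.Assign[of b "Reg 0" \<sigma>3] y by simp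
  have "exec (call c m a b) \<sigma>
      (1 + (3 * m + 2) + (1 + (2 + size (\<sigma> a)) + (1 + t + (2 + size y)))) (\<sigma>3(b := y))"
    unfolding call_def by (rule exec.Seq[OF 1 exec.Seq[OF 2 exec.Seq[OF 3(1) 4]]])
  note run = this
  have "size y \<le> size (\<sigma> a) + t" using assms(1) by (rule runs_size)
  moreover have "\<forall>r>m. r \<noteq> b \<longrightarrow> (\<sigma>3(b := y)) r = \<sigma> r"
    using 3(3) by (auto simp: \<sigma>2_def \<sigma>1_def)
  ultimately show ?thesis
    by - (intro exI conjI, rule run, auto)
qed

lemma exec_Assign': "\<tau> = \<sigma>(n := eval_expr e \<sigma>) \<Longrightarrow> t = 1 + cost_expr e \<sigma> \<Longrightarrow> exec (Assign n e) \<sigma> t \<tau>"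
  by (simp only: exec.Assign)

definition init_store :: "tree \<Rightarrow> store" where
  "init_store x = (\<lambda>_. Tip)(0 := x)"

lemma init_store_0 [simp]: "init_store x 0 = x"
  by (simp add: init_store_def)

lemma runsI: "exec c (init_store x) t \<sigma> \<Longrightarrow> \<sigma> 0 = y \<Longrightarrow> runs c x t y"
  by (auto simp: runs_def init_store_def)

section \<open>Sequencing, pairing, branching and looping with linear overhead\<close>

lemma runs_seq:
  "\<exists>c K. \<forall>x t y t' z. runs c1 x t y \<longrightarrow> runs c2 y t' z \<longrightarrow>
     (\<exists>t''. runs c x t'' z \<and> t'' \<le> K * (t + t' + size x + 1))"
proof -
  define m where "m = reg_bound c1 + reg_bound c2"
  have m: "reg_bound c1 \<le> Suc m" "reg_bound c2 \<le> Suc m" by (auto simp: m_def)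
  define M where "M = Suc m"
  have M: "m < M" "M > 0" by (auto simp: M_def)
  let ?c = "Seq (Assign M (Reg 0)) (Seq (call c1 m M M) (Seq (call c2 m M M) (Assign 0 (Reg M))))"
  have "\<exists>t''. runs ?c x t'' z \<and> t'' \<le> (6 * m + 40) * (t + t' + size x + 1)"
    if r1: "runs c1 x t y" and r2: "runs c2 y t' z" for x t y t' z
  proof -
    define \<sigma>1 where "\<sigma>1 = (init_store x)(M := x)"
    have e1: "exec (Assign M (Reg 0)) (init_store x) (2 + size x) \<sigma>1"
      by (rule exec_Assign') (auto simp: \<sigma>1_def)
    have "runs c1 (\<sigma>1 M) t y" using r1 by (simp add: \<sigma>1_def)
    from exec_call[where \<sigma> = \<sigma>1 and a = M, OF this m(1) M(1) M(1)] obtain t2 \<sigma>2 where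
      e2: "exec (call c1 m M M) \<sigma>1 t2 \<sigma>2" "t2 \<le> 2 * (t + size x) + 3 * m + 9" "\<sigma>2 M = y"
      by (auto simp: \<sigma>1_def)
    have "runs c2 (\<sigma>2 M) t' z" using r2 e2 by simp
    from exec_call[where \<sigma> = \<sigma>2 and a = M, OF this m(2) M(1) M(1)] obtain t3 \<sigma>3 where
      e3: "exec (call c2 m M M) \<sigma>2 t3 \<sigma>3" "t3 \<le> 2 * (t' + size y) + 3 * m + 9" "\<sigma>3 M = z"
      using e2 by auto
    have e4: "exec (Assign 0 (Reg M)) \<sigma>3 (2 + size z) (\<sigma>3(0 := z))"
      by (rule exec_Assign') (auto simp: e3)
    have "runs ?c x (1 + (2 + size x) + (1 + t2 + (1 + t3 + (2 + size z)))) z"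
      by (rule runsI[OF exec.Seq[OF e1 exec.Seq[OF e2(1) exec.Seq[OF e3(1) e4]]]]) simp
    note run = this
    have "size y \<le> size x + t" "size z \<le> size y + t'"
      using r1 r2 runs_size by auto
    then show ?thesis
      using e2(2) e3(2)
      by - (intro exI conjI, rule run, auto simp: algebra_simps)
  qed
  then show ?thesis by blast
qed

lemma runs_pair:
  "\<exists>c K. \<forall>x t y t' z. runs c1 x t y \<longrightarrow> runs c2 x t' z \<longrightarrow>
     (\<exists>t''. runs c x t'' (Bin y z) \<and> t'' \<le> K * (t + t' + size x + 1))"
proof -
  define m where "m = reg_bound c1 + reg_bound c2"
  have m: "reg_bound c1 \<le> Suc m" "reg_bound c2 \<le> Suc m" by (auto simp: m_def)
  define M where "M = Suc m"
  have M: "m < M" "m < Suc M" "M > 0" by (auto simp: M_def)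
  let ?c = "Seq (Assign M (Reg 0)) (Seq (call c1 m M (Suc M)) (Seq (call c2 m M M)
    (Assign 0 (EBin (Reg (Suc M)) (Reg M)))))"
  have "\<exists>t''. runs ?c x t'' (Bin y z) \<and> t'' \<le> (6 * m + 40) * (t + t' + size x + 1)"
    if r1: "runs c1 x t y" and r2: "runs c2 x t' z" for x t y t' z
  proof -
    define \<sigma>1 where "\<sigma>1 = (init_store x)(M := x)"
    have e1: "exec (Assign M (Reg 0)) (init_store x) (2 + size x) \<sigma>1"
      by (rule exec_Assign') (auto simp: \<sigma>1_def)
    have x: "\<sigma>1 M = x" by (simp add: \<sigma>1_def)
    have "runs c1 (\<sigma>1 M) t y" using r1 by (simp add: x)
    from exec_call[where \<sigma> = \<sigma>1 and a = M, OF this m(1) M(1) M(2)] obtain t2 \<sigma>2 where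
      e2: "exec (call c1 m M (Suc M)) \<sigma>1 t2 \<sigma>2" "t2 \<le> 2 * (t + size x) + 3 * m + 9"
        "\<sigma>2 (Suc M) = y" "\<sigma>2 M = x"
      using M x by auto
    have "runs c2 (\<sigma>2 M) t' z" using r2 e2 by simp
    from exec_call[where \<sigma> = \<sigma>2 and a = M, OF this m(2) M(1) M(1)] obtain t3 \<sigma>3 where
      e3: "exec (call c2 m M M) \<sigma>2 t3 \<sigma>3" "t3 \<le> 2 * (t' + size x) + 3 * m + 9" "\<sigma>3 M = z"
        "\<sigma>3 (Suc M) = y"
      using e2 M by auto
    have e4: "exec (Assign 0 (EBin (Reg (Suc M)) (Reg M))) \<sigma>3 (4 + size y + size z)
        (\<sigma>3(0 := Bin y z))"
      by (rule exec_Assign') (auto simp: e3)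
    have "runs ?c x (1 + (2 + size x) + (1 + t2 + (1 + t3 + (4 + size y + size z)))) (Bin y z)"
      by (rule runsI[OF exec.Seq[OF e1 exec.Seq[OF e2(1) exec.Seq[OF e3(1) e4]]]]) simp
    note run = this
    have "size y \<le> size x + t" "size z \<le> size x + t'"
      using r1 r2 runs_size by auto
    then show ?thesis
      using e2(2) e3(2)
      by - (intro exI conjI, rule run, auto simp: algebra_simps)
  qed
  then show ?thesis by blast
qed

lemma runs_if:
  "\<exists>c K. \<forall>x t b t' y. runs c1 x t b \<longrightarrow>
     (if b \<noteq> Tip then runs c2 x t' y else runs c3 x t' y) \<longrightarrow>
     (\<exists>t''. runs c x t'' y \<and> t'' \<le> K * (t + t' + size x + 1))"
proof -
  define m where "m = reg_bound c1 + reg_bound c2 + reg_bound c3"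
  have m: "reg_bound c1 \<le> Suc m" "reg_bound c2 \<le> Suc m" "reg_bound c3 \<le> Suc m"
    by (auto simp: m_def)
  define M where "M = Suc m"
  define B where "B = Suc M"
  define N where "N = Suc B"
  define R where "R = Suc N"
  have M: "m < M" "m < B" "m < N" "m < R" "M > 0" "B > 0" "N > 0" "R > 0"
    "M \<noteq> B" "M \<noteq> N" "M \<noteq> R" "B \<noteq> N" "B \<noteq> R" "N \<noteq> R"
    by (auto simp: M_def B_def N_def R_def)
  \<comment> \<open>The language has no conditional, so two flags simulate one: \<open>B\<close>
    holds the test result and \<open>N\<close> means that no branch has run yet. The first loop
    clears both and the second clears \<open>N\<close>, so exactly one of the loops runs, and only
    once.\<close>
  let ?w1 = "Seq (call c2 m M R) (Seq (Assign B ETip) (Assign N ETip))"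
  let ?w2 = "Seq (call c3 m M R) (Assign N ETip)"
  let ?c = "Seq (Assign M (Reg 0)) (Seq (call c1 m M B) (Seq (Assign N (EBin ETip ETip))
    (Seq (While (Reg B) ?w1) (Seq (While (Reg N) ?w2) (Assign 0 (Reg R))))))"
  have "\<exists>t''. runs ?c x t'' y \<and> t'' \<le> (6 * m + 60) * (t + t' + size x + 1)"
    if r1: "runs c1 x t b" and r2: "if b \<noteq> Tip then runs c2 x t' y else runs c3 x t' y"
    for x t b t' y
  proof -
    define \<sigma>1 where "\<sigma>1 = (init_store x)(M := x)"
    have e1: "exec (Assign M (Reg 0)) (init_store x) (2 + size x) \<sigma>1"
      by (rule exec_Assign') (auto simp: \<sigma>1_def)
    have x: "\<sigma>1 M = x" by (simp add: \<sigma>1_def)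
    have "runs c1 (\<sigma>1 M) t b" using r1 by (simp add: x)
    from exec_call[where \<sigma> = \<sigma>1 and a = M, OF this m(1) M(1) M(2)] obtain t2 \<sigma>2 where
      e2: "exec (call c1 m M B) \<sigma>1 t2 \<sigma>2" "t2 \<le> 2 * (t + size x) + 3 * m + 9"
        "\<sigma>2 B = b" "\<sigma>2 M = x"
      using M x by auto
    define \<sigma>3 where "\<sigma>3 = \<sigma>2(N := Bin Tip Tip)"
    have e3: "exec (Assign N (EBin ETip ETip)) \<sigma>2 4 \<sigma>3"
      by (rule exec_Assign') (auto simp: \<sigma>3_def)
    have s3: "\<sigma>3 M = x" "\<sigma>3 B = b" "\<sigma>3 N = Bin Tip Tip"
      using e2 M by (auto simp: \<sigma>3_def)
    have b: "size b \<le> size x + t" and y: "size y \<le> size x + t'"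
      using r1 r2 runs_size by (auto split: if_splits)
    have "\<exists>t4 \<sigma>4. exec (Seq (While (Reg B) ?w1) (While (Reg N) ?w2)) \<sigma>3 t4 \<sigma>4 \<and> \<sigma>4 R = y \<and>
        t4 \<le> 2 * (t' + size x) + 3 * m + 30 + size b"
    proof (cases "b = Tip")
      case False
      with r2 have "runs c2 (\<sigma>3 M) t' y" by (simp add: s3)
      from exec_call[where \<sigma> = \<sigma>3 and a = M, OF this m(2) M(1) M(4)] obtain t5 \<sigma>5 where
        e5: "exec (call c2 m M R) \<sigma>3 t5 \<sigma>5" "t5 \<le> 2 * (t' + size x) + 3 * m + 9" "\<sigma>5 R = y"
        by (auto simp: s3)
      define \<sigma>6 where "\<sigma>6 = \<sigma>5(B := Tip, N := Tip)"
      have "exec (Assign B ETip) \<sigma>5 2 (\<sigma>5(B := Tip))"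
          "exec (Assign N ETip) (\<sigma>5(B := Tip)) 2 \<sigma>6"
        by (rule exec_Assign'; simp add: \<sigma>6_def)+
      with e5 have "exec ?w1 \<sigma>3 (1 + t5 + (1 + 2 + 2)) \<sigma>6"
        by (intro exec.Seq)
      moreover have "exec (While (Reg B) ?w1) \<sigma>6 2 \<sigma>6"
        using exec.WhileStop[of "Reg B" \<sigma>6 ?w1] M by (simp add: \<sigma>6_def numeral_eq_Suc)
      ultimately have "exec (While (Reg B) ?w1) \<sigma>3
          (1 + cost_expr (Reg B) \<sigma>3 + (1 + t5 + (1 + 2 + 2)) + 2) \<sigma>6"
        using False by (intro exec.WhileStep[where \<sigma>' = \<sigma>6]) (auto simp: s3)
      moreover have "exec (While (Reg N) ?w2) \<sigma>6 2 \<sigma>6"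
        using exec.WhileStop[of "Reg N" \<sigma>6 ?w2] M by (simp add: \<sigma>6_def numeral_eq_Suc)
      ultimately have "exec (Seq (While (Reg B) ?w1) (While (Reg N) ?w2)) \<sigma>3
        (1 + (1 + cost_expr (Reg B) \<sigma>3 + (1 + t5 + (1 + 2 + 2)) + 2) + 2) \<sigma>6"
        by (rule exec.Seq)
      note run = this
      have "\<sigma>6 R = y" using e5 M by (simp add: \<sigma>6_def)
      then show ?thesis using e5(2)
        by - (intro exI conjI, rule run, simp_all add: s3)
    next
      case True
      have w1: "exec (While (Reg B) ?w1) \<sigma>3 2 \<sigma>3"
        using exec.WhileStop[of "Reg B" \<sigma>3 ?w1] True by (simp add: s3 numeral_eq_Suc)
      from r2 True have "runs c3 (\<sigma>3 M) t' y" by (simp add: s3)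
      from exec_call[where \<sigma> = \<sigma>3 and a = M, OF this m(3) M(1) M(4)] obtain t5 \<sigma>5 where
        e5: "exec (call c3 m M R) \<sigma>3 t5 \<sigma>5" "t5 \<le> 2 * (t' + size x) + 3 * m + 9" "\<sigma>5 R = y"
        by (auto simp: s3)
      define \<sigma>6 where "\<sigma>6 = \<sigma>5(N := Tip)"
      have "exec (Assign N ETip) \<sigma>5 2 \<sigma>6"
        by (rule exec_Assign'; simp add: \<sigma>6_def)+
      with e5 have "exec ?w2 \<sigma>3 (1 + t5 + 2) \<sigma>6"
        by (intro exec.Seq)
      moreover have "exec (While (Reg N) ?w2) \<sigma>6 2 \<sigma>6"
        using exec.WhileStop[of "Reg N" \<sigma>6 ?w2] M by (simp add: \<sigma>6_def numeral_eq_Suc)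
      ultimately have "exec (While (Reg N) ?w2) \<sigma>3
          (1 + cost_expr (Reg N) \<sigma>3 + (1 + t5 + 2) + 2) \<sigma>6"
        by (intro exec.WhileStep[where \<sigma>' = \<sigma>6]) (auto simp: s3)
      with w1 have "exec (Seq (While (Reg B) ?w1) (While (Reg N) ?w2)) \<sigma>3
        (1 + 2 + (1 + cost_expr (Reg N) \<sigma>3 + (1 + t5 + 2) + 2)) \<sigma>6"
        by (rule exec.Seq)
      note run = this
      have "\<sigma>6 R = y" using e5 M by (simp add: \<sigma>6_def)
      then show ?thesis using e5(2)
        by - (intro exI conjI, rule run, simp_all add: s3)
    qed
    then obtain t4 \<sigma>4 where e4: "exec (Seq (While (Reg B) ?w1) (While (Reg N) ?w2)) \<sigma>3 t4 \<sigma>4"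
      "\<sigma>4 R = y" "t4 \<le> 2 * (t' + size x) + 3 * m + 30 + size b" by blast
    then obtain u1 u2 \<rho> where u: "exec (While (Reg B) ?w1) \<sigma>3 u1 \<rho>"
      "exec (While (Reg N) ?w2) \<rho> u2 \<sigma>4" "t4 = 1 + u1 + u2"
      by (auto elim: exec.cases)
    have e5: "exec (Assign 0 (Reg R)) \<sigma>4 (2 + size y) (\<sigma>4(0 := y))"
      by (rule exec_Assign') (auto simp: e4)
    have "runs ?c x (1 + (2 + size x) + (1 + t2 + (1 + 4 + (1 + u1 + (1 + u2 + (2 + size y)))))) y"
      by (rule runsI[OF exec.Seq[OF e1 exec.Seq[OF e2(1) exec.Seq[OF e3
            exec.Seq[OF u(1) exec.Seq[OF u(2) e5]]]]]]) simp
    note run = this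
    show ?thesis
      using e2(2) e4(3) u(3) b y
      by - (intro exI conjI, rule run, auto simp: algebra_simps)
  qed
  then show ?thesis by blast
qed

text \<open>\<open>f\<close> is the sequence of loop states, and \<open>T\<close> bounds all tests,
  steps and state sizes uniformly. The quantifiers are ordered so that \<open>c\<close> and
  \<open>K\<close> depend on \<open>c1\<close> and \<open>c2\<close> alone.\<close>

lemma runs_while:
  "\<exists>c K. \<forall>n f T.
     (\<forall>i<n. \<exists>y t. runs c1 (f i) t y \<and> y \<noteq> Tip \<and> t \<le> T) \<longrightarrow>
     (\<exists>t. runs c1 (f n) t Tip \<and> t \<le> T) \<longrightarrow>
     (\<forall>i<n. \<exists>t. runs c2 (f i) t (f (Suc i)) \<and> t \<le> T) \<longrightarrow>
     (\<forall>i\<le>n. size (f i) \<le> T) \<longrightarrow>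
     (\<exists>t. runs c (f 0) t (f n) \<and> t \<le> K * (n + 1) * (T + 1))"
proof -
  define m where "m = reg_bound c1 + reg_bound c2"
  have m: "reg_bound c1 \<le> Suc m" "reg_bound c2 \<le> Suc m" by (auto simp: m_def)
  define M where "M = Suc m"
  define B where "B = Suc M"
  have M: "m < M" "m < B" "M > 0" "B > 0" "M \<noteq> B"
    by (auto simp: M_def B_def)
  \<comment> \<open>\<open>While\<close> can only inspect an expression, so the body advances the
    state and then already evaluates the test for the next round.\<close>
  define w where "w = Seq (call c2 m M M) (call c1 m M B)"
  let ?c = "Seq (Assign M (Reg 0)) (Seq (call c1 m M B) (Seq (While (Reg B) w) (Assign 0 (Reg M))))"
  have "\<exists>t. runs ?c (f 0) t (f n) \<and> t \<le> (6 * m + 100) * (n + 1) * (T + 1)"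
    if b: "\<forall>i<n. \<exists>y t. runs c1 (f i) t y \<and> y \<noteq> Tip \<and> t \<le> T"
      and bn: "\<exists>t. runs c1 (f n) t Tip \<and> t \<le> T"
      and st: "\<forall>i<n. \<exists>t. runs c2 (f i) t (f (Suc i)) \<and> t \<le> T"
      and sz: "\<forall>i\<le>n. size (f i) \<le> T" for n f T
  proof -
    have b': "\<exists>y t. runs c1 (f i) t y \<and> t \<le> T \<and> (y = Tip \<longleftrightarrow> i = n)" if "i \<le> n" for i
      using b bn that by (metis le_neq_implies_less less_irrefl)
    then obtain g where g: "\<And>i. i \<le> n \<Longrightarrow> \<exists>t. runs c1 (f i) t (g i) \<and> t \<le> T"
        "\<And>i. i \<le> n \<Longrightarrow> g i = Tip \<longleftrightarrow> i = n"
      by metis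
    have gs: "size (g i) \<le> 2 * T" if "i \<le> n" for i
      using g(1)[OF that] sz that runs_size by (metis add_mono le_trans mult_2)
    \<comment> \<open>A round makes two calls, each costing at most
      \<open>4 * T + 3 * m + 9\<close>, and reads a test result of size at most
      \<open>2 * T\<close>; the constant leaves some slack.\<close>
    define K where "K = 13 * T + 6 * m + 23"
    \<comment> \<open>Induction on the number \<open>k\<close> of rounds still to go, so the current
      index is \<open>n - k\<close>.\<close>
    have loop: "\<exists>t \<sigma>'. exec (While (Reg B) w) \<sigma> t \<sigma>' \<and> \<sigma>' M = f n \<and> t \<le> k * K + 2"
      if "\<sigma> M = f (n - k)" "\<sigma> B = g (n - k)" "k \<le> n" for k \<sigma>
      using that
    proof (induction k arbitrary: \<sigma>)
      case 0
      have "exec (While (Reg B) w) \<sigma> 2 \<sigma>"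
        using exec.WhileStop[of "Reg B" \<sigma> w] 0 g(2)[of n] by (simp add: numeral_eq_Suc)
      with 0 show ?case by (intro exI[of _ 2] exI[of _ \<sigma>]) simp
    next
      case (Suc k)
      define i where "i = n - Suc k"
      have i: "i < n" "Suc i = n - k" using Suc by (auto simp: i_def)
      obtain t1 where t1: "runs c2 (f i) t1 (f (Suc i))" "t1 \<le> T" using st i by blast
      then have "runs c2 (\<sigma> M) t1 (f (Suc i))" using Suc by (simp add: i_def)
      from exec_call[where \<sigma> = \<sigma> and a = M, OF this m(2) M(1) M(1)] obtain u1 \<sigma>1 where
        e1: "exec (call c2 m M M) \<sigma> u1 \<sigma>1" "u1 \<le> 2 * (t1 + size (f i)) + 3 * m + 9"
        "\<sigma>1 M = f (Suc i)"
        using Suc by (auto simp: i_def)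
      obtain t2 where t2: "runs c1 (f (Suc i)) t2 (g (Suc i))" "t2 \<le> T" using g(1)[of "Suc i"] i by auto
      then have "runs c1 (\<sigma>1 M) t2 (g (Suc i))" by (simp add: e1)
      from exec_call[where \<sigma> = \<sigma>1 and a = M, OF this m(1) M(1) M(2)] obtain u2 \<sigma>2 where
        e2: "exec (call c1 m M B) \<sigma>1 u2 \<sigma>2" "u2 \<le> 2 * (t2 + size (f (Suc i))) + 3 * m + 9"
        "\<sigma>2 B = g (Suc i)" "\<sigma>2 M = f (Suc i)"
        using M by (auto simp: e1)
      obtain u3 \<sigma>3 where
        e3: "exec (While (Reg B) w) \<sigma>2 u3 \<sigma>3" "\<sigma>3 M = f n" "u3 \<le> k * K + 2"
        using Suc.IH[of \<sigma>2] e2 i Suc.prems by (metis Suc_leD)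
      have "exec w \<sigma> (1 + u1 + u2) \<sigma>2"
        unfolding w_def by (rule exec.Seq[OF e1(1) e2(1)])
      then have "exec (While (Reg B) w) \<sigma> (1 + cost_expr (Reg B) \<sigma> + (1 + u1 + u2) + u3) \<sigma>3"
        using Suc.prems(2) g(2)[of i] i
        by (intro exec.WhileStep[OF _ _ e3(1)]) (simp_all add: i_def[symmetric])
      moreover have "1 + cost_expr (Reg B) \<sigma> + (1 + u1 + u2) + u3 \<le> Suc k * K + 2"
        using e1(2) e2(2) e3(3) t1(2) t2(2) gs[of i] i sz[rule_format, of i]
          sz[rule_format, of "Suc i"] Suc
        by (simp add: i_def[symmetric] K_def)
      ultimately show ?case using e3 by blast
    qed
    define \<sigma>1 where "\<sigma>1 = (init_store (f 0))(M := f 0)"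
    have e1: "exec (Assign M (Reg 0)) (init_store (f 0)) (2 + size (f 0)) \<sigma>1"
      by (rule exec_Assign') (auto simp: \<sigma>1_def)
    have x: "\<sigma>1 M = f 0" by (simp add: \<sigma>1_def)
    obtain t where t: "runs c1 (\<sigma>1 M) t (g 0)" "t \<le> T" using g(1)[of 0] by (auto simp: x)
    from exec_call[where \<sigma> = \<sigma>1 and a = M, OF t(1) m(1) M(1) M(2)] obtain t2 \<sigma>2 where
      e2: "exec (call c1 m M B) \<sigma>1 t2 \<sigma>2" "t2 \<le> 2 * (t + size (f 0)) + 3 * m + 9"
        "\<sigma>2 B = g 0" "\<sigma>2 M = f 0"
      using M x by auto
    obtain t3 \<sigma>3 where e3: "exec (While (Reg B) w) \<sigma>2 t3 \<sigma>3" "\<sigma>3 M = f n" "t3 \<le> n * K + 2"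
      using loop[of \<sigma>2 n] e2 by auto
    have e4: "exec (Assign 0 (Reg M)) \<sigma>3 (2 + size (f n)) (\<sigma>3(0 := f n))"
      by (rule exec_Assign') (auto simp: e3)
    have "runs ?c (f 0) (1 + (2 + size (f 0)) + (1 + t2 + (1 + t3 + (2 + size (f n))))) (f n)"
      by (rule runsI[OF exec.Seq[OF e1 exec.Seq[OF e2(1) exec.Seq[OF e3(1) e4]]]]) simp
    moreover have "1 + (2 + size (f 0)) + (1 + t2 + (1 + t3 + (2 + size (f n)))) \<le>
        6 * T + n * K + 3 * m + 18"
      using e2(2) e3(3) t(2) sz[rule_format, of 0] sz[rule_format, of n] by simp
    moreover have "\<dots> \<le> (6 * m + 100) * (n + 1) * (T + 1)"
      by (simp add: K_def algebra_simps)
    ultimately show ?thesis by (meson order.trans)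
  qed
  then show ?thesis by blast
qed

section \<open>Polynomial-time functions on encoded data\<close>

text \<open>Injectivity allows values to be compared through their codes, which is how the equality
  test is programmed for all types at once.\<close>

class encodable =
  fixes enc :: "'a \<Rightarrow> tree"
  assumes enc_inj: "enc x = enc y \<Longrightarrow> x = y"

lemma enc_eq_iff [simp]: "enc x = enc y \<longleftrightarrow> x = y"
  by (auto intro: enc_inj)

definition esize :: "'a::encodable \<Rightarrow> nat" where
  "esize x = size (enc x)"

text \<open>With trees coded by themselves, \<open>enc\<close> is a polynomial-time function into
  \<open>tree\<close>, so data of any type can be taken apart by \<open>tfst\<close> and
  \<open>tsnd\<close>.\<close>

instantiation tree :: encodable
begin
definition enc_tree :: "tree \<Rightarrow> tree" where "enc_tree t = t"
instance by standard (simp add: enc_tree_def)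
end

instantiation bool :: encodable
begin
definition enc_bool_inst: "enc = enc_bool"
instance by standard (auto simp: enc_bool_inst enc_bool_def split: if_splits)
end

lemma enc_nat_eq_iff: "enc_nat m = enc_nat n \<longleftrightarrow> m = n"
proof (induction m arbitrary: n)
  case 0
  then show ?case by (cases n) auto
next
  case (Suc m)
  then show ?case by (cases n) auto
qed

instantiation nat :: encodable
begin
definition enc_nat_inst: "enc = enc_nat"
instance by standard (simp add: enc_nat_inst enc_nat_eq_iff)
end

instantiation prod :: (encodable, encodable) encodable
begin
definition enc_prod_inst: "enc = enc_pair enc enc"
instance by standard (simp add: enc_prod_inst enc_pair_def prod_eq_iff)
end

lemma enc_list_inj: "(\<And>x y. f x = f y \<Longrightarrow> x = y) \<Longrightarrow> enc_list f xs = enc_list f ys \<Longrightarrow> xs = ys"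
proof (induction xs arbitrary: ys)
  case Nil
  then show ?case by (cases ys) auto
next
  case (Cons x xs)
  then show ?case by (cases ys) auto
qed

instantiation list :: (encodable) encodable
begin
definition enc_list_inst: "enc = enc_list enc"
instance by standard (auto simp: enc_list_inst intro: enc_list_inj enc_inj)
end

lemma enc_Pair [simp]: "enc (x, y) = Bin (enc x) (enc y)"
  by (simp add: enc_prod_inst enc_pair_def)

lemma enc_Nil [simp]: "enc [] = Tip"
  by (simp add: enc_list_inst)

lemma enc_Cons [simp]: "enc (x # xs) = Bin (enc x) (enc xs)"
  by (simp add: enc_list_inst)

lemma enc_0 [simp]: "enc (0::nat) = Tip"
  by (simp add: enc_nat_inst)

lemma enc_Suc [simp]: "enc (Suc n) = Bin Tip (enc n)"
  by (simp add: enc_nat_inst)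

lemma enc_True [simp]: "enc True = Bin Tip Tip"
  by (simp add: enc_bool_inst enc_bool_def)

lemma enc_False [simp]: "enc False = Tip"
  by (simp add: enc_bool_inst enc_bool_def)

lemma enc_tree [simp]: "enc (t::tree) = t"
  by (simp add: enc_tree_def)

lemma enc_name_eq: "enc_name = enc"
  by (simp add: enc_name_def enc_list_inst enc_bool_inst)

lemma esize_Pair [simp]: "esize (x, y) = esize x + esize y + 1"
  and esize_Nil [simp]: "esize [] = 0"
  and esize_Cons [simp]: "esize (x # xs) = esize x + esize xs + 1"
  and esize_tree [simp]: "esize (t::tree) = size t"
  by (simp_all add: esize_def)

lemma esize_prod: "esize p = esize (fst p) + esize (snd p) + 1"
  by (cases p) simp

text \<open>The code is unary, so a number can directly serve as a loop counter or as a size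
  bound.\<close>

lemma esize_nat [simp]: "esize (n::nat) = n"
  by (induction n) (simp_all add: esize_def)

lemma esize_bool: "esize (b::bool) \<le> 1"
  by (cases b) (simp_all add: esize_def)

lemma esize_append [simp]: "esize (xs @ ys) = esize xs + esize ys"
  by (induction xs) auto

lemma esize_rev [simp]: "esize (rev xs) = esize xs"
  by (induction xs) auto

lemma length_le_esize: "length xs \<le> esize xs"
  by (induction xs) auto

lemma esize_in_set: "x \<in> set xs \<Longrightarrow> esize x < esize xs"
  by (induction xs) auto

lemma esize_list_le: "(\<And>x. x \<in> set xs \<Longrightarrow> esize x \<le> b) \<Longrightarrow> esize xs \<le> length xs * (b + 1)"
proof (induction xs)
  case (Cons x xs)
  have "esize x \<le> b" using Cons.prems by simp
  moreover have "esize xs \<le> length xs * (b + 1)" using Cons by simp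
  ultimately show ?case by simp
qed simp

lemma esize_concat_le: "esize (concat xss) \<le> esize xss"
  by (induction xss) auto

lemma esize_remdups_le: "esize (remdups xs) \<le> esize xs"
  by (induction xs) auto

lemma esize_drop_le: "esize (drop n xs) \<le> esize xs"
  by (metis append_take_drop_id esize_append le_add2)

section \<open>Polynomial bounds\<close>

definition polybounded :: "('a::encodable \<Rightarrow> nat) \<Rightarrow> bool" where
  "polybounded f \<longleftrightarrow> (\<exists>C k. \<forall>x. f x \<le> C * (esize x + 1) ^ k)"

named_theorems polybounded_intros

lemma polybounded_const [polybounded_intros]: "polybounded (\<lambda>_. c)"
  unfolding polybounded_def by (intro exI[of _ c] exI[of _ 0]) simp

lemma polybounded_self [polybounded_intros]: "polybounded esize"
  unfolding polybounded_def by (intro exI[of _ 1] exI[of _ 1]) simp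

lemma polybounded_mono: "polybounded g \<Longrightarrow> (\<And>x. f x \<le> g x) \<Longrightarrow> polybounded f"
  unfolding polybounded_def by (meson order.trans)

lemma polybounded_add [polybounded_intros]:
  assumes "polybounded f" "polybounded g" shows "polybounded (\<lambda>x. f x + g x)"
proof -
  obtain C k D l where f: "\<And>x. f x \<le> C * (esize x + 1) ^ k" and g: "\<And>x. g x \<le> D * (esize x + 1) ^ l"
    using assms by (auto simp: polybounded_def)
  have "f x + g x \<le> (C + D) * (esize x + 1) ^ (k + l)" for x
  proof -
    have "C * (esize x + 1) ^ k \<le> C * (esize x + 1) ^ (k + l)"
      "D * (esize x + 1) ^ l \<le> D * (esize x + 1) ^ (k + l)"
      by (auto intro!: mult_le_mono2 power_increasing simp del: add_gr_0)
    with f[of x] g[of x] show ?thesis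
      unfolding add_mult_distrib by linarith
  qed
  then show ?thesis by (auto simp: polybounded_def)
qed

lemma polybounded_mult [polybounded_intros]:
  assumes "polybounded f" "polybounded g" shows "polybounded (\<lambda>x. f x * g x)"
proof -
  obtain C k D l where f: "\<And>x. f x \<le> C * (esize x + 1) ^ k" and g: "\<And>x. g x \<le> D * (esize x + 1) ^ l"
    using assms by (auto simp: polybounded_def)
  have "f x * g x \<le> (C * D) * (esize x + 1) ^ (k + l)" for x
    using mult_le_mono[OF f[of x] g[of x]] by (simp add: power_add mult_ac)
  then show ?thesis by (auto simp: polybounded_def)
qed

lemma polybounded_power [polybounded_intros]:
  "polybounded f \<Longrightarrow> polybounded (\<lambda>x. f x ^ n)"
  by (induction n) (auto intro: polybounded_intros)

text \<open>In a loop a function is applied to states \<open>y\<close> that differ from the input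
  \<open>x\<close>. The function \<open>f\<close> need not be monotone in the size, but the
  dominating \<open>C * (n + 1) ^ k\<close> is, and this yields a bound in terms of
  \<open>x\<close>.\<close>

lemma polybounded_uniform:
  fixes f :: "'a::encodable \<Rightarrow> nat" and S :: "'b::encodable \<Rightarrow> nat"
  assumes "polybounded f" "polybounded S"
  obtains P where "polybounded P" "\<And>x y. esize y \<le> S x \<Longrightarrow> f y \<le> P x"
proof -
  obtain C k where f: "\<And>x. f x \<le> C * (esize x + 1) ^ k"
    using assms(1) by (auto simp: polybounded_def)
  show thesis
  proof
    show "polybounded (\<lambda>x. C * (S x + 1) ^ k)"
      by (intro polybounded_intros assms)
    fix x and y :: 'a assume "esize y \<le> S x"
    then have "C * (esize y + 1) ^ k \<le> C * (S x + 1) ^ k"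
      by (intro mult_le_mono2 power_mono) auto
    with f[of y] show "f y \<le> C * (S x + 1) ^ k" by linarith
  qed
qed

lemma polybounded_comp:
  assumes "polybounded f" "polybounded (\<lambda>x. esize (g x))"
  shows "polybounded (\<lambda>x. f (g x))"
  using polybounded_uniform[OF assms] by (metis order_refl polybounded_mono)

section \<open>Polynomial-time functions and their closure properties\<close>

definition polytime :: "('a::encodable \<Rightarrow> 'b::encodable) \<Rightarrow> bool" where
  "polytime f \<longleftrightarrow> (\<exists>c T. polybounded T \<and> (\<forall>x. \<exists>t\<le>T x. runs c (enc x) t (enc (f x))))"

lemma polytimeI:
  "polybounded T \<Longrightarrow> (\<And>x. \<exists>t\<le>T x. runs c (enc x) t (enc (f x))) \<Longrightarrow> polytime f"
  unfolding polytime_def by blast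

named_theorems polytime_intros

lemma polytime_esize: "polytime f \<Longrightarrow> polybounded (\<lambda>x. esize (f x))"
  unfolding polytime_def
proof (elim exE conjE)
  fix c T assume "polybounded T" and r: "\<forall>x. \<exists>t\<le>T x. runs c (enc x) t (enc (f x))"
  have "esize (f x) \<le> esize x + T x" for x
  proof -
    obtain t where "t \<le> T x" "runs c (enc x) t (enc (f x))" using r by blast
    then show ?thesis using runs_size unfolding esize_def by fastforce
  qed
  then show ?thesis
    by (rule polybounded_mono[rotated]) (intro polybounded_intros \<open>polybounded T\<close>)
qed

lemma polytime_length: "polytime f \<Longrightarrow> polybounded (\<lambda>x. length (f x))"
  by (rule polybounded_mono[OF polytime_esize]) (auto intro: length_le_esize)

text \<open>Time and result are judged on codes only, so a function may be realised by one of a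
  different type with the same codes: \<open>Cons\<close> by pairing, a number by a list of
  \<open>Tip\<close>s.\<close>

lemma polytime_enc_cong: "polytime f \<Longrightarrow> (\<And>x. enc (f x) = enc (g x)) \<Longrightarrow> polytime g"
  unfolding polytime_def by simp

lemma polytime_enc_iff: "polytime (\<lambda>x. enc (f x)) \<longleftrightarrow> polytime f"
  unfolding polytime_def by simp

lemma polytime_expr:
  assumes "\<And>x. enc (f x) = eval_expr e (init_store (enc x))"
    and "\<And>x. cost_expr e (init_store x) \<le> k * (size x + 1)"
  shows "polytime f"
  unfolding polytime_def
proof (intro exI conjI allI)
  show "polybounded (\<lambda>x. 1 + k * (esize x + 1))"
    by (intro polybounded_intros)
  show "runs (Assign 0 e) (enc x) (1 + cost_expr e (init_store (enc x))) (enc (f x))" for x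
    by (rule runsI, rule exec.Assign) (simp add: assms(1))
  show "1 + cost_expr e (init_store (enc x)) \<le> 1 + k * (esize x + 1)" for x
    using assms(2) by (simp add: esize_def)
qed

lemma polytime_id [polytime_intros]: "polytime (\<lambda>x. x)"
  by (rule polytime_expr[of _ "Reg 0" 1]) auto

lemma polytime_const [polytime_intros]: "polytime (\<lambda>_. c)"
proof -
  \<comment> \<open>The tree is turned into an expression that rebuilds it, at a cost independent of
    the input.\<close>
  define e where "e = rec_tree ETip (\<lambda>_ _. EBin)"
  have "eval_expr (e t) \<sigma> = t" and c: "cost_expr (e t) \<sigma> \<le> 2 * size t + 1" for t \<sigma>
    by (induction t) (auto simp: e_def)
  then show ?thesis
    by (intro polytime_expr[of _ "e (enc c)" "2 * size (enc c) + 1"])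
      (auto intro: order_trans[OF c])
qed

lemma polytime_comp:
  assumes "polytime f" "polytime g" shows "polytime (\<lambda>x. g (f x))"
proof -
  obtain c1 T1 where 1: "polybounded T1" "\<And>x. \<exists>t\<le>T1 x. runs c1 (enc x) t (enc (f x))"
    using assms(1) by (auto simp: polytime_def)
  obtain c2 T2 where 2: "polybounded T2" "\<And>x. \<exists>t\<le>T2 x. runs c2 (enc x) t (enc (g x))"
    using assms(2) by (auto simp: polytime_def)
  obtain c K where c: "\<And>x t y t' z. runs c1 x t y \<Longrightarrow> runs c2 y t' z \<Longrightarrow>
     \<exists>t''. runs c x t'' z \<and> t'' \<le> K * (t + t' + size x + 1)"
    using runs_seq[of c1 c2] by blast
  have "\<exists>t\<le>K * (T1 x + T2 (f x) + esize x + 1). runs c (enc x) t (enc (g (f x)))" for x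
  proof -
    obtain t t' where "t \<le> T1 x" "runs c1 (enc x) t (enc (f x))"
      "t' \<le> T2 (f x)" "runs c2 (enc (f x)) t' (enc (g (f x)))"
      using 1 2 by metis
    with c obtain t'' where "runs c (enc x) t'' (enc (g (f x)))" "t'' \<le> K * (t + t' + esize x + 1)"
      unfolding esize_def by blast
    moreover have "K * (t + t' + esize x + 1) \<le> K * (T1 x + T2 (f x) + esize x + 1)"
      using \<open>t \<le> T1 x\<close> \<open>t' \<le> T2 (f x)\<close> by (intro mult_le_mono2) auto
    ultimately show ?thesis by (meson order.trans)
  qed
  moreover have "polybounded (\<lambda>x. K * (T1 x + T2 (f x) + esize x + 1))"
    by (intro polybounded_intros 1 polybounded_comp[OF 2(1)] polytime_esize assms)
  ultimately show ?thesis unfolding polytime_def by blast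
qed

lemma polytime_Pair [polytime_intros]:
  assumes "polytime f" "polytime g" shows "polytime (\<lambda>x. (f x, g x))"
proof -
  obtain c1 T1 where 1: "polybounded T1" "\<And>x. \<exists>t\<le>T1 x. runs c1 (enc x) t (enc (f x))"
    using assms(1) by (auto simp: polytime_def)
  obtain c2 T2 where 2: "polybounded T2" "\<And>x. \<exists>t\<le>T2 x. runs c2 (enc x) t (enc (g x))"
    using assms(2) by (auto simp: polytime_def)
  obtain c K where c: "\<And>x t y t' z. runs c1 x t y \<Longrightarrow> runs c2 x t' z \<Longrightarrow>
     \<exists>t''. runs c x t'' (Bin y z) \<and> t'' \<le> K * (t + t' + size x + 1)"
    using runs_pair[of c1 c2] by blast
  have "\<exists>t\<le>K * (T1 x + T2 x + esize x + 1). runs c (enc x) t (enc (f x, g x))" for x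
  proof -
    obtain t t' where "t \<le> T1 x" "runs c1 (enc x) t (enc (f x))"
      "t' \<le> T2 x" "runs c2 (enc x) t' (enc (g x))"
      using 1 2 by metis
    with c[of "enc x" t "enc (f x)" t' "enc (g x)"] obtain t'' where
      "runs c (enc x) t'' (enc (f x, g x))" "t'' \<le> K * (t + t' + esize x + 1)"
      by (auto simp: esize_def)
    moreover have "K * (t + t' + esize x + 1) \<le> K * (T1 x + T2 x + esize x + 1)"
      using \<open>t \<le> T1 x\<close> \<open>t' \<le> T2 x\<close> by (intro mult_le_mono2) auto
    ultimately show ?thesis by (meson order.trans)
  qed
  moreover have "polybounded (\<lambda>x. K * (T1 x + T2 x + esize x + 1))"
    by (intro polybounded_intros 1 2)
  ultimately show ?thesis unfolding polytime_def by blast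
qed

lemma polytime_apply2:
  assumes "polytime (\<lambda>p. F (fst p) (snd p))" "polytime f" "polytime g"
  shows "polytime (\<lambda>x. F (f x) (g x))"
  using polytime_comp[OF polytime_Pair[OF assms(2,3)] assms(1)] by simp

lemma polytime_tfst [polytime_intros]: "polytime f \<Longrightarrow> polytime (\<lambda>x. tfst (f x))"
  by (rule polytime_comp[where g = tfst]) (auto intro!: polytime_expr[of _ "EFst (Reg 0)" 2])

lemma polytime_tsnd [polytime_intros]: "polytime f \<Longrightarrow> polytime (\<lambda>x. tsnd (f x))"
  by (rule polytime_comp[where g = tsnd]) (auto intro!: polytime_expr[of _ "ESnd (Reg 0)" 2])

lemma polytime_enc [polytime_intros]: "polytime f \<Longrightarrow> polytime (\<lambda>x. enc (f x))"
  by (simp add: polytime_enc_iff)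

lemma polytime_fst [polytime_intros]: "polytime f \<Longrightarrow> polytime (\<lambda>x. fst (f x))"
  by (rule polytime_enc_cong[where f = "\<lambda>x. tfst (enc (f x))"], intro polytime_intros)
    (auto simp: enc_prod_inst enc_pair_def)

lemma polytime_snd [polytime_intros]: "polytime f \<Longrightarrow> polytime (\<lambda>x. snd (f x))"
  by (rule polytime_enc_cong[where f = "\<lambda>x. tsnd (enc (f x))"], intro polytime_intros)
    (auto simp: enc_prod_inst enc_pair_def)

lemma polytime_Cons [polytime_intros]:
  "polytime f \<Longrightarrow> polytime g \<Longrightarrow> polytime (\<lambda>x. f x # g x)"
  by (rule polytime_enc_cong[where f = "\<lambda>x. (f x, g x)"], intro polytime_intros) auto

lemma polytime_Suc [polytime_intros]: "polytime f \<Longrightarrow> polytime (\<lambda>x. Suc (f x))"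
  by (rule polytime_enc_cong[where f = "\<lambda>x. (Tip, f x)"], intro polytime_intros) auto

text \<open>The branches are given as programs rather than as polynomial-time functions, because a
  branch may make sense only on the inputs that reach it, such as those with a non-empty
  list.\<close>

lemma polytime_branch:
  assumes "polytime b" "polybounded T"
    and "\<And>x. enc (b x) \<noteq> Tip \<Longrightarrow> \<exists>t\<le>T x. runs c2 (enc x) t (enc (f x))"
    and "\<And>x. enc (b x) = Tip \<Longrightarrow> \<exists>t\<le>T x. runs c3 (enc x) t (enc (f x))"
  shows "polytime f"
proof -
  obtain c1 T1 where 1: "polybounded T1" "\<And>x. \<exists>t\<le>T1 x. runs c1 (enc x) t (enc (b x))"
    using assms(1) by (auto simp: polytime_def)
  obtain c K where c: "\<And>x t b t' y. runs c1 x t b \<Longrightarrow>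
     (if b \<noteq> Tip then runs c2 x t' y else runs c3 x t' y) \<Longrightarrow>
     (\<exists>t''. runs c x t'' y \<and> t'' \<le> K * (t + t' + size x + 1))"
    using runs_if[of c1 c2 c3] by blast
  have "\<exists>t\<le>K * (T1 x + T x + esize x + 1). runs c (enc x) t (enc (f x))" for x
  proof -
    obtain t t' where "t \<le> T1 x" "runs c1 (enc x) t (enc (b x))" "t' \<le> T x"
      "if enc (b x) \<noteq> Tip then runs c2 (enc x) t' (enc (f x)) else runs c3 (enc x) t' (enc (f x))"
      using 1 assms(3,4) by metis
    with c obtain t'' where "runs c (enc x) t'' (enc (f x))" "t'' \<le> K * (t + t' + esize x + 1)"
      unfolding esize_def by blast
    moreover have "K * (t + t' + esize x + 1) \<le> K * (T1 x + T x + esize x + 1)"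
      using \<open>t \<le> T1 x\<close> \<open>t' \<le> T x\<close> by (intro mult_le_mono2) auto
    ultimately show ?thesis by (meson order.trans)
  qed
  moreover have "polybounded (\<lambda>x. K * (T1 x + T x + esize x + 1))"
    by (intro polybounded_intros 1 assms)
  ultimately show ?thesis unfolding polytime_def by blast
qed

lemma polytime_if_Tip:
  assumes "polytime b" "polytime f" "polytime g"
  shows "polytime (\<lambda>x. if b x = Tip then f x else g x)"
proof -
  obtain c1 T1 where 1: "polybounded T1" "\<And>x. \<exists>t\<le>T1 x. runs c1 (enc x) t (enc (f x))"
    using assms(2) by (auto simp: polytime_def)
  obtain c2 T2 where 2: "polybounded T2" "\<And>x. \<exists>t\<le>T2 x. runs c2 (enc x) t (enc (g x))"
    using assms(3) by (auto simp: polytime_def)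
  show ?thesis
  proof (rule polytime_branch[OF assms(1), of "\<lambda>x. T1 x + T2 x" c2 _ c1])
    show "polybounded (\<lambda>x. T1 x + T2 x)" by (intro polybounded_intros 1 2)
    fix x
    show "enc (b x) \<noteq> Tip \<Longrightarrow> \<exists>t\<le>T1 x + T2 x. runs c2 (enc x) t (enc (if b x = Tip then f x else g x))"
      using 2(2)[of x] by (auto intro: trans_le_add2)
    show "enc (b x) = Tip \<Longrightarrow> \<exists>t\<le>T1 x + T2 x. runs c1 (enc x) t (enc (if b x = Tip then f x else g x))"
      using 1(2)[of x] by (auto intro: trans_le_add1)
  qed
qed

lemma polytime_if [polytime_intros]:
  assumes "polytime b" "polytime f" "polytime g"
  shows "polytime (\<lambda>x. if b x then f x else g x)"
proof -
  have "polytime (\<lambda>x. if enc (b x) = Tip then g x else f x)"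
    by (intro polytime_if_Tip polytime_enc assms)
  then show ?thesis
  proof (rule polytime_enc_cong)
    show "enc (if enc (b x) = Tip then g x else f x) = enc (if b x then f x else g x)" for x
      by (cases "b x") auto
  qed
qed

lemma polytime_eq_Tip: "polytime f \<Longrightarrow> polytime (\<lambda>x. f x = Tip)"
  by (rule polytime_enc_cong[where f = "\<lambda>x. if f x = Tip then True else False"],
      intro polytime_if_Tip polytime_const) auto

lemma polytime_not [polytime_intros]: "polytime f \<Longrightarrow> polytime (\<lambda>x. \<not> f x)"
  by (rule polytime_enc_cong[where f = "\<lambda>x. if f x then False else True"],
      intro polytime_intros) auto

lemma enc_eq_Tip_iff: "enc (xs::'a::encodable list) = Tip \<longleftrightarrow> xs = []"
  by (cases xs) auto

lemma polytime_eq_Nil [polytime_intros]: "polytime f \<Longrightarrow> polytime (\<lambda>x. f x = [])"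
  by (rule polytime_enc_cong[OF polytime_eq_Tip[OF polytime_enc]]) (auto simp: enc_eq_Tip_iff)

lemma polytime_case_list [polytime_intros]:
  assumes "polytime L" "polytime N" "polytime (\<lambda>p. F (fst p) (fst (snd p)) (snd (snd p)))"
  shows "polytime (\<lambda>x. case L x of [] \<Rightarrow> N x | y # ys \<Rightarrow> F x y ys)"
proof -
  obtain c1 T1 where 1: "polybounded T1" "\<And>x. \<exists>t\<le>T1 x. runs c1 (enc x) t (enc (N x))"
    using assms(2) by (auto simp: polytime_def)
  obtain c2 T2 where 2: "polybounded T2"
    "\<And>x y ys. \<exists>t\<le>T2 (x, y, ys). runs c2 (enc (x, y, ys)) t (enc (F x y ys))"
    using assms(3) by (fastforce simp: polytime_def)
  have p: "polytime (\<lambda>x. (x, L x))" by (intro polytime_intros assms)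
  then obtain c0 T0 where 0: "polybounded T0" "\<And>x. \<exists>t\<le>T0 x. runs c0 (enc x) t (enc (x, L x))"
    by (auto simp: polytime_def)
  obtain c K where c: "\<And>x t y t' z. runs c0 x t y \<Longrightarrow> runs c2 y t' z \<Longrightarrow>
     \<exists>t''. runs c x t'' z \<and> t'' \<le> K * (t + t' + size x + 1)"
    using runs_seq[of c0 c2] by blast
  obtain P where P: "polybounded P" "\<And>x y. esize y \<le> esize (x, L x) \<Longrightarrow> T2 y \<le> P x"
    using polybounded_uniform[OF 2(1) polytime_esize[OF p]] by blast
  show ?thesis
  proof (rule polytime_branch[OF assms(1), of "\<lambda>x. K * (T0 x + P x + esize x + 1) + T1 x" c _ c1])
    show "polybounded (\<lambda>x. K * (T0 x + P x + esize x + 1) + T1 x)"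
      by (intro polybounded_intros 0 P 1)
  next
    fix x assume "enc (L x) \<noteq> Tip"
    then obtain y ys where L: "L x = y # ys" by (cases "L x") auto
    obtain t t' where "t \<le> T0 x" "runs c0 (enc x) t (enc (x, L x))"
      "t' \<le> T2 (x, y, ys)" "runs c2 (enc (x, y, ys)) t' (enc (F x y ys))"
      using 0 2 by metis
    moreover from this have "t' \<le> P x"
      using P(2)[of "(x, y, ys)" x] L by simp
    \<comment> \<open>A non-empty list has the code of the pair of its head and tail, so the second
      program can run on the code of \<open>(x, L x)\<close> as it is.\<close>
    moreover have "enc (x, L x) = enc (x, y, ys)" using L by simp
    ultimately obtain t'' where "runs c (enc x) t'' (enc (F x y ys))"
      "t'' \<le> K * (t + t' + esize x + 1)"
      using c unfolding esize_def by metis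
    moreover have "K * (t + t' + esize x + 1) \<le> K * (T0 x + P x + esize x + 1)"
      using \<open>t \<le> T0 x\<close> \<open>t' \<le> P x\<close> by (intro mult_le_mono2) auto
    ultimately have "t'' \<le> K * (T0 x + P x + esize x + 1) + T1 x"
      by linarith
    with \<open>runs c (enc x) t'' _\<close> show "\<exists>t\<le>K * (T0 x + P x + esize x + 1) + T1 x.
        runs c (enc x) t (enc (case L x of [] \<Rightarrow> N x | y # ys \<Rightarrow> F x y ys))"
      using L by auto
  next
    fix x assume "enc (L x) = Tip"
    then have "L x = []" by (simp add: enc_eq_Tip_iff)
    then show "\<exists>t\<le>K * (T0 x + P x + esize x + 1) + T1 x.
        runs c1 (enc x) t (enc (case L x of [] \<Rightarrow> N x | y # ys \<Rightarrow> F x y ys))"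
      using 1(2)[of x] by (auto intro: trans_le_add2)
  qed
qed

text \<open>Iterating a polynomial-time step polynomially often can still blow up the state, for
  instance by repeated doubling. Besides correctness, the invariant \<open>I\<close> must therefore
  yield a size bound \<open>S\<close> in terms of the original input; \<open>\<mu>\<close> only
  limits the number of rounds.\<close>

lemma polytime_while:
  fixes init :: "'a::encodable \<Rightarrow> 's::encodable"
  assumes "polytime init" "polytime b" "polytime step" "polytime out"
    and N: "polybounded N" and S: "polybounded S"
    and init: "\<And>x. I x (init x)" "\<And>x. \<mu> (init x) \<le> N x"
    and step: "\<And>x s. I x s \<Longrightarrow> b s \<Longrightarrow> I x (step s) \<and> \<mu> (step s) < (\<mu> s :: nat)"
    and size: "\<And>x s. I x s \<Longrightarrow> esize s \<le> S x"
    and out: "\<And>x s. I x s \<Longrightarrow> \<not> b s \<Longrightarrow> out s = r x"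
  shows "polytime r"
proof -
  obtain c1 T1 where 1: "polybounded T1" "\<And>x. \<exists>t\<le>T1 x. runs c1 (enc x) t (enc (b x))"
    using assms(2) by (auto simp: polytime_def)
  obtain c2 T2 where 2: "polybounded T2" "\<And>x. \<exists>t\<le>T2 x. runs c2 (enc x) t (enc (step x))"
    using assms(3) by (auto simp: polytime_def)
  obtain P1 where P1: "polybounded P1" "\<And>x y. esize y \<le> S x \<Longrightarrow> T1 y \<le> P1 x"
    using polybounded_uniform[OF 1(1) S] by blast
  obtain P2 where P2: "polybounded P2" "\<And>x y. esize y \<le> S x \<Longrightarrow> T2 y \<le> P2 x"
    using polybounded_uniform[OF 2(1) S] by blast
  obtain c K where c: "\<And>n f T.
     (\<forall>i<n. \<exists>y t. runs c1 (f i) t y \<and> y \<noteq> Tip \<and> t \<le> T) \<Longrightarrow>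
     (\<exists>t. runs c1 (f n) t Tip \<and> t \<le> T) \<Longrightarrow>
     (\<forall>i<n. \<exists>t. runs c2 (f i) t (f (Suc i)) \<and> t \<le> T) \<Longrightarrow>
     (\<forall>i\<le>n. size (f i) \<le> T) \<Longrightarrow>
     (\<exists>t. runs c (f 0) t (f n) \<and> t \<le> K * (n + 1) * (T + 1))"
    using runs_while[of c1 c2] by blast
  \<comment> \<open>The invariant is recorded up to and including the first state that fails the
    test, since that state is tested and read as well.\<close>
  have iter: "\<exists>n\<le>\<mu> s. (\<forall>i<n. b ((step ^^ i) s)) \<and> \<not> b ((step ^^ n) s) \<and> (\<forall>i\<le>n. I x ((step ^^ i) s))"
    if "I x s" for x s
    using that
  proof (induction "\<mu> s" arbitrary: s rule: less_induct)
    case less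
    show ?case
    proof (cases "b s")
      case True
      with step[OF less.prems] less.hyps obtain n where
        n: "n \<le> \<mu> (step s)" "\<forall>i<n. b ((step ^^ i) (step s))" "\<not> b ((step ^^ n) (step s))"
          "\<forall>i\<le>n. I x ((step ^^ i) (step s))" by blast
      have "b ((step ^^ i) s)" if "i < Suc n" for i
        using that n True by (cases i) (auto simp: funpow_swap1)
      moreover have "I x ((step ^^ i) s)" if "i \<le> Suc n" for i
        using that n less.prems by (cases i) (auto simp: funpow_swap1)
      moreover have "\<not> b ((step ^^ Suc n) s)" using n by (simp add: funpow_swap1)
      moreover have "Suc n \<le> \<mu> s" using step[OF less.prems True] n by linarith
      ultimately show ?thesis by blast
    next
      case False
      then show ?thesis using less.prems by (intro exI[of _ 0]) auto
    qed
  qed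
  have "\<exists>n\<le>N x. (\<forall>i<n. b ((step ^^ i) (init x))) \<and> \<not> b ((step ^^ n) (init x)) \<and>
      (\<forall>i\<le>n. I x ((step ^^ i) (init x)))" for x
    using iter[OF init(1)[of x]] init(2)[of x] by (meson order.trans)
  then obtain n where n: "\<And>x. n x \<le> N x" "\<And>x i. i < n x \<Longrightarrow> b ((step ^^ i) (init x))"
    "\<And>x. \<not> b ((step ^^ n x) (init x))" "\<And>x i. i \<le> n x \<Longrightarrow> I x ((step ^^ i) (init x))"
    by metis
  define final where "final x = (step ^^ n x) (init x)" for x
  define Q where "Q x = P1 x + P2 x + S x" for x
  have "\<exists>t. runs c (enc (init x)) t (enc (final x)) \<and> t \<le> K * (n x + 1) * (Q x + 1)" for x
  proof -
    define f where "f i = enc ((step ^^ i) (init x))" for i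
    have sz: "esize ((step ^^ i) (init x)) \<le> S x" if "i \<le> n x" for i
      using size n(4) that by blast
    have tm: "T1 ((step ^^ i) (init x)) \<le> Q x" "T2 ((step ^^ i) (init x)) \<le> Q x" if "i \<le> n x" for i
      using P1(2)[OF sz[OF that]] P2(2)[OF sz[OF that]] by (auto simp: Q_def)
    have "\<exists>y t. runs c1 (f i) t y \<and> y \<noteq> Tip \<and> t \<le> Q x" if "i < n x" for i
    proof -
      from that have b: "b ((step ^^ i) (init x))" by (rule n)
      obtain t where "t \<le> T1 ((step ^^ i) (init x))" "runs c1 (f i) t (enc True)"
        using 1(2)[of "(step ^^ i) (init x)"] b by (auto simp: f_def)
      with tm(1)[of i] that show ?thesis by fastforce
    qed
    moreover have "\<exists>t. runs c1 (f (n x)) t Tip \<and> t \<le> Q x"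
    proof -
      obtain t where "t \<le> T1 ((step ^^ n x) (init x))" "runs c1 (f (n x)) t (enc False)"
        using 1(2)[of "(step ^^ n x) (init x)"] n(3)[of x] by (auto simp: f_def)
      with tm(1)[of "n x"] show ?thesis by fastforce
    qed
    moreover have "\<exists>t. runs c2 (f i) t (f (Suc i)) \<and> t \<le> Q x" if "i < n x" for i
      using 2(2)[of "(step ^^ i) (init x)"] tm(2)[of i] that by (fastforce simp: f_def)
    moreover have "size (f i) \<le> Q x" if "i \<le> n x" for i
      using sz[OF that] by (simp add: f_def Q_def esize_def)
    ultimately have "\<exists>t. runs c (f 0) t (f (n x)) \<and> t \<le> K * (n x + 1) * (Q x + 1)"
      by (intro c) auto
    then show ?thesis by (simp add: f_def final_def)
  qed
  note run = this
  obtain c0 T0 where 0: "polybounded T0" "\<And>x. \<exists>t\<le>T0 x. runs c0 (enc x) t (enc (init x))"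
    using assms(1) by (auto simp: polytime_def)
  obtain c' K' where c': "\<And>x t y t' z. runs c0 x t y \<Longrightarrow> runs c y t' z \<Longrightarrow>
     \<exists>t''. runs c' x t'' z \<and> t'' \<le> K' * (t + t' + size x + 1)"
    using runs_seq[of c0 c] by blast
  have "polytime final"
  proof (rule polytimeI)
    show "polybounded (\<lambda>x. K' * (T0 x + K * (N x + 1) * (Q x + 1) + esize x + 1))"
      unfolding Q_def by (intro polybounded_intros 0 N P1 P2 S)
    fix x
    obtain t t' where "t \<le> T0 x" "runs c0 (enc x) t (enc (init x))"
      "runs c (enc (init x)) t' (enc (final x))" "t' \<le> K * (n x + 1) * (Q x + 1)"
      using 0 run by metis
    moreover from this obtain t'' where "runs c' (enc x) t'' (enc (final x))"
      "t'' \<le> K' * (t + t' + esize x + 1)"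
      using c' unfolding esize_def by blast
    moreover have "K * (n x + 1) * (Q x + 1) \<le> K * (N x + 1) * (Q x + 1)"
      using n(1)[of x] by (intro mult_le_mono) auto
    ultimately have "t'' \<le> K' * (T0 x + K * (N x + 1) * (Q x + 1) + esize x + 1)"
      by (meson add_le_mono le_refl mult_le_mono2 order.trans)
    then show "\<exists>t\<le>K' * (T0 x + K * (N x + 1) * (Q x + 1) + esize x + 1). runs c' (enc x) t (enc (final x))"
      using \<open>runs c' (enc x) t'' (enc (final x))\<close> by blast
  qed
  from polytime_comp[OF this assms(4)] have "polytime (\<lambda>x. out (final x))" .
  moreover have "out (final x) = r x" for x
    using out n(3,4) unfolding final_def by blast
  ultimately show ?thesis by simp
qed

text \<open>The loop state consists of the input, the accumulator and the rest of the list. The size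
  bound is required for every prefix, since every intermediate accumulator is part of a
  state.\<close>

lemma polytime_foldl:
  assumes F: "polytime (\<lambda>p. F (fst p) (fst (snd p)) (snd (snd p)))"
    and "polytime A" "polytime L" and S: "polybounded S"
    and bound: "\<And>x ys zs. L x = ys @ zs \<Longrightarrow> esize (foldl (F x) (A x) ys) \<le> S x"
  shows "polytime (\<lambda>x. foldl (F x) (A x) (L x))"
proof (rule polytime_while[where
    init = "\<lambda>x. (x, A x, L x)" and b = "\<lambda>s. snd (snd s) \<noteq> []" and
    step = "\<lambda>s. case snd (snd s) of [] \<Rightarrow> s | y # ys \<Rightarrow> (fst s, F (fst s) (fst (snd s)) y, ys)" and
    out = "\<lambda>s. fst (snd s)" and \<mu> = "\<lambda>s. length (snd (snd s))" and
    N = "\<lambda>x. length (L x)" and S = "\<lambda>x. esize x + S x + esize (L x) + 2" and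
    I = "\<lambda>x s. fst s = x \<and> (\<exists>ys. L x = ys @ snd (snd s) \<and> fst (snd s) = foldl (F x) (A x) ys)"])
  have "polytime (\<lambda>p. (fst (fst p), fst (snd (fst p)), fst (snd p)))"
    by (intro polytime_intros)
  from polytime_comp[OF this F]
  have "polytime (\<lambda>p. F (fst (fst p)) (fst (snd (fst p))) (fst (snd p)))" by simp
  then show "polytime (\<lambda>s. case snd (snd s) of [] \<Rightarrow> s
      | y # ys \<Rightarrow> (fst s, F (fst s) (fst (snd s)) y, ys))"
    by (intro polytime_intros)
  show "polybounded (\<lambda>x. esize x + S x + esize (L x) + 2)"
    by (intro polybounded_intros S polytime_esize assms)
  fix x s
  assume I: "fst s = x \<and> (\<exists>ys. L x = ys @ snd (snd s) \<and> fst (snd s) = foldl (F x) (A x) ys)"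
  then obtain ys where ys: "L x = ys @ snd (snd s)" "fst (snd s) = foldl (F x) (A x) ys" by blast
  have "esize (fst (snd s)) \<le> S x" using bound[OF ys(1)] ys by simp
  moreover have "esize (snd (snd s)) \<le> esize (L x)" using ys by simp
  moreover have "esize s = esize (fst s) + (esize (fst (snd s)) + esize (snd (snd s)) + 1) + 1"
    by (metis esize_prod)
  ultimately show "esize s \<le> esize x + S x + esize (L x) + 2"
    using I by simp
  let ?st = "case snd (snd s) of [] \<Rightarrow> s | y # ys \<Rightarrow> (fst s, F (fst s) (fst (snd s)) y, ys)"
  assume "snd (snd s) \<noteq> []"
  then obtain z zs where z: "snd (snd s) = z # zs" by (cases "snd (snd s)") auto
  have "L x = (ys @ [z]) @ zs" "F (fst s) (fst (snd s)) z = foldl (F x) (A x) (ys @ [z])"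
    using ys z I by auto
  with z I show "(fst ?st = x \<and> (\<exists>ys. L x = ys @ snd (snd ?st) \<and> fst (snd ?st) = foldl (F x) (A x) ys)) \<and>
      length (snd (snd ?st)) < length (snd (snd s))"
    by (simp add: exI[of _ "ys @ [z]"])
qed (intro polytime_intros assms polytime_length | simp add: polytime_length assms)+

subsection \<open>Lists\<close>

lemma polytime_rev [polytime_intros]:
  assumes "polytime L" shows "polytime (\<lambda>x. rev (L x))"
proof -
  have rev: "foldl (\<lambda>a y. y # a) [] ys = rev ys" for ys :: "'b list"
    by (induction ys rule: rev_induct) auto
  have "polytime (\<lambda>x. foldl (\<lambda>a y. y # a) [] (L x))"
    by (rule polytime_foldl[where S = "\<lambda>x. esize (L x)"])
      (intro polytime_intros polytime_esize assms | simp add: rev)+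
  then show ?thesis by (simp add: rev)
qed

lemma polytime_append [polytime_intros]:
  assumes "polytime L" "polytime M" shows "polytime (\<lambda>x. L x @ M x)"
proof -
  have rev: "foldl (\<lambda>a y. y # a) zs ys = rev ys @ zs" for ys zs :: "'b list"
    by (induction ys rule: rev_induct) auto
  have "polytime (\<lambda>x. foldl (\<lambda>a y. y # a) (M x) (rev (L x)))"
  proof (rule polytime_foldl[where S = "\<lambda>x. esize (L x) + esize (M x)"])
    fix x ys zs assume "rev (L x) = ys @ zs"
    then have "esize (L x) = esize ys + esize zs" by (metis esize_append esize_rev)
    then show "esize (foldl (\<lambda>a y. y # a) (M x) ys) \<le> esize (L x) + esize (M x)"
      by (simp add: rev)
  qed (intro polytime_intros polybounded_intros polytime_esize assms)+
  then show ?thesis by (simp add: rev)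
qed

lemma polybounded_esize2:
  assumes "polytime (\<lambda>p. F (fst p) (snd p))" "polytime L"
  obtains P where "polybounded P" "\<And>x y. y \<in> set (L x) \<Longrightarrow> esize (F x y) \<le> P x"
proof -
  have S: "polybounded (\<lambda>x. esize x + esize (L x) + 1)"
    by (intro polybounded_intros polytime_esize assms)
  obtain P where P: "polybounded P"
    "\<And>x y. esize y \<le> esize x + esize (L x) + 1 \<Longrightarrow> esize (F (fst y) (snd y)) \<le> P x"
    using polybounded_uniform[OF polytime_esize[OF assms(1)] S] by blast
  show thesis
  proof
    show "polybounded P" by fact
    fix x y assume "y \<in> set (L x)"
    then have "esize (x, y) \<le> esize x + esize (L x) + 1"
      using esize_in_set by fastforce
    from P(2)[OF this] show "esize (F x y) \<le> P x" by simp
  qed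
qed

lemma polytime_map [polytime_intros]:
  assumes F: "polytime (\<lambda>p. F (fst p) (snd p))" and "polytime L"
  shows "polytime (\<lambda>x. map (F x) (L x))"
proof -
  have rev: "foldl (\<lambda>a y. F x y # a) [] ys = rev (map (F x) ys)" for x ys
    by (induction ys rule: rev_induct) auto
  obtain P where P: "polybounded P" "\<And>x y. y \<in> set (L x) \<Longrightarrow> esize (F x y) \<le> P x"
    using polybounded_esize2[OF assms] by blast
  have F': "polytime (\<lambda>p. F (fst p) (snd (snd p)))"
    by (rule polytime_apply2[OF F]) (intro polytime_intros)+
  have "polytime (\<lambda>x. rev (foldl (\<lambda>a y. F x y # a) [] (L x)))"
  proof (intro polytime_intros, rule polytime_foldl[where S = "\<lambda>x. length (L x) * (P x + 1)"])
    fix x ys zs assume L: "L x = ys @ zs"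
    have "esize (map (F x) ys) \<le> length (map (F x) ys) * (P x + 1)"
      using P(2) L by (intro esize_list_le) auto
    also have "\<dots> \<le> length (L x) * (P x + 1)" by (intro mult_le_mono1) (simp add: L)
    finally show "esize (foldl (\<lambda>a y. F x y # a) [] ys) \<le> length (L x) * (P x + 1)"
      by (simp add: rev)
  qed (intro F' polytime_intros polybounded_intros polytime_length assms P)+
  then show ?thesis by (simp add: rev)
qed

lemma polytime_concat [polytime_intros]:
  assumes "polytime L" shows "polytime (\<lambda>x. concat (L x))"
proof -
  have c: "foldl (@) [] yss = concat yss" for yss :: "'b list list"
    by (induction yss rule: rev_induct) auto
  have "polytime (\<lambda>x. foldl (@) [] (L x))"
  proof (rule polytime_foldl[where S = "\<lambda>x. esize (L x)"])
    fix x ys zs assume L: "L x = ys @ zs"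
    have "esize (concat ys) \<le> esize ys" by (rule esize_concat_le)
    also have "\<dots> \<le> esize (L x)" by (simp add: L)
    finally show "esize (foldl (@) [] ys) \<le> esize (L x)" by (simp add: c)
  qed (intro polytime_intros polytime_esize assms)+
  then show ?thesis by (simp add: c)
qed

lemma polytime_filter [polytime_intros]:
  assumes "polytime (\<lambda>p. P (fst p) (snd p))" "polytime L"
  shows "polytime (\<lambda>x. filter (P x) (L x))"
proof -
  have "polytime (\<lambda>x. concat (map (\<lambda>y. if P x y then [y] else []) (L x)))"
    by (intro polytime_intros assms)
  moreover have "concat (map (\<lambda>y. if Q y then [y] else []) ys) = filter Q ys"
    for Q and ys :: "'b list"
    by (induction ys) auto
  ultimately show ?thesis by simp
qed

lemma polytime_length_nat [polytime_intros]:
  assumes "polytime L" shows "polytime (\<lambda>x. length (L x))"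
proof -
  have c: "foldl (\<lambda>a y. Suc a) 0 ys = length ys" for ys :: "'b list"
    by (induction ys rule: rev_induct) auto
  have "polytime (\<lambda>x. foldl (\<lambda>a y. Suc a) 0 (L x))"
    by (rule polytime_foldl[where S = "\<lambda>x. length (L x)"])
      (intro polytime_intros polytime_length assms | simp add: c)+
  then show ?thesis by (simp add: c)
qed

text \<open>A unary number and the list of that many \<open>Tip\<close>s have the same code, so
  arithmetic reduces to list operations and numbers can drive folds.\<close>

lemma polytime_replicate_Tip:
  "polytime f \<Longrightarrow> polytime (\<lambda>x. replicate (f x) Tip)"
proof (rule polytime_enc_cong[where f = f])
  have "enc n = enc (replicate n Tip)" for n by (induction n) auto
  then show "enc (f x) = enc (replicate (f x) Tip)" for x .
qed

lemma polytime_replicate [polytime_intros]: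
  assumes "polytime f" "polytime g" shows "polytime (\<lambda>x. replicate (f x) (g x))"
proof -
  have "polytime (\<lambda>x. map (\<lambda>_. g x) (replicate (f x) Tip))"
    by (intro polytime_intros polytime_replicate_Tip assms polytime_comp[OF polytime_fst[OF polytime_id] assms(2)])
  then show ?thesis by (simp add: map_replicate_const)
qed

lemma polytime_add [polytime_intros]:
  assumes "polytime f" "polytime g" shows "polytime (\<lambda>x. f x + g x :: nat)"
proof -
  have "polytime (\<lambda>x. length (replicate (f x) Tip @ replicate (g x) Tip))"
    by (intro polytime_intros assms)
  then show ?thesis by simp
qed

lemma polytime_mult [polytime_intros]:
  assumes "polytime f" "polytime g" shows "polytime (\<lambda>x. f x * g x :: nat)"
proof -
  have "polytime (\<lambda>x. length (concat (replicate (f x) (replicate (g x) Tip))))"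
    by (intro polytime_intros assms)
  then show ?thesis by (simp add: length_concat sum_list_replicate)
qed

text \<open>The exponent is a constant: with unary numbers a variable exponent would give results of
  exponential size.\<close>

lemma polytime_power [polytime_intros]:
  assumes "polytime f" shows "polytime (\<lambda>x. f x ^ n :: nat)"
  by (induction n) (auto intro!: polytime_const polytime_mult assms)

lemma polytime_tl [polytime_intros]:
  assumes "polytime L" shows "polytime (\<lambda>x. tl (L x))"
  by (rule polytime_enc_cong[where f = "\<lambda>x. tsnd (enc (L x))"], intro polytime_intros assms)
    (case_tac "L x"; simp)

lemma polytime_drop [polytime_intros]:
  assumes "polytime f" "polytime L" shows "polytime (\<lambda>x. drop (f x) (L x))"
proof -
  have c: "foldl (\<lambda>a y. tl a) xs ys = drop (length ys) xs" for xs :: "'b list" and ys :: "tree list"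
    by (induction ys rule: rev_induct) (auto simp: drop_Suc tl_drop)
  have "polytime (\<lambda>x. foldl (\<lambda>a y. tl a) (L x) (replicate (f x) Tip))"
    by (rule polytime_foldl[where S = "\<lambda>x. esize (L x)"])
      (intro polytime_intros polytime_esize assms | simp add: c esize_drop_le)+
  then show ?thesis by (simp add: c)
qed

lemma polytime_diff [polytime_intros]:
  assumes "polytime f" "polytime g" shows "polytime (\<lambda>x. f x - g x :: nat)"
proof -
  have "polytime (\<lambda>x. length (drop (g x) (replicate (f x) Tip)))"
    by (intro polytime_intros assms)
  then show ?thesis by simp
qed

lemma polytime_le [polytime_intros]:
  assumes "polytime f" "polytime g" shows "polytime (\<lambda>x. f x \<le> (g x :: nat))"
proof -
  have "polytime (\<lambda>x. drop (g x) (replicate (f x) Tip) = [])"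
    by (intro polytime_intros assms)
  then show ?thesis by simp
qed

lemma polytime_take [polytime_intros]:
  assumes "polytime f" "polytime L" shows "polytime (\<lambda>x. take (f x) (L x))"
proof -
  have "polytime (\<lambda>x. rev (drop (length (L x) - f x) (rev (L x))))"
    by (intro polytime_intros assms)
  moreover have "rev (drop (length ys - n) (rev ys)) = take n ys" for n and ys :: "'b list"
    by (cases "n \<le> length ys") (auto simp: rev_drop)
  ultimately show ?thesis by simp
qed

lemma polytime_upt [polytime_intros]:
  assumes "polytime f" "polytime g" shows "polytime (\<lambda>x. [f x..<g x])"
proof -
  have c: "foldl (\<lambda>l y. l @ [m + length l]) [] ys = [m..<m + length ys]" for m and ys :: "tree list"
    by (induction ys rule: rev_induct) auto
  have "polytime (\<lambda>x. foldl (\<lambda>l y. l @ [f x + length l]) [] (replicate (g x - f x) Tip))"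
  proof (rule polytime_foldl[where S = "\<lambda>x. g x * (g x + 1)"])
    show "polytime (\<lambda>p. fst (snd p) @ [f (fst p) + length (fst (snd p))])"
      by (intro polytime_intros polytime_comp[OF _ assms(1)])
    fix x and ys zs :: "tree list"
    assume r: "replicate (g x - f x) Tip = ys @ zs"
    then have l: "length ys \<le> g x - f x"
      by (metis length_append length_replicate le_add1)
    have "esize [f x..<f x + length ys] \<le> length [f x..<f x + length ys] * (g x + 1)"
      using l by (intro esize_list_le) auto
    also have "\<dots> \<le> g x * (g x + 1)"
      using l by (intro mult_le_mono1) auto
    finally show "esize (foldl (\<lambda>l y. l @ [f x + length l]) [] ys) \<le> g x * (g x + 1)"
      by (simp add: c)
  qed (intro polytime_intros polybounded_intros polytime_esize[of g, simplified] assms)+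
  moreover have "[m..<m + (n - m)] = [m..<n]" for m n :: nat
    by (cases "m \<le> n") auto
  ultimately show ?thesis by (simp add: c)
qed

lemma polytime_zip [polytime_intros]:
  assumes "polytime L" "polytime M" shows "polytime (\<lambda>x. zip (L x) (M x))"
proof -
  define step where "step s y =
    (case snd s of [] \<Rightarrow> (fst s, []) | z # zs \<Rightarrow> ((y, z) # fst s, zs))"
    for s :: "('b \<times> 'c) list \<times> 'c list" and y
  have c: "foldl step (acc, zs) ys = (rev (zip ys zs) @ acc, drop (length ys) zs)" for ys zs acc
    by (induction ys arbitrary: acc zs) (auto simp: step_def split: list.split)
  have zip: "esize (zip ys zs) + esize (drop (length ys) zs) \<le> esize ys + esize zs"
    for ys :: "'b list" and zs :: "'c list"
  proof (induction ys arbitrary: zs)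
    case (Cons y ys)
    show ?case
    proof (cases zs)
      case (Cons w ws)
      then show ?thesis using Cons.IH[of ws] by simp
    qed simp
  qed simp
  have "polytime (\<lambda>x. rev (fst (foldl step ([], M x) (L x))))"
  proof (intro polytime_intros, rule polytime_foldl[where S = "\<lambda>x. esize (L x) + esize (M x) + 1"])
    show "polytime (\<lambda>p. step (fst (snd p)) (snd (snd p)))"
      unfolding step_def by (intro polytime_intros)
    fix x ys zs assume "L x = ys @ zs"
    then have "esize ys \<le> esize (L x)" by simp
    with zip[of ys "M x"] show "esize (foldl step ([], M x) ys) \<le> esize (L x) + esize (M x) + 1"
      by (simp add: c)
  qed (intro polytime_intros polybounded_intros polytime_esize assms)+
  then show ?thesis by (simp add: c)
qed

lemma polytime_enumerate [polytime_intros]: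
  assumes "polytime f" "polytime L" shows "polytime (\<lambda>x. enumerate (f x) (L x))"
  unfolding enumerate_eq_zip by (intro polytime_intros assms)

subsection \<open>Equality and size\<close>

text \<open>Recursion over two trees is replaced by a worklist of pairs that have to be equal.
  Splitting a pair trades two \<open>Bin\<close> nodes for one more pair and one more list node, so
  the worklist does not grow.\<close>

lemma polytime_eq [polytime_intros]:
  assumes "polytime f" "polytime g" shows "polytime (\<lambda>x. f x = g x)"
proof -
  define step where "step s = (case fst s of [] \<Rightarrow> s
    | p # ps \<Rightarrow>
      if fst p = Tip then if snd p = Tip then (ps, snd s) else ([], False)
      else if snd p = Tip then ([], False)
      else ((tfst (fst p), tfst (snd p)) # (tsnd (fst p), tsnd (snd p)) # ps, snd s))"
    for s :: "(tree \<times> tree) list \<times> bool"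
  have "polytime (\<lambda>p. fst p = (snd p :: tree))"
  \<comment> \<open>The measure counts nodes and leaves of the first components, so that even a step
    that merely removes a leaf lowers it.\<close>
  proof (rule polytime_while[where
      init = "\<lambda>p. ([p], True)" and b = "\<lambda>s. fst s \<noteq> []" and step = step and out = snd and
      \<mu> = "\<lambda>s. \<Sum>p\<leftarrow>fst s. 2 * size (fst p) + 1" and
      N = "\<lambda>p. 2 * esize p + 1" and S = "\<lambda>p. esize p + 3" and
      I = "\<lambda>p s. (snd s \<and> (\<forall>q\<in>set (fst s). fst q = snd q) \<longleftrightarrow> fst p = snd p) \<and>
        esize (fst s) \<le> esize p + 1"])
    show "polytime step"
      unfolding step_def
      by (intro polytime_intros polytime_eq_Tip)
    fix p :: "tree \<times> tree" and s :: "(tree \<times> tree) list \<times> bool"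
    assume I: "(snd s \<and> (\<forall>q\<in>set (fst s). fst q = snd q) \<longleftrightarrow> fst p = snd p) \<and>
        esize (fst s) \<le> esize p + 1"
    show "esize s \<le> esize p + 3"
      using I esize_bool[of "snd s"] by (simp add: esize_prod[of s])
    show "\<not> fst s \<noteq> [] \<Longrightarrow> snd s = (fst p = snd p)" using I by simp
    assume "fst s \<noteq> []"
    then obtain a b ps ok where s: "s = ((a, b) # ps, ok)"
      by (cases s; cases "fst s") auto
    show "((snd (step s) \<and> (\<forall>q\<in>set (fst (step s)). fst q = snd q) \<longleftrightarrow> fst p = snd p) \<and>
        esize (fst (step s)) \<le> esize p + 1) \<and>
        (\<Sum>p\<leftarrow>fst (step s). 2 * size (fst p) + 1) < (\<Sum>p\<leftarrow>fst s. 2 * size (fst p) + 1)"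
      using I by (cases a; cases b) (auto simp: s step_def)
  qed (intro polytime_intros polybounded_intros | simp add: esize_prod)+
  from polytime_apply2[OF this polytime_enc[OF assms(1)] polytime_enc[OF assms(2)]]
  show ?thesis by simp
qed

text \<open>Needed because the program itself computes the cut-off bound of the tables from the size
  of the formula.\<close>

lemma polytime_esize_nat [polytime_intros]:
  assumes "polytime f" shows "polytime (\<lambda>x. esize (f x))"
proof -
  define step where "step s = (case fst s of [] \<Rightarrow> s
    | t # ts \<Rightarrow> if t = Tip then (ts, snd s) else (tfst t # tsnd t # ts, Suc (snd s)))"
    for s :: "tree list \<times> nat"
  have "polytime (\<lambda>t. size (t :: tree))"
  proof (rule polytime_while[where
      init = "\<lambda>t. ([t], 0)" and b = "\<lambda>s. fst s \<noteq> []" and step = step and out = snd and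
      \<mu> = "\<lambda>s. \<Sum>t\<leftarrow>fst s. 2 * size t + 1" and
      N = "\<lambda>t. 2 * esize t + 1" and S = "\<lambda>t. 2 * esize t + 2" and
      I = "\<lambda>t s. snd s + (\<Sum>t\<leftarrow>fst s. size t) = size t \<and> esize (fst s) \<le> size t + 1"])
    show "polytime step"
      unfolding step_def by (intro polytime_intros)
    fix t :: tree and s :: "tree list \<times> nat"
    assume I: "snd s + (\<Sum>t\<leftarrow>fst s. size t) = size t \<and> esize (fst s) \<le> size t + 1"
    show "esize s \<le> 2 * esize t + 2"
      using I by (simp add: esize_prod[of s])
    show "\<not> fst s \<noteq> [] \<Longrightarrow> snd s = size t" using I by simp
    assume "fst s \<noteq> []"
    then obtain a ts n where s: "s = (a # ts, n)"
      by (cases s; cases "fst s") auto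
    show "(snd (step s) + (\<Sum>t\<leftarrow>fst (step s). size t) = size t \<and> esize (fst (step s)) \<le> size t + 1) \<and>
        (\<Sum>t\<leftarrow>fst (step s). 2 * size t + 1) < (\<Sum>t\<leftarrow>fst s. 2 * size t + 1)"
      using I by (cases a) (auto simp: s step_def)
  qed (intro polytime_intros polybounded_intros | simp)+
  from polytime_comp[OF polytime_enc[OF assms] this]
  show ?thesis by (simp add: esize_def)
qed

lemma polytime_member [polytime_intros]:
  assumes "polytime f" "polytime L" shows "polytime (\<lambda>x. f x \<in> set (L x))"
proof -
  have "polytime (\<lambda>x. filter (\<lambda>y. y = f x) (L x) \<noteq> [])"
    by (intro polytime_intros assms polytime_comp[OF polytime_fst[OF polytime_id] assms(1)])
  then show ?thesis by (simp add: filter_empty_conv)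
qed

lemma polytime_remdups [polytime_intros]:
  assumes "polytime L" shows "polytime (\<lambda>x. remdups (L x))"
proof -
  have c: "foldl (\<lambda>a y. if y \<in> set a then a else y # a) [] ys = remdups (rev ys)" for ys :: "'b list"
    by (induction ys rule: rev_induct) auto
  have "polytime (\<lambda>x. foldl (\<lambda>a y. if y \<in> set a then a else y # a) [] (rev (L x)))"
  proof (rule polytime_foldl[where S = "\<lambda>x. esize (L x)"])
    fix x ys zs assume "rev (L x) = ys @ zs"
    then have "esize (L x) = esize ys + esize zs" by (metis esize_append esize_rev)
    then show "esize (foldl (\<lambda>a y. if y \<in> set a then a else y # a) [] ys) \<le> esize (L x)"
      using esize_remdups_le[of "rev ys"] by (simp add: c)
  qed (intro polytime_intros polytime_esize assms)+
  then show ?thesis by (simp add: c)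
qed

section \<open>Evaluating regex formulas bottom-up\<close>

text \<open>Two unary blocks with a separator. The naming serves a second purpose: applied to the
  index of a disjunct and that of an atom it yields relation symbols.\<close>

definition span_name :: "span \<Rightarrow> name" where
  "span_name p = replicate (fst p) False @ True # replicate (snd p) False"

text \<open>The first component is the position of the separator. Decoding has to be total, so a
  word without a separator is sent to an arbitrary pair.\<close>

definition name_span :: "name \<Rightarrow> span" where
  "name_span w = (case filter snd (enumerate 0 w) of [] \<Rightarrow> (0, 0)
     | p # _ \<Rightarrow> (fst p, length w - Suc (fst p)))"

lemma name_span_span_name [simp]: "name_span (span_name p) = p"
proof -
  have "filter snd (enumerate k (replicate m False)) = []" for k m
    by (induction m arbitrary: k) auto
  then show ?thesis
    by (simp add: name_span_def span_name_def enumerate_append_eq)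
qed

lemma span_name_eq_iff [simp]: "span_name p = span_name q \<longleftrightarrow> p = q"
  by (metis name_span_span_name)

lemma span_name_neq_Nil [simp]: "span_name p \<noteq> []"
  by (simp add: span_name_def)

lemma esize_span_name: "esize (span_name p) = fst p + snd p + 2"
proof -
  have "esize (replicate m False) = m" for m
    by (induction m) (simp_all add: esize_def)
  moreover have "esize True = 1" by (simp add: esize_def)
  ultimately show ?thesis by (simp add: span_name_def)
qed

text \<open>Unassigned variables are represented by the empty word, which is not the name of a span.\<close>

definition entry :: "span option \<Rightarrow> name" where
  "entry po = (case po of None \<Rightarrow> [] | Some p \<Rightarrow> span_name p)"

lemma entry_simps [simp]: "entry None = []" "entry (Some p) = span_name p"
  by (simp_all add: entry_def)

lemma entry_eq_Nil_iff [simp]: "entry po = [] \<longleftrightarrow> po = None"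
  by (cases po) auto

subsection \<open>Tuples of ref-words\<close>

lemma clr_append [simp]: "clr (u @ v) = clr u @ clr v"
proof (induction u)
  case (Cons l u)
  then show ?case by (cases l) auto
qed simp

lemma length_clr_takeWhile_le: "length (clr (takeWhile P r)) \<le> length (clr r)"
proof -
  have "clr (takeWhile P r) @ clr (dropWhile P r) = clr r"
    by (simp flip: clr_append)
  then show ?thesis by (metis le_add1 length_append)
qed

text \<open>Reads a partial tuple off an arbitrary fragment of a ref-word that starts at position
  \<open>i\<close>. Unlike \<open>is_tuple_of\<close> it is a function of the word alone and makes
  sense for fragments that are not valid for any intended set of variables.\<close>

definition tuple_at :: "nat \<Rightarrow> 'a letter list \<Rightarrow> name \<rightharpoonup> span" where
  "tuple_at i r x = (if Open x \<in> set r
     then Some (i + length (clr (takeWhile (\<lambda>l. l \<noteq> Open x) r)),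
       i + length (clr (takeWhile (\<lambda>l. l \<noteq> Close x) r)))
     else None)"

lemma tuple_at_eq_None_iff: "tuple_at i r x = None \<longleftrightarrow> Open x \<notin> set r"
  by (simp add: tuple_at_def)

text \<open>Words of a subformula are not known to be valid for its variables. This much holds for
  all formulas, and it suffices to attribute each variable of a concatenation to one factor.\<close>

definition balanced :: "'a letter list \<Rightarrow> bool" where
  "balanced r \<longleftrightarrow> (\<forall>x. Open x \<in> set r \<longleftrightarrow> Close x \<in> set r)"

lemma balanced_ref_lang: "r \<in> ref_lang \<alpha> \<Longrightarrow> balanced r"
proof (induction \<alpha> arbitrary: r)
  case (Star \<alpha>)
  then obtain us where "r = concat us" "set us \<subseteq> ref_lang \<alpha>" by auto
  with Star.IH show ?case by (fastforce simp: balanced_def)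
qed (fastforce simp: balanced_def)+

text \<open>Either both kinds of brackets of \<open>x\<close> occur in the left factor or neither
  does, so the two searches stop on the same side of the cut. If both factors bind \<open>x\<close>,
  the left one wins.\<close>

lemma tuple_at_append:
  assumes "Open x \<in> set r \<longleftrightarrow> Close x \<in> set r"
  shows "tuple_at i (r @ r') x =
    (if Open x \<in> set r then tuple_at i r x else tuple_at (i + length (clr r)) r' x)"
proof (cases "Open x \<in> set r")
  case True
  with assms have "takeWhile (\<lambda>l. l \<noteq> Open x) (r @ r') = takeWhile (\<lambda>l. l \<noteq> Open x) r"
    "takeWhile (\<lambda>l. l \<noteq> Close x) (r @ r') = takeWhile (\<lambda>l. l \<noteq> Close x) r"
    by (auto intro!: takeWhile_append1)
  with True show ?thesis by (simp add: tuple_at_def)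
next
  case False
  with assms have "takeWhile (\<lambda>l. l \<noteq> Open x) (r @ r') = r @ takeWhile (\<lambda>l. l \<noteq> Open x) r'"
    "takeWhile (\<lambda>l. l \<noteq> Close x) (r @ r') = r @ takeWhile (\<lambda>l. l \<noteq> Close x) r'"
    by (auto intro!: takeWhile_append2)
  with False show ?thesis by (simp add: tuple_at_def)
qed

lemma tuple_at_append_left:
  assumes "Open x \<in> set r" "Close x \<in> set r"
  shows "tuple_at i (r @ r') x = tuple_at i r x"
  using assms tuple_at_append[of x r i r'] by simp

lemma valid_Open_iff: "valid V r \<Longrightarrow> Open x \<in> set r \<longleftrightarrow> x \<in> V"
  unfolding valid_def by (fastforce simp: in_set_conv_decomp)

text \<open>Uniqueness of the brackets makes the prefixes found by \<open>takeWhile\<close> coincide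
  with those of the given decomposition.\<close>

lemma tuple_at_decomp:
  assumes "count_list r (Open x) = 1" "count_list r (Close x) = 1"
    and r: "r = u @ Open x # v @ Close x # w"
  shows "tuple_at i r x = Some (i + length (clr u), i + length (clr u) + length (clr v))"
proof -
  have "Open x \<notin> set u" "Close x \<notin> set u" "Close x \<notin> set v"
    using assms by (auto simp flip: count_list_0_iff)
  then have "takeWhile (\<lambda>l. l \<noteq> Open x) r = u"
    "takeWhile (\<lambda>l. l \<noteq> Close x) (u @ Open x # v) = u @ Open x # v"
    "takeWhile (\<lambda>l. l \<noteq> Close x) ((u @ Open x # v) @ Close x # w) =
      (u @ Open x # v) @ takeWhile (\<lambda>l. l \<noteq> Close x) (Close x # w)"
    unfolding r by (subst takeWhile_append2; auto)+
  then show ?thesis by (simp add: tuple_at_def r)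
qed

lemma is_tuple_of_iff:
  assumes "valid V r" shows "is_tuple_of V r \<mu> \<longleftrightarrow> \<mu> = tuple_at 1 r"
proof
  assume \<mu>: "is_tuple_of V r \<mu>"
  show "\<mu> = tuple_at 1 r"
  proof
    fix x
    show "\<mu> x = tuple_at 1 r x"
    proof (cases "x \<in> V")
      case True
      then obtain u v w where r: "r = u @ Open x # v @ Close x # w"
        "\<mu> x = Some (length (clr u) + 1, length (clr u) + 1 + length (clr v))"
        using \<mu> unfolding is_tuple_of_def Let_def by blast
      with True assms show ?thesis
        by (subst tuple_at_decomp[OF _ _ r(1)]) (auto simp: valid_def)
    next
      case False
      then have "\<mu> x = None" using \<mu> by (auto simp: is_tuple_of_def)
      with False assms show ?thesis by (simp add: tuple_at_def valid_Open_iff)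
    qed
  qed
next
  assume \<mu>: "\<mu> = tuple_at 1 r"
  have "dom \<mu> = V"
    using assms by (auto simp: \<mu> dom_def tuple_at_def valid_Open_iff)
  moreover have "\<exists>u v w. r = u @ Open x # v @ Close x # w \<and>
      (let i = length (clr u) + 1 in \<mu> x = Some (i, i + length (clr v)))" if x: "x \<in> V" for x
  proof -
    obtain u v w where r: "r = u @ Open x # v @ Close x # w"
      using assms x unfolding valid_def by blast
    have "\<mu> x = Some (1 + length (clr u), 1 + length (clr u) + length (clr v))"
      unfolding \<mu> using assms x by (intro tuple_at_decomp[OF _ _ r]) (auto simp: valid_def)
    with r show ?thesis by (auto simp: Let_def)
  qed
  ultimately show "is_tuple_of V r \<mu>" by (simp add: is_tuple_of_def)
qed

lemma regex_eval_eq: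
  assumes "functional \<alpha>"
  shows "regex_eval \<alpha> s = {tuple_at 1 r | r. r \<in> ref_lang \<alpha> \<and> clr r = s}"
  using assms is_tuple_of_iff unfolding regex_eval_def functional_def by fastforce

lemma tuple_at_spans:
  assumes "valid V r" "x \<in> V" shows "\<exists>p\<in>spans (clr r). tuple_at 1 r x = Some p"
proof -
  obtain u v w where r: "r = u @ Open x # v @ Close x # w"
    using assms by (auto simp: valid_def)
  have "tuple_at 1 r x = Some (1 + length (clr u), 1 + length (clr u) + length (clr v))"
    using assms by (intro tuple_at_decomp[OF _ _ r]) (auto simp: valid_def)
  then show ?thesis by (simp add: spans_def r)
qed

lemma regex_eval_spans:
  assumes "functional \<alpha>" "\<mu> \<in> regex_eval \<alpha> s"
  shows "dom \<mu> = vars \<alpha>" "ran \<mu> \<subseteq> spans s"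
proof -
  obtain r where r: "r \<in> ref_lang \<alpha>" "clr r = s" "\<mu> = tuple_at 1 r"
    using assms by (auto simp: regex_eval_eq)
  then have v: "valid (vars \<alpha>) r" using assms by (auto simp: functional_def)
  show d: "dom \<mu> = vars \<alpha>"
    using v r by (auto simp: dom_def tuple_at_def valid_Open_iff)
  show "ran \<mu> \<subseteq> spans s"
  proof
    fix p assume "p \<in> ran \<mu>"
    then obtain x where x: "\<mu> x = Some p" by (auto simp: ran_def)
    with d have "x \<in> vars \<alpha>" by auto
    with tuple_at_spans[OF v this] r x show "p \<in> spans s" by auto
  qed
qed

lemma finite_vars: "finite (vars \<alpha>)"
  by (induction \<alpha>) auto

lemma finite_spans: "finite (spans s)"
  by (rule finite_subset[of _ "{..length s + 1} \<times> {..length s + 1}"]) (auto simp: spans_def)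

text \<open>Without finiteness a bound on \<open>card\<close> would say nothing, as infinite sets
  have cardinality 0.\<close>

lemma finite_regex_eval: "functional \<alpha> \<Longrightarrow> finite (regex_eval \<alpha> s)"
  by (rule finite_subset[OF _ finite_set_of_finite_maps[OF finite_vars finite_spans, of \<alpha> s]])
    (auto dest: regex_eval_spans)

subsection \<open>Tables of a formula\<close>

text \<open>
  A row consists of a span of the string and a vector of entries, one for each element of a fixed
  list of variables.
\<close>

type_synonym row = "span \<times> name list"

text \<open>The bounds on \<open>i\<close> exclude positions beyond the end, from which the empty
  word would otherwise be spelled, and position 0, which \<open>i - 1\<close> would confuse with
  1.\<close>

definition matches :: "'a list \<Rightarrow> nat \<Rightarrow> 'a letter list \<Rightarrow> bool" where
  "matches s i r \<longleftrightarrow> 1 \<le> i \<and> i \<le> length s + 1 \<and> take (length (clr r)) (drop (i - 1) s) = clr r"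

definition word_row :: "name list \<Rightarrow> nat \<Rightarrow> 'a letter list \<Rightarrow> row" where
  "word_row xs i r = ((i, i + length (clr r)), map (\<lambda>x. entry (tuple_at i r x)) xs)"

definition rows :: "name list \<Rightarrow> 'a list \<Rightarrow> 'a letter list set \<Rightarrow> row set" where
  "rows xs s L = {word_row xs i r | i r. r \<in> L \<and> matches s i r}"

lemma matches_bound: "matches s i r \<Longrightarrow> i + length (clr r) \<le> length s + 1"
proof -
  assume m: "matches s i r"
  then have "length (take (length (clr r)) (drop (i - 1) s)) = length (clr r)"
    unfolding matches_def by simp
  then have "length (clr r) \<le> length s - (i - 1)" by simp
  with m show ?thesis unfolding matches_def by linarith
qed

lemma matches_append:
  "matches s i (r @ r') \<longleftrightarrow> matches s i r \<and> matches s (i + length (clr r)) r'"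
proof
  assume m: "matches s i (r @ r')"
  then have b: "i + length (clr r) + length (clr r') \<le> length s + 1"
    using matches_bound by fastforce
  have "take (length (clr r) + length (clr r')) (drop (i - 1) s) = clr r @ clr r'"
    using m by (simp add: matches_def)
  then have "take (length (clr r)) (drop (i - 1) s) @
      take (length (clr r')) (drop (length (clr r)) (drop (i - 1) s)) = clr r @ clr r'"
    by (simp add: take_add)
  moreover have "length (take (length (clr r)) (drop (i - 1) s)) = length (clr r)"
    using b m by (auto simp: matches_def)
  ultimately have "take (length (clr r)) (drop (i - 1) s) = clr r"
      "take (length (clr r')) (drop (length (clr r)) (drop (i - 1) s)) = clr r'"
    by (auto simp: append_eq_append_conv)
  moreover have "length (clr r) + (i - 1) = i + length (clr r) - 1" using m by (simp add: matches_def)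
  ultimately show "matches s i r \<and> matches s (i + length (clr r)) r'"
    using m b by (simp add: matches_def)
next
  assume m: "matches s i r \<and> matches s (i + length (clr r)) r'"
  moreover have "length (clr r) + (i - 1) = i + length (clr r) - 1" using m by (simp add: matches_def)
  ultimately show "matches s i (r @ r')" by (simp add: matches_def take_add)
qed

lemma matches_full: "matches s 1 r \<and> 1 + length (clr r) = length s + 1 \<longleftrightarrow> clr r = s"
proof
  assume m: "matches s 1 r \<and> 1 + length (clr r) = length s + 1"
  then have "take (length (clr r)) (drop (1 - 1) s) = clr r"
    unfolding matches_def by blast
  moreover have "take (length (clr r)) (drop (1 - 1) s) = s" using m by simp
  ultimately show "clr r = s" by metis
qed (simp add: matches_def)

text \<open>Span ends are at most \<open>length s + 1\<close>. A span name thus has size at most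
  \<open>2 * length s + 4\<close>, one more with its list node; the span of the row, together with
  the node pairing it with the entries, also takes at most \<open>2 * length s + 4\<close>.\<close>

lemma word_row_bounds:
  assumes "matches s i r"
  shows "esize (word_row xs i r) \<le> 2 * length s + 4 + length xs * (2 * length s + 5)"
proof -
  have b: "i + length (clr r) \<le> length s + 1" using matches_bound[OF assms] .
  have "esize (entry (tuple_at i r x)) \<le> 2 * length s + 4" for x
  proof -
    have "length (clr (takeWhile P r)) \<le> length (clr r)" for P
      by (rule length_clr_takeWhile_le)
    from this[of "\<lambda>l. l \<noteq> Open x"] this[of "\<lambda>l. l \<noteq> Close x"] b show ?thesis
      by (simp add: tuple_at_def esize_span_name)
  qed
  then have "esize (map (\<lambda>x. entry (tuple_at i r x)) xs) \<le> length (map (\<lambda>x. entry (tuple_at i r x)) xs) * (2 * length s + 4 + 1)"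
    by (intro esize_list_le) auto
  then have "esize (map (\<lambda>x. entry (tuple_at i r x)) xs) \<le> length xs * (2 * length s + 5)"
    by (simp add: ac_simps)
  then show ?thesis using b by (simp add: word_row_def)
qed

text \<open>The left entry takes precedence, exactly as in \<open>tuple_at_append\<close>, so joins
  are correct even when both words bind a variable.\<close>

definition merge :: "name list \<Rightarrow> name list \<Rightarrow> name list" where
  "merge v w = map (\<lambda>p. if fst p = [] then snd p else fst p) (zip v w)"

definition join_rows :: "row list \<Rightarrow> row list \<Rightarrow> row list" where
  "join_rows T1 T2 = concat (map (\<lambda>r1.
     map (\<lambda>r2. ((fst (fst r1), snd (fst r2)), merge (snd r1) (snd r2)))
       (filter (\<lambda>r2. snd (fst r1) = fst (fst r2)) T2)) T1)"

definition eps_rows :: "name list \<Rightarrow> 'a list \<Rightarrow> row list" where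
  "eps_rows xs s = map (\<lambda>i. ((i, i), map (\<lambda>_. []) xs)) [1..<Suc (Suc (length s))]"

definition lit_rows :: "name list \<Rightarrow> 'a list \<Rightarrow> 'a \<Rightarrow> row list" where
  "lit_rows xs s a = map (\<lambda>p. ((fst p, Suc (fst p)), map (\<lambda>_. []) xs))
     (filter (\<lambda>p. snd p = a) (enumerate 1 s))"

definition capt_rows :: "name list \<Rightarrow> name \<Rightarrow> row list \<Rightarrow> row list" where
  "capt_rows xs x T = map (\<lambda>r. (fst r,
     map (\<lambda>p. if fst p = x then span_name (fst r) else snd p) (zip xs (snd r)))) T"

text \<open>Size is measured after removing duplicates because the polynomial bound counts distinct
  rows.\<close>

definition truncate :: "nat \<Rightarrow> row list \<Rightarrow> row list" where
  "truncate B T = (if esize (remdups T) \<le> B then remdups T else [])"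

text \<open>Starting from the empty table, \<open>k\<close> rounds yield the concatenations of fewer
  than \<open>k\<close> factors, so \<open>length s + 1\<close> rounds allow \<open>length s\<close>
  factors. The list of \<open>Tip\<close>s is a mere loop counter.\<close>

definition star_rows :: "name list \<Rightarrow> 'a list \<Rightarrow> nat \<Rightarrow> row list \<Rightarrow> row list" where
  "star_rows xs s B T =
     foldl (\<lambda>A _. truncate B (eps_rows xs s @ join_rows A T)) [] (replicate (Suc (length s)) Tip)"

text \<open>
  The truncation keeps all tables small unconditionally. A table that is too large belongs to a
  subformula that occurs in no word of the formula, for instance a factor of a concatenation
  with \<^const>\<open>Empty\<close>.
\<close>

fun table :: "name list \<Rightarrow> 'a list \<Rightarrow> nat \<Rightarrow> 'a regex \<Rightarrow> row list" where
  "table xs s B Empty = []"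
| "table xs s B Eps = truncate B (eps_rows xs s)"
| "table xs s B (Lit a) = truncate B (lit_rows xs s a)"
| "table xs s B (Or \<alpha> \<beta>) = truncate B (table xs s B \<alpha> @ table xs s B \<beta>)"
| "table xs s B (Cat \<alpha> \<beta>) = truncate B (join_rows (table xs s B \<alpha>) (table xs s B \<beta>))"
| "table xs s B (Star \<alpha>) = star_rows xs s B (table xs s B \<alpha>)"
| "table xs s B (Capt x \<alpha>) = truncate B (capt_rows xs x (table xs s B \<alpha>))"

lemma truncate_Nil [simp]: "truncate B [] = []"
  by (simp add: truncate_def)

lemma join_rows_Nil [simp]: "join_rows [] T = []" "join_rows T [] = []"
  by (simp_all add: join_rows_def)

text \<open>Meant for concatenations with an unproductive factor. The other factor need not be
  useful then and its table may be wrong, but a join with the empty table is empty whatever it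
  contains.\<close>

lemma table_eq_Nil: "ref_lang \<alpha> = {} \<Longrightarrow> table xs s B \<alpha> = []"
proof (induction \<alpha>)
  case (Cat \<alpha> \<beta>)
  then have "ref_lang \<alpha> = {} \<or> ref_lang \<beta> = {}" by auto
  with Cat.IH show ?case by auto
next
  case (Star \<alpha>)
  have "concat [] \<in> ref_lang (Star \<alpha>)" unfolding ref_lang.simps by fastforce
  with Star.prems show ?case by simp
qed (auto simp: capt_rows_def)

lemma rows_mono: "L \<subseteq> L' \<Longrightarrow> rows xs s L \<subseteq> rows xs s L'"
  by (auto simp: rows_def)

lemma rows_Un: "rows xs s (L \<union> L') = rows xs s L \<union> rows xs s L'"
  by (auto simp: rows_def)

lemma set_eps_rows: "set (eps_rows xs s) = rows xs s {[]}"
  by (auto simp: eps_rows_def rows_def word_row_def matches_def tuple_at_def)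

lemma matches_Sym: "matches s i [Sym a] \<longleftrightarrow> 1 \<le> i \<and> i \<le> length s \<and> s ! (i - 1) = a"
proof (cases "1 \<le> i \<and> i \<le> length s")
  case True
  then have "drop (i - 1) s = s ! (i - 1) # drop i s"
    using Cons_nth_drop_Suc[of "i - 1" s] by (cases i) auto
  with True show ?thesis by (simp add: matches_def)
next
  case False
  then show ?thesis by (auto simp: matches_def)
qed

lemma set_lit_rows: "set (lit_rows xs s a) = rows xs s {[Sym a]}"
proof -
  have "set (filter (\<lambda>p. snd p = a) (enumerate 1 s)) = (\<lambda>i. (i, a)) ` {i. matches s i [Sym a]}"
    unfolding matches_Sym by (force simp: in_set_enumerate_eq)
  then have "set (lit_rows xs s a) = (\<lambda>i. ((i, Suc i), map (\<lambda>_. []) xs)) ` {i. matches s i [Sym a]}"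
    unfolding lit_rows_def set_map by (simp add: image_image)
  also have "\<dots> = {word_row xs i [Sym a] | i. matches s i [Sym a]}"
    by (auto simp: word_row_def tuple_at_def)
  finally show ?thesis by (auto simp: rows_def)
qed

lemma merge_map:
  "merge (map f xs) (map g xs) = map (\<lambda>x. if f x = [] then g x else f x) xs"
  by (induction xs) (auto simp: merge_def)

lemma word_row_append:
  assumes "balanced r"
  shows "word_row xs i (r @ r') =
    ((i, snd (fst (word_row xs (i + length (clr r)) r'))),
      merge (snd (word_row xs i r)) (snd (word_row xs (i + length (clr r)) r')))"
  using assms
  by (auto simp: word_row_def merge_map tuple_at_append balanced_def tuple_at_eq_None_iff)

lemma set_join_rows:
  assumes "set T1 = rows xs s L1" "set T2 = rows xs s L2" "\<And>r. r \<in> L1 \<Longrightarrow> balanced r"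
  shows "set (join_rows T1 T2) = rows xs s {u @ v | u v. u \<in> L1 \<and> v \<in> L2}"
proof
  show "set (join_rows T1 T2) \<subseteq> rows xs s {u @ v | u v. u \<in> L1 \<and> v \<in> L2}"
  proof
    fix z assume "z \<in> set (join_rows T1 T2)"
    then obtain r1 r2 where r: "r1 \<in> rows xs s L1" "r2 \<in> rows xs s L2" "snd (fst r1) = fst (fst r2)"
      "z = ((fst (fst r1), snd (fst r2)), merge (snd r1) (snd r2))"
      using assms by (auto simp: join_rows_def)
    then obtain i u j v where u: "r1 = word_row xs i u" "u \<in> L1" "matches s i u"
      and v: "r2 = word_row xs j v" "v \<in> L2" "matches s j v"
      by (auto simp: rows_def)
    have "j = i + length (clr u)" using r u v by (simp add: word_row_def)
    then have "z = word_row xs i (u @ v)" "matches s i (u @ v)"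
      using r u v assms(3) by (auto simp: word_row_append matches_append) (auto simp: word_row_def)
    then show "z \<in> rows xs s {u @ v | u v. u \<in> L1 \<and> v \<in> L2}"
      using u v unfolding rows_def by blast
  qed
next
  show "rows xs s {u @ v | u v. u \<in> L1 \<and> v \<in> L2} \<subseteq> set (join_rows T1 T2)"
  proof
    fix z assume "z \<in> rows xs s {u @ v | u v. u \<in> L1 \<and> v \<in> L2}"
    then obtain i u v where z: "z = word_row xs i (u @ v)" "u \<in> L1" "v \<in> L2" "matches s i (u @ v)"
      by (auto simp: rows_def)
    let ?r1 = "word_row xs i u" and ?r2 = "word_row xs (i + length (clr u)) v"
    have "?r1 \<in> set T1" "?r2 \<in> set T2"
      using z assms by (auto simp: rows_def matches_append)
    moreover have "snd (fst ?r1) = fst (fst ?r2)" by (simp add: word_row_def)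
    moreover have "z = ((fst (fst ?r1), snd (fst ?r2)), merge (snd ?r1) (snd ?r2))"
      using z assms(3) by (auto simp: word_row_append) (auto simp: word_row_def)
    ultimately show "z \<in> set (join_rows T1 T2)"
      by (force simp: join_rows_def)
  qed
qed

text \<open>Freshness of \<open>x\<close> matters: with brackets of \<open>x\<close> inside the
  word, \<open>tuple_at\<close> would stop at the inner closing bracket, whereas
  \<open>capt_rows\<close> records the outer span.\<close>

lemma set_capt_rows:
  assumes "set T = rows xs s L" and fresh: "\<And>r. r \<in> L \<Longrightarrow> Open x \<notin> set r"
    and bal: "\<And>r. r \<in> L \<Longrightarrow> balanced r"
  shows "set (capt_rows xs x T) = rows xs s {Open x # u @ [Close x] | u. u \<in> L}"
proof -
  define f where "f r = (fst r, map (\<lambda>p. if fst p = x then span_name (fst r) else snd p) (zip xs (snd r)))"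
    for r :: row
  have f: "f (word_row xs i u) = word_row xs i (Open x # u @ [Close x])" if "u \<in> L" for i and u :: "'a letter list"
  proof -
    have "Close x \<notin> set u" using fresh bal that by (auto simp: balanced_def)
    then have "takeWhile (\<lambda>l. l \<noteq> Close x) (u @ [Close x]) = u"
      by (subst takeWhile_append2) auto
    then have x: "tuple_at i (Open x # u @ [Close x]) x = Some (i, i + length (clr u))"
      by (simp add: tuple_at_def)
    have y: "tuple_at i (Open x # u @ [Close x]) y = tuple_at i u y" if "y \<noteq> x" for y
    proof -
      have "Open y \<in> set u \<longleftrightarrow> Close y \<in> set u" using bal \<open>u \<in> L\<close> by (simp add: balanced_def)
      then have "tuple_at i (u @ [Close x]) y = tuple_at i u y"
        using that by (subst tuple_at_append) (auto simp: tuple_at_def)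
      moreover have "tuple_at i (Open x # u @ [Close x]) y = tuple_at i (u @ [Close x]) y"
        using that by (simp add: tuple_at_def)
      ultimately show ?thesis by simp
    qed
    have "map (\<lambda>p. if fst p = x then c else snd p) (zip xs (map g xs)) =
        map (\<lambda>y. if y = x then c else g y) xs" for c and g :: "name \<Rightarrow> name"
      by (induction xs) auto
    then show ?thesis
      by (auto simp: f_def word_row_def x y)
  qed
  have m: "matches s i (Open x # u @ [Close x]) \<longleftrightarrow> matches s i u" for i u
    by (simp add: matches_def)
  have "set (capt_rows xs x T) = f ` rows xs s L"
    by (simp add: capt_rows_def f_def assms(1)[symmetric])
  also have "\<dots> = rows xs s {Open x # u @ [Close x] | u. u \<in> L}"
  proof (intro equalityI subsetI)
    fix z assume "z \<in> f ` rows xs s L"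
    then obtain i u where u: "u \<in> L" "matches s i u" "z = f (word_row xs i u)"
      by (auto simp: rows_def)
    have "z = word_row xs i (Open x # u @ [Close x])" using u f by simp
    moreover have "matches s i (Open x # u @ [Close x])" using u m by blast
    ultimately show "z \<in> rows xs s {Open x # u @ [Close x] | u. u \<in> L}"
      using u(1) unfolding rows_def by blast
  next
    fix z assume "z \<in> rows xs s {Open x # u @ [Close x] | u. u \<in> L}"
    then obtain i u where u: "u \<in> L" "matches s i (Open x # u @ [Close x])"
      "z = word_row xs i (Open x # u @ [Close x])" unfolding rows_def by blast
    then have "word_row xs i u \<in> rows xs s L" using m unfolding rows_def by blast
    moreover have "z = f (word_row xs i u)" using u f by simp
    ultimately show "z \<in> f ` rows xs s L" by blast
  qed
  finally show ?thesis .
qed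

text \<open>Choose one side of each alternative and no iteration of any star: each literal
  occurrence is then used at most once, and it contributes at least one node to the code.\<close>

lemma exists_short_word:
  fixes \<alpha> :: "'a::finite regex"
  shows "ref_lang \<alpha> \<noteq> {} \<Longrightarrow> \<exists>r\<in>ref_lang \<alpha>. length (clr r) \<le> size (enc_regex \<alpha>)"
proof (induction \<alpha>)
  case (Cat \<alpha> \<beta>)
  then obtain u v where "u \<in> ref_lang \<alpha>" "length (clr u) \<le> size (enc_regex \<alpha>)"
    "v \<in> ref_lang \<beta>" "length (clr v) \<le> size (enc_regex \<beta>)" by force
  then show ?case by (intro bexI[of _ "u @ v"]) auto
next
  case (Or \<alpha> \<beta>)
  then show ?case by (force intro: trans_le_add1 trans_le_add2)
next
  case (Star \<alpha>)
  show ?case by (rule bexI[of _ "[]"]) (auto intro!: exI[of _ "[]"])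
next
  case (Capt x \<alpha>)
  then obtain u where "u \<in> ref_lang \<alpha>" "length (clr u) \<le> size (enc_regex \<alpha>)" by force
  then show ?case by (intro bexI[of _ "Open x # u @ [Close x]"]) auto
qed auto

subsection \<open>Correctness of the tables\<close>

lemma truncate_eq:
  "esize (remdups T) \<le> B \<Longrightarrow> set (truncate B T) = set T"
  by (simp add: truncate_def)

locale bounded_formula =
  fixes \<alpha>0 :: "'a::finite regex" and C d :: nat
  assumes functional: "functional \<alpha>0"
    and bounded: "card (regex_eval \<alpha>0 s) \<le> C * (length s + 1) ^ d"
begin

text \<open>
  A subformula is useful if its words extend to words of the whole formula in a short context.
  The tuples of a useful subformula extend injectively to tuples of the whole formula on a string
  that is not much longer, so that they inherit the polynomial bound.
\<close>

definition useful :: "'a regex \<Rightarrow> bool" where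
  "useful \<beta> \<longleftrightarrow> (\<exists>u v. length (clr u) + length (clr v) + size (enc_regex \<beta>) \<le> size (enc_regex \<alpha>0) \<and>
     (\<forall>r\<in>ref_lang \<beta>. u @ r @ v \<in> ref_lang \<alpha>0))"

lemma useful_root: "useful \<alpha>0"
  unfolding useful_def by (intro exI[of _ "[]"]) simp

lemma useful_Or:
  assumes "useful (Or \<beta> \<gamma>)" shows "useful \<beta>" "useful \<gamma>"
proof -
  obtain u v where "length (clr u) + length (clr v) + size (enc_regex (Or \<beta> \<gamma>)) \<le> size (enc_regex \<alpha>0)"
    "\<forall>r\<in>ref_lang (Or \<beta> \<gamma>). u @ r @ v \<in> ref_lang \<alpha>0"
    using assms by (auto simp: useful_def)
  then show "useful \<beta>" "useful \<gamma>"
    unfolding useful_def by (intro exI[of _ u] exI[of _ v]; simp)+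
qed

text \<open>The sibling factor is frozen to a short word that joins the context. Its length is paid
  for by the size of the sibling, which the bound in \<open>useful\<close> releases on passing to
  \<open>\<beta>\<close>.\<close>

lemma useful_Cat1: assumes "useful (Cat \<beta> \<gamma>)" "ref_lang \<gamma> \<noteq> {}" shows "useful \<beta>"
proof -
  obtain u v where uv: "length (clr u) + length (clr v) + size (enc_regex (Cat \<beta> \<gamma>)) \<le> size (enc_regex \<alpha>0)"
    "\<forall>r\<in>ref_lang (Cat \<beta> \<gamma>). u @ r @ v \<in> ref_lang \<alpha>0"
    using assms by (auto simp: useful_def)
  obtain w where w: "w \<in> ref_lang \<gamma>" "length (clr w) \<le> size (enc_regex \<gamma>)"
    using exists_short_word assms by blast
  have "\<forall>r\<in>ref_lang \<beta>. u @ r @ (w @ v) \<in> ref_lang \<alpha>0"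
    using uv(2) w(1) by (metis (mono_tags, lifting) append.assoc mem_Collect_eq ref_lang.simps(5))
  with uv(1) w(2) show ?thesis
    unfolding useful_def by (intro exI[of _ u] exI[of _ "w @ v"]) auto
qed

lemma useful_Cat2: assumes "useful (Cat \<beta> \<gamma>)" "ref_lang \<beta> \<noteq> {}" shows "useful \<gamma>"
proof -
  obtain u v where uv: "length (clr u) + length (clr v) + size (enc_regex (Cat \<beta> \<gamma>)) \<le> size (enc_regex \<alpha>0)"
    "\<forall>r\<in>ref_lang (Cat \<beta> \<gamma>). u @ r @ v \<in> ref_lang \<alpha>0"
    using assms by (auto simp: useful_def)
  obtain w where w: "w \<in> ref_lang \<beta>" "length (clr w) \<le> size (enc_regex \<beta>)"
    using exists_short_word assms by blast
  have "\<forall>r\<in>ref_lang \<gamma>. (u @ w) @ r @ v \<in> ref_lang \<alpha>0"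
    using uv(2) w(1) by (metis (mono_tags, lifting) append.assoc mem_Collect_eq ref_lang.simps(5))
  with uv(1) w(2) show ?thesis
    unfolding useful_def by (intro exI[of _ "u @ w"] exI[of _ v]) auto
qed

lemma Star_context: "\<forall>r\<in>ref_lang (Star \<beta>). P r \<Longrightarrow> r \<in> ref_lang \<beta> \<Longrightarrow> P r"
proof -
  assume "\<forall>r\<in>ref_lang (Star \<beta>). P r" and r: "r \<in> ref_lang \<beta>"
  moreover have "concat [r] \<in> ref_lang (Star \<beta>)" unfolding ref_lang.simps using r by fastforce
  ultimately show "P r" by simp
qed

lemma useful_Star: "useful (Star \<beta>) \<Longrightarrow> useful \<beta>"
proof -
  assume "useful (Star \<beta>)"
  then obtain u v where "length (clr u) + length (clr v) + size (enc_regex (Star \<beta>)) \<le> size (enc_regex \<alpha>0)"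
    "\<forall>r\<in>ref_lang (Star \<beta>). u @ r @ v \<in> ref_lang \<alpha>0"
    unfolding useful_def by blast
  then show ?thesis unfolding useful_def
    using Star_context[of \<beta> "\<lambda>r. u @ r @ v \<in> ref_lang \<alpha>0"]
    by (intro exI[of _ u] exI[of _ v]) (auto simp del: ref_lang.simps)
qed

text \<open>The brackets move into the context at no cost, since only letters of the alphabet are
  counted.\<close>

lemma useful_Capt: "useful (Capt x \<beta>) \<Longrightarrow> useful \<beta>"
proof -
  assume "useful (Capt x \<beta>)"
  then obtain u v where "length (clr u) + length (clr v) + size (enc_regex (Capt x \<beta>)) \<le> size (enc_regex \<alpha>0)"
    "\<forall>r\<in>ref_lang (Capt x \<beta>). u @ r @ v \<in> ref_lang \<alpha>0"
    by (auto simp: useful_def)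
  then show ?thesis unfolding useful_def
    by (intro exI[of _ "u @ [Open x]"] exI[of _ "Close x # v"]) auto
qed

text \<open>Functionality is available for the whole formula only; the completed word is valid,
  which controls the brackets of its middle part.\<close>

lemma useful_count:
  assumes "\<forall>r\<in>ref_lang \<beta>. u @ r @ v \<in> ref_lang \<alpha>0" "r \<in> ref_lang \<beta>" "Open x \<in> set r"
  shows "x \<in> vars \<alpha>0" "count_list (u @ r @ v) (Open x) = 1" "count_list (u @ r @ v) (Close x) = 1"
proof -
  have v: "valid (vars \<alpha>0) (u @ r @ v)" using assms functional by (auto simp: functional_def)
  show "x \<in> vars \<alpha>0" using assms(3) valid_Open_iff[OF v, of x] by auto
  with v show "count_list (u @ r @ v) (Open x) = 1" "count_list (u @ r @ v) (Close x) = 1"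
    by (auto simp: valid_def)
qed

text \<open>Two copies of \<open>r\<close> would open \<open>x\<close> twice in a word of the whole
  formula.\<close>

lemma useful_Star_no_vars:
  assumes "useful (Star \<beta>)" "r \<in> ref_lang \<beta>" shows "Open x \<notin> set r"
proof
  assume x: "Open x \<in> set r"
  obtain u v where uv: "\<forall>r\<in>ref_lang (Star \<beta>). u @ r @ v \<in> ref_lang \<alpha>0"
    using assms by (auto simp: useful_def)
  have "concat [r, r] \<in> ref_lang (Star \<beta>)" unfolding ref_lang.simps using assms by fastforce
  from useful_count(2)[OF uv this, of x] x
  have "count_list r (Open x) + count_list r (Open x) \<le> 1" by simp
  moreover have "count_list r (Open x) \<noteq> 0" using x by (simp add: count_list_0_iff)
  ultimately show False by simp
qed

lemma useful_Capt_fresh: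
  assumes "useful (Capt x \<beta>)" "r \<in> ref_lang \<beta>" shows "Open x \<notin> set r"
proof
  assume x: "Open x \<in> set r"
  obtain u v where uv: "\<forall>r\<in>ref_lang (Capt x \<beta>). u @ r @ v \<in> ref_lang \<alpha>0"
    using assms by (auto simp: useful_def)
  have "Open x # r @ [Close x] \<in> ref_lang (Capt x \<beta>)" using assms by simp
  from useful_count(2)[OF uv this, of x] x
  have "count_list r (Open x) = 0" by simp
  with x show False by (simp add: count_list_0_iff)
qed

text \<open>Once the span is fixed, every completed word \<open>u @ r @ v\<close> spells the same
  string \<open>s'\<close>, and the row of \<open>r\<close> can be recovered from the tuple of the
  completed word by a map \<open>g\<close>. Hence the rows lie in an image of
  \<open>regex_eval \<alpha>0 s'\<close>, whose size is bounded by assumption.\<close>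

lemma card_rows_at:
  assumes "useful \<beta>"
  shows "finite {z \<in> rows xs s (ref_lang \<beta>). fst z = (i, j)} \<and>
    card {z \<in> rows xs s (ref_lang \<beta>). fst z = (i, j)} \<le> C * (length s + size (enc_regex \<alpha>0) + 1) ^ d"
proof -
  obtain u v where uv: "length (clr u) + length (clr v) + size (enc_regex \<beta>) \<le> size (enc_regex \<alpha>0)"
    "\<forall>r\<in>ref_lang \<beta>. u @ r @ v \<in> ref_lang \<alpha>0"
    using assms by (auto simp: useful_def)
  define s' where "s' = clr u @ take (j - i) (drop (i - 1) s) @ clr v"
  \<comment> \<open>Variables bound by the context are left unassigned in the row of the inner
    word.\<close>
  define V where "V = {x \<in> vars \<alpha>0. Open x \<notin> set u \<and> Open x \<notin> set v}"
  \<comment> \<open>Undoes the shift: \<open>r\<close> starts at position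
    \<open>1 + length (clr u)\<close> in the completed word and at \<open>i\<close> in
    \<open>s\<close>. For variables bound in \<open>r\<close> the subtractions do not truncate, as
    their spans start no earlier.\<close>
  define g where "g \<mu> = ((i, j), map (\<lambda>x. if x \<in> V then
      entry (map_option (\<lambda>p. (fst p - (1 + length (clr u)) + i, snd p - (1 + length (clr u)) + i)) (\<mu> x))
      else []) xs)" for \<mu> :: "name \<rightharpoonup> span"
  have "{z \<in> rows xs s (ref_lang \<beta>). fst z = (i, j)} \<subseteq> g ` regex_eval \<alpha>0 s'"
  proof
    fix z assume "z \<in> {z \<in> rows xs s (ref_lang \<beta>). fst z = (i, j)}"
    then obtain r where r: "r \<in> ref_lang \<beta>" "matches s i r" "z = word_row xs i r" "j = i + length (clr r)"
      by (auto simp: rows_def word_row_def)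
    let ?w = "u @ r @ v"
    have w: "?w \<in> ref_lang \<alpha>0" using r uv by blast
    have valid: "valid (vars \<alpha>0) ?w" using w functional by (auto simp: functional_def)
    have "clr ?w = s'" using r by (simp add: s'_def matches_def)
    with w have \<mu>: "tuple_at 1 ?w \<in> regex_eval \<alpha>0 s'"
      using functional by (auto simp: regex_eval_eq)
    have bal: "balanced r" using r balanced_ref_lang by blast
    have "entry (tuple_at i r x) = (if x \<in> V then
      entry (map_option (\<lambda>p. (fst p - (1 + length (clr u)) + i, snd p - (1 + length (clr u)) + i)) (tuple_at 1 ?w x))
      else [])" for x
    proof (cases "Open x \<in> set r")
      case True
      then have "Close x \<in> set r" using bal by (simp add: balanced_def)
      have "count_list r (Open x) \<noteq> 0" "count_list r (Close x) \<noteq> 0"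
        using True \<open>Close x \<in> set r\<close> by (simp_all add: count_list_0_iff)
      with useful_count(2,3)[OF uv(2) r(1) True]
      have "count_list u (Open x) = 0" "count_list v (Open x) = 0" "count_list u (Close x) = 0"
        unfolding count_list_append by linarith+
      then have "Open x \<notin> set u" "Open x \<notin> set v" "Close x \<notin> set u" "x \<in> vars \<alpha>0"
        using useful_count(1)[OF uv(2) r(1) True] by (simp_all add: count_list_0_iff)
      then have "x \<in> V" by (simp add: V_def)
      have "tuple_at 1 ?w x = tuple_at (1 + length (clr u)) (r @ v) x"
        using \<open>Open x \<notin> set u\<close> \<open>Close x \<notin> set u\<close> by (subst tuple_at_append) auto
      also have "\<dots> = tuple_at (1 + length (clr u)) r x"
        using True \<open>Close x \<in> set r\<close> by (rule tuple_at_append_left)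
      finally have "tuple_at 1 ?w x = tuple_at (1 + length (clr u)) r x" .
      with \<open>x \<in> V\<close> True show ?thesis by (simp add: tuple_at_def)
    next
      case False
      \<comment> \<open>A variable of the formula that is missing in \<open>r\<close> must be bound
        in \<open>u\<close> or \<open>v\<close>, as the completed word is valid.\<close>
      then have "x \<notin> V"
        using valid_Open_iff[OF valid, of x] by (auto simp: V_def)
      with False show ?thesis by (simp add: tuple_at_def)
    qed
    then have "z = g (tuple_at 1 ?w)"
      by (simp add: r(3,4) word_row_def g_def)
    with \<mu> show "z \<in> g ` regex_eval \<alpha>0 s'" by blast
  qed
  moreover have fin: "finite (regex_eval \<alpha>0 s')" by (rule finite_regex_eval[OF functional])
  ultimately have "finite {z \<in> rows xs s (ref_lang \<beta>). fst z = (i, j)}"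
    and "card {z \<in> rows xs s (ref_lang \<beta>). fst z = (i, j)} \<le> card (regex_eval \<alpha>0 s')"
    by (auto intro: finite_subset order.trans[OF card_mono card_image_le])
  moreover have "length s' \<le> length s + size (enc_regex \<alpha>0)"
    using uv(1) by (simp add: s'_def) 
  then have "C * (length s' + 1) ^ d \<le> C * (length s + size (enc_regex \<alpha>0) + 1) ^ d"
    by (intro mult_le_mono2 power_mono) auto
  ultimately show ?thesis using bounded[of s'] by linarith
qed

text \<open>At most \<open>length s + 1\<close> choices for each end of the span, the bound of
  \<open>card_rows_at\<close> for each span, and the bound of \<open>word_row_bounds\<close> plus a
  list node for each row.\<close>

definition row_bound :: "name list \<Rightarrow> 'a list \<Rightarrow> nat" where
  "row_bound xs s = ((length s + 1) * (length s + 1) * (C * (length s + size (enc_regex \<alpha>0) + 1) ^ d)) *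
     (2 * length s + 4 + length xs * (2 * length s + 5) + 1)"

lemma rows_esize:
  assumes "useful \<beta>" "distinct T" "set T \<subseteq> rows xs s (ref_lang \<beta>)"
  shows "esize T \<le> row_bound xs s"
proof -
  let ?R = "rows xs s (ref_lang \<beta>)" and ?n = "length s + 1"
  let ?K = "C * (length s + size (enc_regex \<alpha>0) + 1) ^ d"
  have R: "?R = (\<Union>p\<in>{1..?n} \<times> {1..?n}. {z \<in> ?R. fst z = p})"
    using matches_bound[of s] by (fastforce simp: rows_def word_row_def matches_def)
  have "finite ?R"
    by (subst R) (use card_rows_at[OF assms(1)] in auto)
  then have "length T \<le> card ?R"
    using assms by (metis card_mono distinct_card)
  also have "\<dots> \<le> (\<Sum>p\<in>{1..?n} \<times> {1..?n}. card {z \<in> ?R. fst z = p})"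
    by (subst R) (rule card_UN_le, simp)
  also have "\<dots> \<le> of_nat (card ({1..?n} \<times> {1..?n})) * ?K"
    using card_rows_at[OF assms(1)] by (intro sum_bounded_above) auto
  also have "\<dots> = ?n * ?n * ?K" by simp
  finally have l: "length T \<le> ?n * ?n * ?K" .
  have "esize T \<le> length T * (2 * length s + 4 + length xs * (2 * length s + 5) + 1)"
  proof (rule esize_list_le)
    fix z assume "z \<in> set T"
    then obtain i r where "z = word_row xs i r" "matches s i r"
      using assms(3) by (auto simp: rows_def)
    then show "esize z \<le> 2 * length s + 4 + length xs * (2 * length s + 5)"
      using word_row_bounds by simp
  qed
  also have "\<dots> \<le> row_bound xs s"
    unfolding row_bound_def using l by (rule mult_le_mono1)
  finally show ?thesis .
qed

context
  fixes xs :: "name list" and s :: "'a list" and B :: nat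
  assumes B: "row_bound xs s \<le> B"
begin

text \<open>Inclusion is assumed instead of equality because the intermediate stages of a star hold
  only part of its rows.\<close>

lemma set_truncate:
  assumes "useful \<beta>" "set T \<subseteq> rows xs s (ref_lang \<beta>)" shows "set (truncate B T) = set T"
  using rows_esize[OF assms(1), of "remdups T" xs s] assms(2) B by (intro truncate_eq) auto

lemma set_star_rows:
  assumes u: "useful (Star \<beta>)" and T: "set T = rows xs s (ref_lang \<beta>)"
  shows "set (star_rows xs s B T) = rows xs s (ref_lang (Star \<beta>))"
proof -
  \<comment> \<open>Strictly fewer than \<open>k\<close> factors, to match the start of the
    iteration with the empty table: \<open>L 0\<close> is empty.\<close>
  define L where "L k = {concat us | us. set us \<subseteq> ref_lang \<beta> \<and> length us < k}" for k
  have L_Suc: "L (Suc k) = {[]} \<union> {u @ v | u v. u \<in> L k \<and> v \<in> ref_lang \<beta>}" for k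
  proof (intro equalityI subsetI)
    fix w assume "w \<in> L (Suc k)"
    then obtain us where us: "w = concat us" "set us \<subseteq> ref_lang \<beta>" "length us < Suc k"
      by (auto simp: L_def)
    show "w \<in> {[]} \<union> {u @ v | u v. u \<in> L k \<and> v \<in> ref_lang \<beta>}"
    proof (cases us rule: rev_cases)
      case (snoc vs v)
      then have "concat vs \<in> L k" "v \<in> ref_lang \<beta>" "w = concat vs @ v"
        using us by (auto simp: L_def)
      then show ?thesis by blast
    qed (use us in auto)
  next
    fix w assume "w \<in> {[]} \<union> {u @ v | u v. u \<in> L k \<and> v \<in> ref_lang \<beta>}"
    then consider "w = []" | us v where "w = concat (us @ [v])" "set (us @ [v]) \<subseteq> ref_lang \<beta>"
      "length (us @ [v]) < Suc k"
      by (auto simp: L_def)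
    then show "w \<in> L (Suc k)"
    proof cases
      case 1
      then show ?thesis by (auto simp: L_def intro!: exI[of _ "[]"])
    next
      case 2
      then show ?thesis unfolding L_def by blast
    qed
  qed
  have L_sub: "L k \<subseteq> ref_lang (Star \<beta>)" for k by (auto simp: L_def)
  have iter: "set (foldl (\<lambda>A _. truncate B (eps_rows xs s @ join_rows A T)) [] (replicate k Tip)) = rows xs s (L k)"
    for k
  proof (induction k)
    case 0
    then show ?case by (simp add: rows_def L_def)
  next
    case (Suc k)
    let ?A = "foldl (\<lambda>A _. truncate B (eps_rows xs s @ join_rows A T)) [] (replicate k Tip)"
    have bal: "balanced r" if "r \<in> L k" for r
      using that L_sub balanced_ref_lang by blast
    have A: "set (eps_rows xs s @ join_rows ?A T) = rows xs s (L (Suc k))"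
      unfolding L_Suc rows_Un by (simp only: set_append set_eps_rows set_join_rows[OF Suc T bal])
    then have "set (truncate B (eps_rows xs s @ join_rows ?A T)) = rows xs s (L (Suc k))"
      using set_truncate[OF u] rows_mono[OF L_sub] by metis
    moreover have "replicate (Suc k) Tip = replicate k Tip @ [Tip]"
      by (simp add: replicate_append_same)
    ultimately show ?case by (simp only: foldl_append foldl.simps)
  qed
  have "rows xs s (L (Suc (length s))) = rows xs s (ref_lang (Star \<beta>))"
  proof
    show "rows xs s (L (Suc (length s))) \<subseteq> rows xs s (ref_lang (Star \<beta>))"
      by (rule rows_mono[OF L_sub])
    show "rows xs s (ref_lang (Star \<beta>)) \<subseteq> rows xs s (L (Suc (length s)))"
    proof
      fix z assume "z \<in> rows xs s (ref_lang (Star \<beta>))"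
      then obtain us i where us: "set us \<subseteq> ref_lang \<beta>" "matches s i (concat us)" "z = word_row xs i (concat us)"
        by (auto simp: rows_def)
      define vs where "vs = filter (\<lambda>r. clr r \<noteq> []) us"
      have clr: "clr (concat vs) = clr (concat us)"
        unfolding vs_def by (induction us) auto
      have "length ws \<le> length (clr (concat ws))" if "\<forall>r\<in>set ws. clr r \<noteq> []" for ws :: "'a letter list list"
        using that
      proof (induction ws)
        case (Cons w ws)
        have "1 \<le> length (clr w)" using Cons.prems by (simp add: Suc_le_eq)
        then show ?case using Cons by auto
      qed simp
      from this[of vs] have "length vs \<le> length (clr (concat us))"
        unfolding clr[symmetric] by (simp add: vs_def)
      also have "\<dots> \<le> length s" using matches_bound[OF us(2)] us(2) by (simp add: matches_def)
      finally have vs: "concat vs \<in> L (Suc (length s))"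
        unfolding L_def using us(1) by (force simp: vs_def)
      have no: "Open x \<notin> set (concat us)" "Open x \<notin> set (concat vs)" for x
        using useful_Star_no_vars[OF u, of _ x] us(1) by (auto simp: vs_def)
      have "word_row xs i (concat us) = word_row xs i (concat vs)"
        unfolding word_row_def tuple_at_def using no clr by simp
      moreover have "matches s i (concat vs)" using us(2) clr by (simp add: matches_def)
      ultimately show "z \<in> rows xs s (L (Suc (length s)))"
        using vs us(3) unfolding rows_def by blast
    qed
  qed
  then show ?thesis unfolding star_rows_def iter .
qed

lemma set_table:
  "useful \<beta> \<Longrightarrow> set (table xs s B \<beta>) = rows xs s (ref_lang \<beta>)"
proof (induction \<beta>)
  case Empty
  then show ?case by (simp add: rows_def)
next
  case Eps
  then show ?case using set_truncate[OF Eps, of "eps_rows xs s"] by (simp add: set_eps_rows)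
next
  case (Lit a)
  then show ?case using set_truncate[OF Lit, of "lit_rows xs s a"] by (simp add: set_lit_rows)
next
  case (Or \<beta> \<gamma>)
  then have "set (table xs s B \<beta> @ table xs s B \<gamma>) = rows xs s (ref_lang (Or \<beta> \<gamma>))"
    using useful_Or[OF Or.prems] by (simp add: rows_Un)
  with set_truncate[OF Or.prems] show ?case by simp
next
  case (Cat \<beta> \<gamma>)
  show ?case
  proof (cases "ref_lang \<beta> = {} \<or> ref_lang \<gamma> = {}")
    case True
    \<comment> \<open>The induction hypotheses do not apply here, since a factor next to an
      unproductive one need not be useful.\<close>
    then have "table xs s B (Cat \<beta> \<gamma>) = []" "ref_lang (Cat \<beta> \<gamma>) = {}"
      using table_eq_Nil[of \<beta> xs s B] table_eq_Nil[of \<gamma> xs s B] by auto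
    then show ?thesis by (simp add: rows_def del: table.simps ref_lang.simps)
  next
    case False
    then have "set (table xs s B \<beta>) = rows xs s (ref_lang \<beta>)" "set (table xs s B \<gamma>) = rows xs s (ref_lang \<gamma>)"
      using Cat useful_Cat1 useful_Cat2 by blast+
    from set_join_rows[OF this] balanced_ref_lang
    have "set (join_rows (table xs s B \<beta>) (table xs s B \<gamma>)) = rows xs s (ref_lang (Cat \<beta> \<gamma>))"
      by auto
    with set_truncate[OF Cat.prems] show ?thesis by simp
  qed
next
  case (Star \<beta>)
  then show ?case using set_star_rows[OF Star.prems] useful_Star by simp
next
  case (Capt x \<beta>)
  have "set (capt_rows xs x (table xs s B \<beta>)) = rows xs s (ref_lang (Capt x \<beta>))"
    using set_capt_rows[OF Capt.IH[OF useful_Capt[OF Capt.prems]] useful_Capt_fresh[OF Capt.prems]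
        balanced_ref_lang]
    by simp
  with set_truncate[OF Capt.prems] show ?case by simp
qed

lemma table_root:
  "{snd z | z. z \<in> set (table xs s B \<alpha>0) \<and> fst z = (1, length s + 1)} =
    (\<lambda>\<mu>. map (\<lambda>x. entry (\<mu> x)) xs) ` regex_eval \<alpha>0 s"
proof -
  have "{snd z | z. z \<in> set (table xs s B \<alpha>0) \<and> fst z = (1, length s + 1)} =
    {map (\<lambda>x. entry (tuple_at 1 r x)) xs | r. r \<in> ref_lang \<alpha>0 \<and> matches s 1 r \<and> 1 + length (clr r) = length s + 1}"
    (is "?A = ?B")
  proof (intro equalityI subsetI)
    fix z assume "z \<in> ?A"
    then show "z \<in> ?B"
      unfolding set_table[OF useful_root] rows_def word_row_def by fastforce
  next
    fix z assume "z \<in> ?B"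
    then obtain r where r: "r \<in> ref_lang \<alpha>0" "matches s 1 r" "1 + length (clr r) = length s + 1"
      "z = snd (word_row xs 1 r)" by (auto simp: word_row_def)
    then have "word_row xs 1 r \<in> set (table xs s B \<alpha>0)"
      unfolding set_table[OF useful_root] rows_def by blast
    moreover have "fst (word_row xs 1 r) = (1, length s + 1)"
      using r(3) by (simp add: word_row_def)
    ultimately show "z \<in> ?A" using r(4) by blast
  qed
  also have "\<dots> = (\<lambda>\<mu>. map (\<lambda>x. entry (\<mu> x)) xs) ` regex_eval \<alpha>0 s"
    unfolding matches_full regex_eval_eq[OF functional] by blast
  finally show ?thesis .
qed

end

end

text \<open>Programs work on letters coded by numbers, while correctness is proved over the original
  alphabet. The tables use letters only in equality tests, so an injective renaming does not affect
  them.\<close>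

lemma table_map:
  assumes "inj f" shows "table xs (map f s) B (map_regex f \<alpha>) = table xs s B \<alpha>"
proof -
  have "eps_rows xs (map f s) = eps_rows xs s" by (simp add: eps_rows_def)
  moreover have "lit_rows xs (map f s) (f a) = lit_rows xs s a" for a
  proof -
    have "enumerate n (map f s) = map (\<lambda>p. (fst p, f (snd p))) (enumerate n s)" for n
      by (induction s arbitrary: n) auto
    then show ?thesis
      by (simp add: lit_rows_def filter_map comp_def inj_eq[OF assms])
  qed
  ultimately show ?thesis
    by (induction \<alpha>) (simp_all add: star_rows_def)
qed

lemma vars_map_regex [simp]: "vars (map_regex f \<alpha>) = vars \<alpha>"
  by (induction \<alpha>) auto

section \<open>The tables are computable in polynomial time\<close>

text \<open>Copies the prescribed \<open>enc_regex\<close> with the generic code for letters, so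
  that formulas become encodable data; once letters are coded by \<open>to_nat\<close> the two
  agree.\<close>

fun enc_rx :: "'a::encodable regex \<Rightarrow> tree" where
  "enc_rx Empty = Bin (enc_nat 0) Tip"
| "enc_rx Eps = Bin (enc_nat 1) Tip"
| "enc_rx (Lit a) = Bin (enc_nat 2) (enc a)"
| "enc_rx (Or \<alpha> \<beta>) = Bin (enc_nat 3) (Bin (enc_rx \<alpha>) (enc_rx \<beta>))"
| "enc_rx (Cat \<alpha> \<beta>) = Bin (enc_nat 4) (Bin (enc_rx \<alpha>) (enc_rx \<beta>))"
| "enc_rx (Star \<alpha>) = Bin (enc_nat 5) (enc_rx \<alpha>)"
| "enc_rx (Capt x \<alpha>) = Bin (enc_nat 6) (Bin (enc x) (enc_rx \<alpha>))"

lemma enc_rx_inj: "enc_rx \<alpha> = enc_rx \<beta> \<Longrightarrow> \<alpha> = \<beta>"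
proof (induction \<alpha> arbitrary: \<beta>)
  case Empty
  then show ?case by (cases \<beta>) (auto simp: eval_nat_numeral)
next
  case Eps
  then show ?case by (cases \<beta>) (auto simp: eval_nat_numeral)
next
  case (Lit a)
  then show ?case by (cases \<beta>) (auto simp: eval_nat_numeral)
next
  case (Or \<alpha>1 \<alpha>2)
  from Or.prems Or.IH show ?case by (cases \<beta>) (auto simp: eval_nat_numeral)
next
  case (Cat \<alpha>1 \<alpha>2)
  from Cat.prems Cat.IH show ?case by (cases \<beta>) (auto simp: eval_nat_numeral)
next
  case (Star \<alpha>)
  from Star.prems Star.IH show ?case by (cases \<beta>) (auto simp: eval_nat_numeral)
next
  case (Capt x \<alpha>)
  from Capt.prems Capt.IH show ?case by (cases \<beta>) (auto simp: eval_nat_numeral)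
qed

instantiation regex :: (encodable) encodable
begin
definition enc_regex_inst: "enc = enc_rx"
instance by standard (auto simp: enc_regex_inst intro: enc_rx_inj)
end

lemma enc_map_regex: "enc (map_regex to_nat \<alpha>) = enc_regex \<alpha>"
  unfolding enc_regex_inst
  by (induction \<alpha>) (simp_all add: enc_letter_def enc_nat_inst enc_name_eq)

fun rtag :: "'a regex \<Rightarrow> nat" where
  "rtag Empty = 0"
| "rtag Eps = 1"
| "rtag (Lit a) = 2"
| "rtag (Or \<alpha> \<beta>) = 3"
| "rtag (Cat \<alpha> \<beta>) = 4"
| "rtag (Star \<alpha>) = 5"
| "rtag (Capt x \<alpha>) = 6"

text \<open>Together with \<open>rtag\<close>, \<open>rname\<close> and \<open>rkids\<close> this
  replaces pattern matching by functions that can be read off the code. The defaults of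
  \<open>rletter\<close> and \<open>rname\<close> are the values coded by
  \<open>Tip\<close>.\<close>

fun rletter :: "nat regex \<Rightarrow> nat" where
  "rletter (Lit a) = a"
| "rletter _ = 0"

fun rname :: "'a regex \<Rightarrow> name" where
  "rname (Capt x \<alpha>) = x"
| "rname _ = []"

fun rkids :: "'a regex \<Rightarrow> 'a regex list" where
  "rkids (Or \<alpha> \<beta>) = [\<alpha>, \<beta>]"
| "rkids (Cat \<alpha> \<beta>) = [\<alpha>, \<beta>]"
| "rkids (Star \<alpha>) = [\<alpha>]"
| "rkids (Capt x \<alpha>) = [\<alpha>]"
| "rkids _ = []"

lemma polytime_rtag [polytime_intros]: "polytime f \<Longrightarrow> polytime (\<lambda>x. rtag (f x))"
proof (rule polytime_enc_cong[where f = "\<lambda>x. tfst (enc (f x))"])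
  show "enc (tfst (enc (f x))) = enc (rtag (f x))" for x
    by (cases "f x") (simp_all add: enc_regex_inst enc_nat_inst)
qed (intro polytime_intros)

lemma polytime_rletter [polytime_intros]: "polytime f \<Longrightarrow> polytime (\<lambda>x. rletter (f x))"
proof (rule polytime_enc_cong[where f = "\<lambda>x. if rtag (f x) = 2 then tsnd (enc (f x)) else Tip"])
  show "enc (if rtag (f x) = 2 then tsnd (enc (f x)) else Tip) = enc (rletter (f x))" for x
    by (cases "f x") (simp_all add: enc_regex_inst)
qed (intro polytime_intros)

lemma polytime_rname [polytime_intros]: "polytime f \<Longrightarrow> polytime (\<lambda>x. rname (f x))"
proof (rule polytime_enc_cong[where f = "\<lambda>x. if rtag (f x) = 6 then tfst (tsnd (enc (f x))) else Tip"])
  show "enc (if rtag (f x) = 6 then tfst (tsnd (enc (f x))) else Tip) = enc (rname (f x))" for x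
    by (cases "f x") (simp_all add: enc_regex_inst)
qed (intro polytime_intros)

lemma polytime_rkids [polytime_intros]: "polytime f \<Longrightarrow> polytime (\<lambda>x. rkids (f x))"
proof (rule polytime_enc_cong[where f = "\<lambda>x. let t = rtag (f x); e = tsnd (enc (f x)) in
    if t = 3 then [tfst e, tsnd e] else if t = 4 then [tfst e, tsnd e]
    else if t = 5 then [e] else if t = 6 then [tsnd e] else []"])
  show "enc (let t = rtag (f x); e = tsnd (enc (f x)) in
    if t = 3 then [tfst e, tsnd e] else if t = 4 then [tfst e, tsnd e]
    else if t = 5 then [e] else if t = 6 then [tsnd e] else []) = enc (rkids (f x))" for x
    by (cases "f x") (simp_all add: enc_regex_inst)
qed (unfold Let_def, intro polytime_intros)

text \<open>Preorder: read backwards, the list has the parts of a formula before the formula itself,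
  which replaces recursion.\<close>

fun subregexes :: "'a regex \<Rightarrow> 'a regex list" where
  "subregexes (Or \<alpha> \<beta>) = Or \<alpha> \<beta> # subregexes \<alpha> @ subregexes \<beta>"
| "subregexes (Cat \<alpha> \<beta>) = Cat \<alpha> \<beta> # subregexes \<alpha> @ subregexes \<beta>"
| "subregexes (Star \<alpha>) = Star \<alpha> # subregexes \<alpha>"
| "subregexes (Capt x \<alpha>) = Capt x \<alpha> # subregexes \<alpha>"
| "subregexes \<alpha> = [\<alpha>]"

lemma subregexes_eq: "subregexes \<alpha> = \<alpha> # concat (map subregexes (rkids \<alpha>))"
  by (cases \<alpha>) auto

lemma length_subregexes_le: "length (subregexes \<alpha>) \<le> esize \<alpha>"
  by (induction \<alpha>) (auto simp: esize_def enc_regex_inst)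

lemma esize_in_subregexes: "\<beta> \<in> set (subregexes \<alpha>) \<Longrightarrow> esize \<beta> \<le> esize \<alpha>"
  by (induction \<alpha>) (auto simp: esize_def enc_regex_inst)

lemma esize_subregexes_le: "esize (subregexes \<alpha>) \<le> esize \<alpha> * (esize \<alpha> + 1)"
proof -
  have "esize (subregexes \<alpha>) \<le> length (subregexes \<alpha>) * (esize \<alpha> + 1)"
    by (rule esize_list_le) (rule esize_in_subregexes)
  also have "\<dots> \<le> esize \<alpha> * (esize \<alpha> + 1)"
    by (rule mult_le_mono1[OF length_subregexes_le])
  finally show ?thesis .
qed

lemma esize_worklist_le: "esize ws \<le> esize (concat (map subregexes ws))"
proof (induction ws)
  case (Cons w ws)
  have "esize (subregexes w) = esize w + esize (concat (map subregexes (rkids w))) + 1"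
    by (subst subregexes_eq) simp
  with Cons show ?case by simp
qed simp

text \<open>Depth-first traversal with a worklist: the reversed output, followed by the expansions
  of all pending formulas, is always the final result.\<close>

lemma polytime_subregexes [polytime_intros]:
  assumes "polytime f" shows "polytime (\<lambda>x. subregexes (f x))"
proof -
  define step where "step s = (case fst s of [] \<Rightarrow> s | \<alpha> # \<alpha>s \<Rightarrow> (rkids \<alpha> @ \<alpha>s, \<alpha> # snd s))"
    for s :: "'b regex list \<times> 'b regex list"
  have "polytime (\<lambda>\<alpha> :: 'b regex. subregexes \<alpha>)"
  proof (rule polytime_while[where
      init = "\<lambda>\<alpha>. ([\<alpha>], [])" and b = "\<lambda>s. fst s \<noteq> []" and step = step and out = "\<lambda>s. rev (snd s)" and
      \<mu> = "\<lambda>s. length (concat (map subregexes (fst s)))" and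
      N = "\<lambda>\<alpha>. esize \<alpha>" and S = "\<lambda>\<alpha>. 2 * (esize \<alpha> * (esize \<alpha> + 1)) + 1" and
      I = "\<lambda>\<alpha> s. rev (snd s) @ concat (map subregexes (fst s)) = subregexes \<alpha>"])
    show "polytime step"
      unfolding step_def by (intro polytime_intros)
    fix \<alpha> :: "'b regex" and s :: "'b regex list \<times> 'b regex list"
    assume I: "rev (snd s) @ concat (map subregexes (fst s)) = subregexes \<alpha>"
    have "esize (snd s) + esize (concat (map subregexes (fst s))) = esize (subregexes \<alpha>)"
      using I by (metis esize_append esize_rev)
    with esize_worklist_le[of "fst s"] esize_subregexes_le[of \<alpha>]
    show "esize s \<le> 2 * (esize \<alpha> * (esize \<alpha> + 1)) + 1"
      by (simp add: esize_prod[of s])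
    show "\<not> fst s \<noteq> [] \<Longrightarrow> rev (snd s) = subregexes \<alpha>" using I by simp
    assume "fst s \<noteq> []"
    then obtain \<beta> \<beta>s out where s: "s = (\<beta> # \<beta>s, out)"
      by (cases s; cases "fst s") auto
    show "rev (snd (step s)) @ concat (map subregexes (fst (step s))) = subregexes \<alpha> \<and>
        length (concat (map subregexes (fst (step s)))) < length (concat (map subregexes (fst s)))"
      using I subregexes_eq[of \<beta>] by (auto simp: s step_def)
  qed (intro polytime_intros polybounded_intros | simp add: length_subregexes_le)+
  from polytime_comp[OF assms this] show ?thesis .
qed

section \<open>Table operations as polynomial-time functions\<close>

lemma polytime_apply3:
  assumes "polytime (\<lambda>p. F (fst p) (fst (snd p)) (snd (snd p)))" "polytime f" "polytime g" "polytime h"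
  shows "polytime (\<lambda>x. F (f x) (g x) (h x))"
  using polytime_comp[OF polytime_Pair[OF assms(2) polytime_Pair[OF assms(3,4)]] assms(1)] by simp

lemma polytime_apply4:
  assumes "polytime (\<lambda>p. F (fst p) (fst (snd p)) (fst (snd (snd p))) (snd (snd (snd p))))"
    "polytime f" "polytime g" "polytime h" "polytime k"
  shows "polytime (\<lambda>x. F (f x) (g x) (h x) (k x))"
  using polytime_comp[OF polytime_Pair[OF assms(2) polytime_Pair[OF assms(3) polytime_Pair[OF assms(4,5)]]] assms(1)]
  by simp

lemma polytime_span_name [polytime_intros]: "polytime f \<Longrightarrow> polytime (\<lambda>x. span_name (f x))"
  unfolding span_name_def by (intro polytime_intros)

lemma polytime_name_span [polytime_intros]: "polytime f \<Longrightarrow> polytime (\<lambda>x. name_span (f x))"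
  by (rule polytime_comp[where g = name_span], assumption) (unfold name_span_def, intro polytime_intros)

lemma polytime_join_rows [polytime_intros]:
  "polytime f \<Longrightarrow> polytime g \<Longrightarrow> polytime (\<lambda>x. join_rows (f x) (g x))"
  by (rule polytime_apply2[where F = join_rows]) (unfold join_rows_def merge_def, intro polytime_intros)

lemma polytime_eps_rows [polytime_intros]:
  "polytime f \<Longrightarrow> polytime g \<Longrightarrow> polytime (\<lambda>x. eps_rows (f x) (g x))"
  by (rule polytime_apply2[where F = eps_rows]) (unfold eps_rows_def, intro polytime_intros)

lemma polytime_lit_rows [polytime_intros]:
  "polytime f \<Longrightarrow> polytime g \<Longrightarrow> polytime h \<Longrightarrow> polytime (\<lambda>x. lit_rows (f x) (g x) (h x))"
  by (rule polytime_apply3[where F = lit_rows]) (unfold lit_rows_def, intro polytime_intros)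

lemma polytime_capt_rows [polytime_intros]:
  "polytime f \<Longrightarrow> polytime g \<Longrightarrow> polytime h \<Longrightarrow> polytime (\<lambda>x. capt_rows (f x) (g x) (h x))"
  by (rule polytime_apply3[where F = capt_rows]) (unfold capt_rows_def, intro polytime_intros)

lemma polytime_truncate [polytime_intros]:
  "polytime f \<Longrightarrow> polytime g \<Longrightarrow> polytime (\<lambda>x. truncate (f x) (g x))"
  unfolding truncate_def by (intro polytime_intros)

lemma esize_truncate_le: "esize (truncate B T) \<le> B"
  by (simp add: truncate_def)

text \<open>The last round truncates, so the table it extends may be arbitrary.\<close>

lemma esize_star_iter_le:
  "esize (foldl (\<lambda>A _. truncate B (E @ join_rows A T)) [] ys) \<le> B"
  by (cases ys rule: rev_cases) (simp_all add: esize_truncate_le)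

lemma polytime_star_rows [polytime_intros]:
  "polytime f \<Longrightarrow> polytime g \<Longrightarrow> polytime h \<Longrightarrow> polytime k \<Longrightarrow>
    polytime (\<lambda>x. star_rows (f x) (g x) (h x) (k x))"
proof (rule polytime_apply4[where F = star_rows])
  show "polytime (\<lambda>p :: name list \<times> 'b list \<times> nat \<times> row list.
      star_rows (fst p) (fst (snd p)) (fst (snd (snd p))) (snd (snd (snd p))))"
    unfolding star_rows_def
    by (rule polytime_foldl[where S = "\<lambda>p. esize (fst (snd (snd p)))"])
      (intro polytime_intros polytime_esize | simp add: esize_star_iter_le)+
qed

text \<open>A head with a definite default: the step of the stack machine has to be computable on
  every stack, also on one that is too short.\<close>

definition hd_or_Nil :: "'a list list \<Rightarrow> 'a list" where
  "hd_or_Nil st = (case st of [] \<Rightarrow> [] | T # _ \<Rightarrow> T)"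

text \<open>One step of a stack machine. Reversed preorder treats the right operand before the left
  one, so the table of the left operand is on top.\<close>

definition table_step :: "name list \<Rightarrow> nat list \<Rightarrow> nat \<Rightarrow> row list list \<Rightarrow> nat regex \<Rightarrow> row list list" where
  "table_step xs s B st \<alpha> =
    (if rtag \<alpha> = 0 then [] # st
     else if rtag \<alpha> = 1 then truncate B (eps_rows xs s) # st
     else if rtag \<alpha> = 2 then truncate B (lit_rows xs s (rletter \<alpha>)) # st
     else if rtag \<alpha> = 3 then truncate B (hd_or_Nil st @ hd_or_Nil (tl st)) # tl (tl st)
     else if rtag \<alpha> = 4 then truncate B (join_rows (hd_or_Nil st) (hd_or_Nil (tl st))) # tl (tl st)
     else if rtag \<alpha> = 5 then star_rows xs s B (hd_or_Nil st) # tl st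
     else truncate B (capt_rows xs (rname \<alpha>) (hd_or_Nil st)) # tl st)"

lemma foldl_table_step:
  "foldl (table_step xs s B) st (rev (subregexes \<alpha>)) = table xs s B \<alpha> # st"
  by (induction \<alpha> arbitrary: st) (simp_all add: table_step_def hd_or_Nil_def)

lemma esize_tl_le: "esize (tl xs) \<le> esize xs"
  by (cases xs) auto

text \<open>Each step pushes a single table of size at most \<open>B\<close>, so the stack grows
  linearly in the number of steps whatever the input.\<close>

lemma esize_table_step_le: "esize (table_step xs s B st \<alpha>) \<le> esize st + B + 1"
proof -
  have "esize (tl (tl st)) \<le> esize st" "esize (tl st) \<le> esize st"
    using esize_tl_le order.trans by blast+
  moreover have "esize (star_rows xs s B T) \<le> B" for T
    unfolding star_rows_def by (rule esize_star_iter_le)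
  ultimately show ?thesis
    unfolding table_step_def using esize_truncate_le[of B]
    by (simp add: add_mono add.commute[of "esize st"])
qed

lemma esize_foldl_table_step_le:
  "esize (foldl (table_step xs s B) [] ys) \<le> length ys * (B + 1)"
proof (induction ys rule: rev_induct)
  case (snoc y ys)
  then show ?case
    using esize_table_step_le[of xs s B "foldl (table_step xs s B) [] ys" y] by simp
qed simp

lemma polytime_hd_or_Nil [polytime_intros]: "polytime f \<Longrightarrow> polytime (\<lambda>x. hd_or_Nil (f x))"
  unfolding hd_or_Nil_def by (intro polytime_intros)

lemma polytime_table [polytime_intros]:
  assumes "polytime f" "polytime g" "polytime h" "polytime k"
  shows "polytime (\<lambda>x. table (f x) (g x) (h x) (k x :: nat regex))"
proof -
  have "polytime (\<lambda>p :: name list \<times> nat list \<times> nat \<times> nat regex.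
      hd_or_Nil (foldl (table_step (fst p) (fst (snd p)) (fst (snd (snd p)))) [] (rev (subregexes (snd (snd (snd p)))))))"
  proof (intro polytime_intros, rule polytime_foldl[where
        S = "\<lambda>p. length (rev (subregexes (snd (snd (snd p))))) * (esize (fst (snd (snd p))) + 1)"])
    show "polytime (\<lambda>p :: (name list \<times> nat list \<times> nat \<times> nat regex) \<times> row list list \<times> nat regex.
       table_step (fst (fst p)) (fst (snd (fst p))) (fst (snd (snd (fst p)))) (fst (snd p)) (snd (snd p)))"
      unfolding table_step_def by (intro polytime_intros)
    show "polybounded (\<lambda>p :: name list \<times> nat list \<times> nat \<times> nat regex.
        length (rev (subregexes (snd (snd (snd p))))) * (esize (fst (snd (snd p))) + 1))"
      by (intro polybounded_intros polytime_intros polytime_length polytime_esize)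
    fix p :: "name list \<times> nat list \<times> nat \<times> nat regex" and ys zs :: "nat regex list"
    assume l: "rev (subregexes (snd (snd (snd p)))) = ys @ zs"
    have "esize (foldl (table_step (fst p) (fst (snd p)) (fst (snd (snd p)))) [] ys) \<le>
        length ys * (fst (snd (snd p)) + 1)"
      by (rule esize_foldl_table_step_le)
    also have "\<dots> \<le> length (rev (subregexes (snd (snd (snd p))))) * (esize (fst (snd (snd p))) + 1)"
      unfolding l esize_nat by (intro mult_le_mono1) simp
    finally show "esize (foldl (table_step (fst p) (fst (snd p)) (fst (snd (snd p)))) [] ys) \<le>
        length (rev (subregexes (snd (snd (snd p))))) * (esize (fst (snd (snd p))) + 1)" .
  qed (intro polytime_intros)+
  then have "polytime (\<lambda>p :: name list \<times> nat list \<times> nat \<times> nat regex.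
      table (fst p) (fst (snd p)) (fst (snd (snd p))) (snd (snd (snd p))))"
    by (simp add: foldl_table_step) (simp add: hd_or_Nil_def)
  from polytime_apply4[OF this assms] show ?thesis .
qed

section \<open>Translation to a relational query and a database\<close>

text \<open>A variable captured in several alternatives is listed several times. Relational atoms
  may repeat arguments, and the rows repeat the column accordingly.\<close>

definition var_list :: "'a regex \<Rightarrow> name list" where
  "var_list \<alpha> = map rname (filter (\<lambda>\<beta>. rtag \<beta> = 6) (subregexes \<alpha>))"

lemma set_var_list: "set (var_list \<alpha>) = vars \<alpha>"
  unfolding var_list_def by (induction \<alpha>) auto

text \<open>Computable counterpart of \<open>row_bound\<close>, with the size of the formula
  measured on its generic code.\<close>

definition table_bound :: "nat \<Rightarrow> nat \<Rightarrow> name list \<Rightarrow> 'a list \<Rightarrow> 'b::encodable regex \<Rightarrow> nat" where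
  "table_bound C d xs s \<alpha> = ((length s + 1) * (length s + 1) * (C * (length s + esize \<alpha> + 1) ^ d)) *
     (2 * length s + 4 + length xs * (2 * length s + 5) + 1)"

definition formula_rows :: "nat \<Rightarrow> nat \<Rightarrow> nat list \<Rightarrow> nat regex \<Rightarrow> name list list" where
  "formula_rows C d s \<alpha> = remdups (map snd (filter (\<lambda>z. fst z = (1, length s + 1))
     (table (var_list \<alpha>) s (table_bound C d (var_list \<alpha>) s \<alpha>) \<alpha>)))"

definition span_list :: "'a list \<Rightarrow> span list" where
  "span_list s = concat (map (\<lambda>i. map (\<lambda>j. (i, j)) [i..<length s + 2]) [1..<length s + 2])"

definition equality_rows :: "nat list \<Rightarrow> name list list" where
  "equality_rows s = remdups (concat (map (\<lambda>p. map (\<lambda>q. [span_name p, span_name q])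
     (filter (\<lambda>q. substring s p = substring s q) (span_list s))) (span_list s)))"

type_synonym cq_code = "name list \<times> (name \<times> name) list \<times> nat regex list"

definition atom_data :: "nat \<Rightarrow> nat \<Rightarrow> nat list \<Rightarrow> cq_code \<Rightarrow> (name list \<times> name list list) list" where
  "atom_data C d s q = map (\<lambda>\<alpha>. (var_list \<alpha>, formula_rows C d s \<alpha>)) (snd (snd q)) @
     map (\<lambda>e. ([fst e, snd e], equality_rows s)) (fst (snd q))"

text \<open>A symbol encodes the index of the disjunct and that of the atom, so no symbol occurs
  twice in the whole union. Query and database are both derived from this list and thus agree on the
  symbols.\<close>

definition named_atoms ::
  "nat \<Rightarrow> nat \<Rightarrow> nat list \<Rightarrow> nat \<times> cq_code \<Rightarrow> (name \<times> name list \<times> name list list) list" where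
  "named_atoms C d s p = map (\<lambda>a. (span_name (fst p, fst a), snd a)) (enumerate 0 (atom_data C d s (snd p)))"

definition query_code :: "nat \<Rightarrow> nat \<Rightarrow> nat list \<Rightarrow> cq_code list \<Rightarrow> (name list \<times> (name \<times> name list) list) list" where
  "query_code C d s u = map (\<lambda>p. (fst (snd p), map (\<lambda>a. (fst a, fst (snd a))) (named_atoms C d s p)))
     (enumerate 0 u)"

definition database_code :: "nat \<Rightarrow> nat \<Rightarrow> nat list \<Rightarrow> cq_code list \<Rightarrow> db" where
  "database_code C d s u = concat (map (\<lambda>p. map (\<lambda>a. (fst a, snd (snd a))) (named_atoms C d s p))
     (enumerate 0 u))"

lemma polytime_var_list [polytime_intros]: "polytime f \<Longrightarrow> polytime (\<lambda>x. var_list (f x))"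
  unfolding var_list_def by (intro polytime_intros)

lemma polytime_table_bound [polytime_intros]:
  "polytime f \<Longrightarrow> polytime g \<Longrightarrow> polytime h \<Longrightarrow> polytime (\<lambda>x. table_bound C d (f x) (g x) (h x))"
  unfolding table_bound_def by (intro polytime_intros)

lemma polytime_formula_rows [polytime_intros]:
  "polytime f \<Longrightarrow> polytime g \<Longrightarrow> polytime (\<lambda>x. formula_rows C d (f x) (g x))"
  by (rule polytime_apply2[where F = "formula_rows C d"])
    (unfold formula_rows_def, intro polytime_intros)

lemma polytime_substring [polytime_intros]:
  "polytime f \<Longrightarrow> polytime g \<Longrightarrow> polytime (\<lambda>x. substring (f x) (g x))"
  unfolding substring_def by (intro polytime_intros)

lemma polytime_span_list [polytime_intros]: "polytime f \<Longrightarrow> polytime (\<lambda>x. span_list (f x))"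
  by (rule polytime_comp[where g = span_list], assumption) (unfold span_list_def, intro polytime_intros)

lemma polytime_equality_rows [polytime_intros]: "polytime f \<Longrightarrow> polytime (\<lambda>x. equality_rows (f x))"
  by (rule polytime_comp[where g = equality_rows], assumption) (unfold equality_rows_def, intro polytime_intros)

lemma polytime_named_atoms [polytime_intros]:
  "polytime f \<Longrightarrow> polytime g \<Longrightarrow> polytime (\<lambda>x. named_atoms C d (f x) (g x))"
  by (rule polytime_apply2[where F = "named_atoms C d"])
    (unfold named_atoms_def atom_data_def, intro polytime_intros)

lemma polytime_query_code [polytime_intros]:
  "polytime f \<Longrightarrow> polytime g \<Longrightarrow> polytime (\<lambda>x. query_code C d (f x) (g x))"
  by (rule polytime_apply2[where F = "query_code C d"])
    (unfold query_code_def, intro polytime_intros)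

lemma polytime_database_code [polytime_intros]:
  "polytime f \<Longrightarrow> polytime g \<Longrightarrow> polytime (\<lambda>x. database_code C d (f x) (g x))"
  by (rule polytime_apply2[where F = "database_code C d"])
    (unfold database_code_def, intro polytime_intros)

section \<open>Agreement with the prescribed encodings\<close>

lemma enc_list_map: "enc_list f (map g xs) = enc_list (\<lambda>x. f (g x)) xs"
  by (induction xs) auto

definition cq_code :: "'a::finite regex_cq \<Rightarrow> cq_code" where
  "cq_code q = (out_vars q, equalities q, map (map_regex to_nat) (formulas q))"

abbreviation string_code :: "'a::finite list \<Rightarrow> nat list" where
  "string_code \<equiv> map to_nat"

text \<open>The prescribed code of the input is literally a generic code, so the calculus applies to
  the input as it stands.\<close>

lemma enc_input:
  fixes u :: "'a::finite regex_ucq" and s :: "'a list"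
  shows "enc (map cq_code u, string_code s) = enc_pair (enc_list enc_regex_cq) (enc_list enc_letter) (u, s)"
proof -
  have "enc (cq_code q) = enc_regex_cq q" for q :: "'a regex_cq"
    unfolding cq_code_def enc_regex_cq_def enc_Pair
    by (simp add: enc_list_inst enc_list_map enc_map_regex enc_name_eq enc_prod_inst)
  moreover have "(\<lambda>a :: 'a. enc (to_nat a)) = enc_letter"
    by (simp add: fun_eq_iff enc_letter_def enc_nat_inst)
  ultimately show ?thesis
    by (simp add: enc_pair_def enc_list_inst enc_list_map)
qed

definition to_rel_cq :: "name list \<times> (name \<times> name list) list \<Rightarrow> rel_cq" where
  "to_rel_cq p = RelCQ (fst p) (snd p)"

lemma enc_rel_query: "enc_pair (enc_list enc_rel_cq) enc_db (map to_rel_cq U, D) = enc (U, D)"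
proof -
  have "enc_list (enc_pair enc_name (enc_list enc_name)) = enc"
    by (simp add: enc_list_inst enc_prod_inst enc_name_eq)
  then have "enc_rel_cq (to_rel_cq p) = enc p" for p
    by (simp add: enc_rel_cq_def to_rel_cq_def enc_prod_inst[where 'a = "name list"] enc_pair_def)
      (simp add: enc_list_inst enc_name_eq)
  moreover have "enc_db = enc"
    by (simp add: enc_db_def enc_list_inst enc_prod_inst enc_name_eq)
  ultimately show ?thesis
    by (simp add: enc_pair_def enc_list_map) (simp add: enc_list_inst)
qed

lemma bounded_formulaI:
  assumes "\<forall>\<alpha>\<in>\<A>. \<forall>s. card (regex_eval \<alpha> s) \<le> C * (length s + 1) ^ d" "\<alpha> \<in> \<A>" "functional \<alpha>"
  shows "bounded_formula \<alpha> C d"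
  using assms by unfold_locales auto

lemma set_formula_rows:
  fixes \<alpha> :: "'a::finite regex"
  assumes "bounded_formula \<alpha> C d"
  defines "\<alpha>' \<equiv> map_regex to_nat \<alpha>"
  shows "set (formula_rows C d (string_code s) \<alpha>') =
    (\<lambda>\<mu>. map (\<lambda>x. entry (\<mu> x)) (var_list \<alpha>')) ` regex_eval \<alpha> s"
proof -
  interpret bounded_formula \<alpha> C d by fact
  let ?B = "table_bound C d (var_list \<alpha>') (string_code s) \<alpha>'"
  \<comment> \<open>The generic code of the renamed formula is \<open>enc_regex \<alpha>\<close> and
    the string keeps its length, so the two bounds coincide.\<close>
  have "row_bound (var_list \<alpha>') s \<le> ?B"
    by (simp add: row_bound_def table_bound_def esize_def \<alpha>'_def enc_map_regex)
  note root = table_root[OF this]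
  have "table (var_list \<alpha>') (string_code s) ?B \<alpha>' = table (var_list \<alpha>') s ?B \<alpha>"
    unfolding \<alpha>'_def by (rule table_map[OF inj_to_nat])
  then have "set (formula_rows C d (string_code s) \<alpha>') =
      {snd z | z. z \<in> set (table (var_list \<alpha>') s ?B \<alpha>) \<and> fst z = (1, length s + 1)}"
    unfolding formula_rows_def set_remdups set_map set_filter length_map by (simp only:) blast
  with root show ?thesis by simp
qed

lemma set_span_list: "set (span_list s) = spans s"
proof (rule set_eqI)
  fix p :: span
  have "p \<in> set (span_list s) \<longleftrightarrow>
      (\<exists>i\<in>{1..<length s + 2}. \<exists>j\<in>{i..<length s + 2}. p = (i, j))"
    unfolding span_list_def set_concat set_map set_upt image_image by blast
  also have "\<dots> \<longleftrightarrow> p \<in> spans s"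
    unfolding Bex_def atLeastLessThan_iff spans_def by auto
  finally show "p \<in> set (span_list s) \<longleftrightarrow> p \<in> spans s" .
qed

lemma substring_map: "substring (map f s) p = map f (substring s p)"
  by (simp add: substring_def take_map drop_map)

lemma set_equality_rows:
  fixes s :: "'a::finite list"
  shows "set (equality_rows (string_code s)) =
    {[span_name p, span_name q] | p q. p \<in> spans s \<and> q \<in> spans s \<and> substring s p = substring s q}"
proof -
  have "spans (string_code s) = spans s" by (simp add: spans_def)
  then show ?thesis
    by (auto simp: equality_rows_def set_span_list substring_map inj_map_eq_map)
qed

lemma enumerate_map_eq: "enumerate n (map f xs) = map (\<lambda>p. (fst p, f (snd p))) (enumerate n xs)"
  by (induction xs arbitrary: n) auto

lemma enumerate_eq_map_nth: "enumerate 0 xs = map (\<lambda>i. (i, xs ! i)) [0..<length xs]"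
  by (rule nth_equalityI) (auto simp: nth_enumerate_eq)

lemma atoms_match_sym: "atoms_match As Bs \<Longrightarrow> atoms_match Bs As"
proof -
  assume "atoms_match As Bs"
  then obtain f where f: "bij_betw f {..<length As} {..<length Bs}" "\<forall>i<length As. Bs ! f i = As ! i"
    by (auto simp: atoms_match_def)
  let ?g = "the_inv_into {..<length As} f"
  have g: "bij_betw ?g {..<length Bs} {..<length As}" using f(1) by (rule bij_betw_the_inv_into)
  have "As ! ?g i = Bs ! i" if "i < length Bs" for i
  proof -
    have "?g i < length As" using g that by (auto simp: bij_betw_def)
    moreover have "f (?g i) = i" using f(1) that by (intro f_the_inv_into_f) (auto simp: bij_betw_def)
    ultimately show ?thesis using f(2) by metis
  qed
  with g show ?thesis by (auto simp: atoms_match_def)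
qed

definition name_tuple :: "(name \<rightharpoonup> span) \<Rightarrow> (name \<rightharpoonup> name)" where
  "name_tuple \<mu> = map_option span_name \<circ> \<mu>"

lemma name_tuple_restrict: "name_tuple \<mu> |` V = name_tuple (\<mu> |` V)"
  by (auto simp: name_tuple_def restrict_map_def)

lemma dom_name_tuple: "dom (name_tuple \<mu>) = dom \<mu>"
  by (auto simp: name_tuple_def)

lemma inj_name_tuple: "inj name_tuple"
proof (rule injI)
  fix \<mu> \<mu>' assume "name_tuple \<mu> = name_tuple \<mu>'"
  then have "map_option span_name (\<mu> x) = map_option span_name (\<mu>' x)" for x
    unfolding name_tuple_def by (metis comp_apply)
  then show "\<mu> = \<mu>'"
    by (intro ext) (metis option.inj_map_strong span_name_eq_iff)
qed

section \<open>Correctness of the translation\<close>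

locale query_translation =
  fixes u :: "'a::finite regex_ucq" and s :: "'a list" and C d :: nat
  assumes wf: "wf_regex_ucq u"
    and bounded: "\<And>q \<alpha>. q \<in> set u \<Longrightarrow> \<alpha> \<in> set (formulas q) \<Longrightarrow> bounded_formula \<alpha> C d"
begin

definition atoms :: "'a regex_cq \<Rightarrow> (name list \<times> name list list) list" where
  "atoms q = atom_data C d (string_code s) (cq_code q)"

definition rel_query :: rel_ucq where
  "rel_query = map to_rel_cq (query_code C d (string_code s) (map cq_code u))"

definition rel_db :: db where
  "rel_db = database_code C d (string_code s) (map cq_code u)"

definition disjunct :: "nat \<Rightarrow> rel_cq" where
  "disjunct i = RelCQ (out_vars (u ! i))
     (map (\<lambda>a. (span_name (i, fst a), fst (snd a))) (enumerate 0 (atoms (u ! i))))"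

lemma atoms_eq:
  "atoms q = map (\<lambda>\<alpha>. (var_list (map_regex to_nat \<alpha>), formula_rows C d (string_code s) (map_regex to_nat \<alpha>))) (formulas q) @
     map (\<lambda>e. ([fst e, snd e], equality_rows (string_code s))) (equalities q)"
  by (simp add: atoms_def atom_data_def cq_code_def)

lemma rel_query_eq: "rel_query = map disjunct [0..<length u]"
  unfolding rel_query_def query_code_def enumerate_map_eq enumerate_eq_map_nth
  by (simp add: comp_def to_rel_cq_def disjunct_def named_atoms_def atoms_def cq_code_def enumerate_eq_map_nth)

lemma rel_db_eq:
  "rel_db = concat (map (\<lambda>i. map (\<lambda>j. (span_name (i, j), snd (atoms (u ! i) ! j))) [0..<length (atoms (u ! i))])
     [0..<length u])"
  unfolding rel_db_def database_code_def enumerate_map_eq enumerate_eq_map_nth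
  by (simp add: comp_def named_atoms_def atoms_def enumerate_eq_map_nth)

lemma set_body: "set (body (disjunct i)) =
    {(span_name (i, j), fst (atoms (u ! i) ! j)) | j. j < length (atoms (u ! i))}"
  by (auto simp: disjunct_def enumerate_eq_map_nth)

lemma wf_cq: "i < length u \<Longrightarrow> wf_regex_cq (u ! i)"
  using wf by (auto simp: wf_regex_ucq_def)

lemma rel_cq_atoms_disjunct: "rel_cq_atoms (disjunct i) = regex_cq_atoms (u ! i)"
proof -
  have "rel_cq_atoms (disjunct i) = map (\<lambda>a. set (fst a)) (map snd (enumerate 0 (atoms (u ! i))))"
    unfolding rel_cq_atoms_def disjunct_def by (auto simp del: map_snd_enumerate)
  also have "\<dots> = map (\<lambda>a. set (fst a)) (atoms (u ! i))" by simp
  also have "\<dots> = regex_cq_atoms (u ! i)"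
    by (auto simp: atoms_eq regex_cq_atoms_def set_var_list)
  finally show ?thesis .
qed

lemma body_vars_disjunct: "i < length u \<Longrightarrow> body_vars (disjunct i) = all_vars (u ! i)"
proof -
  assume i: "i < length u"
  have "body_vars (disjunct i) = \<Union> (set (rel_cq_atoms (disjunct i)))"
    by (auto simp: body_vars_def rel_cq_atoms_def)
  also have "\<dots> = all_vars (u ! i)"
    using wf_cq[OF i] unfolding rel_cq_atoms_disjunct
    by (fastforce simp: regex_cq_atoms_def all_vars_def wf_regex_cq_def)
  finally show ?thesis .
qed

lemma self_join_free_disjunct: "self_join_free (disjunct i)"
  by (auto simp: self_join_free_def disjunct_def enumerate_eq_map_nth comp_def distinct_map inj_on_def)

lemma rel_atoms_rel_query: "rel_atoms rel_query =
    {(span_name (i, j), fst (atoms (u ! i) ! j)) | i j. i < length u \<and> j < length (atoms (u ! i))}"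
  unfolding rel_atoms_def rel_query_eq using set_body by fastforce

lemma wf_rel_query: "wf_rel_ucq rel_query"
  unfolding wf_rel_ucq_def
proof (intro conjI ballI)
  show "rel_query \<noteq> []" using wf by (simp add: rel_query_eq wf_regex_ucq_def)
next
  fix Q assume "Q \<in> set rel_query"
  then obtain i where i: "i < length u" "Q = disjunct i" by (auto simp: rel_query_eq)
  have "atoms (u ! i) \<noteq> []" using wf_cq[OF i(1)] by (simp add: atoms_eq wf_regex_cq_def)
  then have "body Q \<noteq> []" by (simp add: i disjunct_def enumerate_eq_map_nth)
  then show "wf_rel_cq Q"
    using wf_cq[OF i(1)] body_vars_disjunct[OF i(1)] i
    by (auto simp: wf_rel_cq_def wf_regex_cq_def disjunct_def)
next
  fix Q Q' assume "Q \<in> set rel_query" "Q' \<in> set rel_query"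
  then obtain i j where "i < length u" "Q = disjunct i" "j < length u" "Q' = disjunct j"
    by (auto simp: rel_query_eq)
  then show "set (head Q) = set (head Q')"
    using wf by (simp add: disjunct_def wf_regex_ucq_def)
next
  \<comment> \<open>Equal symbols come from the same disjunct and the same atom, so arities cannot
    clash.\<close>
  fix a assume "a \<in> rel_atoms rel_query"
  then show "case a of (R, xs) \<Rightarrow> \<forall>(R', xs')\<in>rel_atoms rel_query. R = R' \<longrightarrow> length xs = length xs'"
    unfolding rel_atoms_rel_query by auto
qed

text \<open>The canonical query has the same variable sets of atoms as the regex query, in the same
  order, so the matching supplied by the mapping only has to be inverted.\<close>

lemma same_presentation_rel_query:
  assumes "ucq_maps_to u U" shows "list_all2 same_cq_up_to_presentation U rel_query"
proof (rule list_all2_all_nthI)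
  have l: "list_all2 cq_maps_to u U" using assms by (simp add: ucq_maps_to_def)
  show "length U = length rel_query" using list_all2_lengthD[OF l] by (simp add: rel_query_eq)
  fix i assume "i < length U"
  then have i: "i < length u" using list_all2_lengthD[OF l] by simp
  have "cq_maps_to (u ! i) (U ! i)" using l i by (rule list_all2_nthD)
  then show "same_cq_up_to_presentation (U ! i) (rel_query ! i)"
    using i self_join_free_disjunct[of i] atoms_match_sym
    by (auto simp: same_cq_up_to_presentation_def cq_maps_to_def rel_query_eq rel_cq_atoms_disjunct)
      (simp_all add: disjunct_def)
qed

lemma set_rel_db: "set rel_db =
    {(span_name (i, j), snd (atoms (u ! i) ! j)) | i j. i < length u \<and> j < length (atoms (u ! i))}"
  unfolding rel_db_eq by fastforce

lemma db_rel_eq: "i < length u \<Longrightarrow> j < length (atoms (u ! i)) \<Longrightarrow>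
    db_rel rel_db (span_name (i, j)) = set (snd (atoms (u ! i) ! j))"
  unfolding db_rel_def set_rel_db by (auto split: if_splits)

lemma atom_cases:
  assumes "i < length u" "j < length (atoms (u ! i))"
  obtains \<alpha> where "\<alpha> \<in> set (formulas (u ! i))" "bounded_formula \<alpha> C d"
      "atoms (u ! i) ! j = (var_list (map_regex to_nat \<alpha>), formula_rows C d (string_code s) (map_regex to_nat \<alpha>))"
  | e where "e \<in> set (equalities (u ! i))"
      "atoms (u ! i) ! j = ([fst e, snd e], equality_rows (string_code s))"
proof -
  have "atoms (u ! i) ! j \<in> set (atoms (u ! i))" using assms by simp
  then consider \<alpha> where "\<alpha> \<in> set (formulas (u ! i))"
      "atoms (u ! i) ! j = (var_list (map_regex to_nat \<alpha>), formula_rows C d (string_code s) (map_regex to_nat \<alpha>))"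
    | e where "e \<in> set (equalities (u ! i))"
      "atoms (u ! i) ! j = ([fst e, snd e], equality_rows (string_code s))"
    unfolding atoms_eq by auto
  then show thesis
    using that bounded[of "u ! i"] assms by cases auto
qed

lemma db_for_rel_query: "db_for rel_query rel_db"
  unfolding db_for_def
proof (intro conjI ballI)
  have "distinct (concat (map (\<lambda>i. map (\<lambda>j. span_name (i, j)) [0..<f i]) [0..<n]))" for n and f :: "nat \<Rightarrow> nat"
    by (induction n) (auto simp: distinct_map inj_on_def)
  then show "distinct (map fst rel_db)"
    unfolding rel_db_eq map_concat by (simp add: comp_def)
  show "set (map fst rel_db) = fst ` rel_atoms rel_query"
    unfolding set_map set_rel_db rel_atoms_rel_query by force
next
  fix a assume "a \<in> set rel_db"
  then obtain i j where a: "i < length u" "j < length (atoms (u ! i))" "a = (span_name (i, j), snd (atoms (u ! i) ! j))"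
    by (auto simp: set_rel_db)
  from a(1,2) show "case a of (R, ts) \<Rightarrow> distinct ts"
    by (cases rule: atom_cases) (simp_all add: a(3) formula_rows_def equality_rows_def)
next
  fix a assume "a \<in> rel_atoms rel_query"
  then obtain i j where a: "i < length u" "j < length (atoms (u ! i))" "a = (span_name (i, j), fst (atoms (u ! i) ! j))"
    by (auto simp: rel_atoms_rel_query)
  have "\<forall>t\<in>set (snd (atoms (u ! i) ! j)). length t = length (fst (atoms (u ! i) ! j))"
    using a(1,2) by (cases rule: atom_cases) (auto simp: set_formula_rows set_equality_rows)
  then show "case a of (R, xs) \<Rightarrow> \<forall>t\<in>db_rel rel_db R. length t = length xs"
    by (simp add: a(3) db_rel_eq[OF a(1,2)])
qed

text \<open>A row determines its tuple: tuples of \<open>\<alpha>\<close> are defined on all of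
  \<open>vars \<alpha>\<close>, so each entry is a proper span name, and the naming is
  injective.\<close>

lemma formula_atom_iff:
  assumes \<alpha>: "bounded_formula \<alpha> C d" and dom: "vars \<alpha> \<subseteq> dom \<mu>"
  shows "map (the \<circ> name_tuple \<mu>) (var_list (map_regex to_nat \<alpha>)) \<in>
      set (formula_rows C d (string_code s) (map_regex to_nat \<alpha>)) \<longleftrightarrow> \<mu> |` vars \<alpha> \<in> regex_eval \<alpha> s"
proof -
  let ?xs = "var_list (map_regex to_nat \<alpha>)"
  have xs: "set ?xs = vars \<alpha>" by (simp add: set_var_list)
  have f: "functional \<alpha>" using \<alpha> by (rule bounded_formula.functional)
  have eq: "map (the \<circ> name_tuple \<mu>) ?xs = map (\<lambda>x. entry (\<mu>' x)) ?xs \<longleftrightarrow> \<mu> |` vars \<alpha> = \<mu>'"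
    if "\<mu>' \<in> regex_eval \<alpha> s" for \<mu>'
  proof -
    have d: "dom \<mu>' = vars \<alpha>" using regex_eval_spans[OF f that] by simp
    have "map (the \<circ> name_tuple \<mu>) ?xs = map (\<lambda>x. entry (\<mu>' x)) ?xs \<longleftrightarrow>
        (\<forall>x\<in>vars \<alpha>. the (name_tuple \<mu> x) = entry (\<mu>' x))"
      by (simp add: xs)
    also have "\<dots> \<longleftrightarrow> (\<forall>x\<in>vars \<alpha>. \<mu> x = \<mu>' x)"
    proof (intro ball_cong refl)
      fix x assume x: "x \<in> vars \<alpha>"
      then obtain p q where "\<mu> x = Some p" "\<mu>' x = Some q" using d dom by blast
      then show "the (name_tuple \<mu> x) = entry (\<mu>' x) \<longleftrightarrow> \<mu> x = \<mu>' x"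
        by (simp add: name_tuple_def)
    qed
    also have "\<dots> \<longleftrightarrow> \<mu> |` vars \<alpha> = \<mu>'"
    proof
      assume eq: "\<forall>x\<in>vars \<alpha>. \<mu> x = \<mu>' x"
      show "\<mu> |` vars \<alpha> = \<mu>'"
      proof
        fix x show "(\<mu> |` vars \<alpha>) x = \<mu>' x"
        proof (cases "x \<in> vars \<alpha>")
          case False
          then have "\<mu>' x = None" using d by blast
          with False show ?thesis by simp
        qed (use eq in simp)
      qed
    qed (auto simp: restrict_map_def)
    finally show ?thesis .
  qed
  then show ?thesis
    unfolding set_formula_rows[OF \<alpha>] by (auto simp: image_iff)
qed

text \<open>Valuations by spans and by names correspond under \<open>name_tuple\<close> as soon as
  relational valuations take only span names as values. They do, because every variable occurs in
  some formula and the rows of a formula consist of such names.\<close>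

lemma rel_cq_eval_disjunct:
  assumes i: "i < length u"
  shows "rel_cq_eval (disjunct i) rel_db = name_tuple ` regex_cq_eval (u ! i) s"
proof -
  let ?q = "u ! i"
  have funct: "functional \<alpha>" if "\<alpha> \<in> set (formulas ?q)" for \<alpha>
    using that wf_cq[OF i] by (simp add: wf_regex_cq_def)
  have wfe: "fst e \<in> all_vars ?q \<and> snd e \<in> all_vars ?q" if "e \<in> set (equalities ?q)" for e
    using that wf_cq[OF i] by (auto simp: wf_regex_cq_def)
  define bodyok where "bodyok \<nu> \<longleftrightarrow>
    (\<forall>\<alpha>\<in>set (formulas ?q). map (the \<circ> \<nu>) (var_list (map_regex to_nat \<alpha>)) \<in>
      set (formula_rows C d (string_code s) (map_regex to_nat \<alpha>))) \<and>
    (\<forall>e\<in>set (equalities ?q). [the (\<nu> (fst e)), the (\<nu> (snd e))] \<in> set (equality_rows (string_code s)))"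
    for \<nu> :: "name \<rightharpoonup> name"
  have body: "(\<forall>(R, xs)\<in>set (body (disjunct i)). map (the \<circ> \<nu>) xs \<in> db_rel rel_db R) \<longleftrightarrow> bodyok \<nu>" for \<nu>
  proof -
    have "(\<forall>(R, xs)\<in>set (body (disjunct i)). map (the \<circ> \<nu>) xs \<in> db_rel rel_db R) \<longleftrightarrow>
        (\<forall>j<length (atoms ?q). map (the \<circ> \<nu>) (fst (atoms ?q ! j)) \<in> set (snd (atoms ?q ! j)))"
    proof -
      have "(\<forall>(R, xs)\<in>set (body (disjunct i)). map (the \<circ> \<nu>) xs \<in> db_rel rel_db R) \<longleftrightarrow>
          (\<forall>j<length (atoms ?q). map (the \<circ> \<nu>) (fst (atoms ?q ! j)) \<in> db_rel rel_db (span_name (i, j)))"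
        unfolding set_body by blast
      then show ?thesis using db_rel_eq[OF i] by simp
    qed
    also have "\<dots> \<longleftrightarrow> (\<forall>a\<in>set (atoms ?q). map (the \<circ> \<nu>) (fst a) \<in> set (snd a))"
      by (simp add: all_set_conv_all_nth)
    also have "\<dots> \<longleftrightarrow> bodyok \<nu>"
      unfolding atoms_eq bodyok_def by (simp add: ball_Un comp_def)
    finally show ?thesis .
  qed
  define good where "good \<mu> \<longleftrightarrow> dom \<mu> = all_vars ?q \<and> ran \<mu> \<subseteq> spans s \<and>
        (\<forall>\<alpha>\<in>set (formulas ?q). \<mu> |` vars \<alpha> \<in> regex_eval \<alpha> s) \<and>
        (\<forall>(x, y)\<in>set (equalities ?q). substring s (the (\<mu> x)) = substring s (the (\<mu> y)))"
    for \<mu> :: "name \<rightharpoonup> span"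
  have iff: "bodyok (name_tuple \<mu>) \<and> dom \<mu> = all_vars ?q \<longleftrightarrow> good \<mu>" for \<mu>
  proof (cases "dom \<mu> = all_vars ?q")
    case dom: True
    have f: "(\<forall>\<alpha>\<in>set (formulas ?q). map (the \<circ> name_tuple \<mu>) (var_list (map_regex to_nat \<alpha>)) \<in>
        set (formula_rows C d (string_code s) (map_regex to_nat \<alpha>))) \<longleftrightarrow>
      (\<forall>\<alpha>\<in>set (formulas ?q). \<mu> |` vars \<alpha> \<in> regex_eval \<alpha> s)"
    proof (intro ball_cong refl)
      fix \<alpha> assume a: "\<alpha> \<in> set (formulas ?q)"
      then have "bounded_formula \<alpha> C d" using bounded i by (meson nth_mem)
      moreover have "vars \<alpha> \<subseteq> dom \<mu>" using a dom by (auto simp: all_vars_def)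
      ultimately show "map (the \<circ> name_tuple \<mu>) (var_list (map_regex to_nat \<alpha>)) \<in>
        set (formula_rows C d (string_code s) (map_regex to_nat \<alpha>)) \<longleftrightarrow> \<mu> |` vars \<alpha> \<in> regex_eval \<alpha> s"
        by (rule formula_atom_iff)
    qed
    \<comment> \<open>The formulas cover all variables, so their atoms imply the range condition. It
      is used in turn for the equality atoms, whose relation contains only spans of
      \<open>s\<close>.\<close>
    have ran: "ran \<mu> \<subseteq> spans s" if *: "\<forall>\<alpha>\<in>set (formulas ?q). \<mu> |` vars \<alpha> \<in> regex_eval \<alpha> s"
    proof
      fix p assume "p \<in> ran \<mu>"
      then obtain x where x: "\<mu> x = Some p" by (auto simp: ran_def)
      then obtain \<alpha> where a: "\<alpha> \<in> set (formulas ?q)" "x \<in> vars \<alpha>"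
        using dom by (auto simp: all_vars_def)
      have "ran (\<mu> |` vars \<alpha>) \<subseteq> spans s" using regex_eval_spans(2) funct * a by blast
      moreover have "p \<in> ran (\<mu> |` vars \<alpha>)" using x a by (auto simp: ran_def restrict_map_def)
      ultimately show "p \<in> spans s" by blast
    qed
    have e: "[the (name_tuple \<mu> (fst e)), the (name_tuple \<mu> (snd e))] \<in> set (equality_rows (string_code s)) \<longleftrightarrow>
        substring s (the (\<mu> (fst e))) = substring s (the (\<mu> (snd e)))"
      if ran: "ran \<mu> \<subseteq> spans s" and e: "e \<in> set (equalities ?q)" for e
    proof -
      obtain p q where "\<mu> (fst e) = Some p" "\<mu> (snd e) = Some q"
        using wfe[OF e] dom by blast
      moreover from this ran have "p \<in> spans s" "q \<in> spans s" by (auto simp: ran_def)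
      ultimately show ?thesis
        by (auto simp: set_equality_rows name_tuple_def simp del: split_paired_Ex)
    qed
    show ?thesis
      unfolding bodyok_def good_def f using dom ran e by (auto simp: split_beta)
  qed (simp add: good_def)
  have surj: "\<exists>\<mu>. \<nu> = name_tuple \<mu>" if "bodyok \<nu>" "dom \<nu> = all_vars ?q" for \<nu>
  proof -
    have "\<exists>p. \<nu> x = Some (span_name p)" if x: "x \<in> all_vars ?q" for x
    proof -
      obtain \<alpha> where a: "\<alpha> \<in> set (formulas ?q)" "x \<in> vars \<alpha>"
        using x by (auto simp: all_vars_def)
      let ?xs = "var_list (map_regex to_nat \<alpha>)"
      have \<alpha>: "bounded_formula \<alpha> C d" using a bounded i by (meson nth_mem)
      have "map (the \<circ> \<nu>) ?xs \<in> set (formula_rows C d (string_code s) (map_regex to_nat \<alpha>))"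
        using \<open>bodyok \<nu>\<close> a by (simp add: bodyok_def)
      then obtain \<mu> where \<mu>: "\<mu> \<in> regex_eval \<alpha> s" "map (the \<circ> \<nu>) ?xs = map (\<lambda>x. entry (\<mu> x)) ?xs"
        unfolding set_formula_rows[OF \<alpha>] by blast
      have "x \<in> set ?xs" using a by (simp add: set_var_list)
      with \<mu>(2) have "the (\<nu> x) = entry (\<mu> x)" by simp
      moreover have "x \<in> dom \<mu>" using regex_eval_spans(1)[OF funct[OF a(1)] \<mu>(1)] a by simp
      ultimately show ?thesis using \<open>dom \<nu> = all_vars ?q\<close> \<open>x \<in> all_vars ?q\<close> by force
    qed
    then have "\<nu> x = name_tuple (\<lambda>x. map_option name_span (\<nu> x)) x" for x
    proof (cases "x \<in> all_vars ?q")
      case False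
      then have "\<nu> x = None" using that(2) by blast
      then show ?thesis by (simp add: name_tuple_def)
    qed (fastforce simp: name_tuple_def)
    then show ?thesis by blast
  qed
  have "rel_cq_eval (disjunct i) rel_db = {\<nu> |` set (out_vars ?q) | \<nu>. dom \<nu> = all_vars ?q \<and> bodyok \<nu>}"
    unfolding rel_cq_eval_def body body_vars_disjunct[OF i] by (simp add: disjunct_def)
  also have "\<dots> = {name_tuple \<mu> |` set (out_vars ?q) | \<mu>. good \<mu>}"
    using iff surj dom_name_tuple by (safe; metis)
  also have "\<dots> = name_tuple ` regex_cq_eval ?q s"
    unfolding regex_cq_eval_def good_def[symmetric] name_tuple_restrict by blast
  finally show ?thesis .
qed

lemma rel_ucq_eval_rel_query: "rel_ucq_eval rel_query rel_db = name_tuple ` regex_ucq_eval u s"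
proof -
  have "rel_ucq_eval rel_query rel_db = (\<Union>i<length u. rel_cq_eval (disjunct i) rel_db)"
    by (auto simp: rel_ucq_eval_def rel_query_eq)
  also have "\<dots> = (\<Union>i<length u. name_tuple ` regex_cq_eval (u ! i) s)"
    using rel_cq_eval_disjunct by auto
  also have "\<dots> = name_tuple ` (\<Union>i<length u. regex_cq_eval (u ! i) s)" by blast
  also have "(\<Union>i<length u. regex_cq_eval (u ! i) s) = regex_ucq_eval u s"
    unfolding regex_ucq_eval_def set_conv_nth by blast
  finally show ?thesis .
qed

end

section \<open>Decoding and composition\<close>

definition decode :: "(name \<times> name) list list \<Rightarrow> (name \<times> span) list list" where
  "decode out = map (map (\<lambda>p. (fst p, name_span (snd p)))) out"

lemma polytime_decode: "polytime decode"
proof -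
  have "polytime (\<lambda>out. map (\<lambda>a. map (\<lambda>p. (fst p, name_span (snd p))) a) (out :: (name \<times> name) list list))"
    by (intro polytime_intros)
  then show ?thesis by (simp add: decode_def[abs_def])
qed

text \<open>Decoding applies a left inverse of \<open>name_tuple\<close>, which is injective on the
  answers that occur, so no duplicates arise.\<close>

lemma decode_answers:
  assumes "\<forall>a\<in>set out. distinct (map fst a)" "distinct (map map_of out)"
    and set: "set (map map_of out) = name_tuple ` A"
  shows "\<forall>a\<in>set (decode out). distinct (map fst a)" "distinct (map map_of (decode out))"
    "set (map map_of (decode out)) = A"
proof -
  define g :: "(name \<rightharpoonup> name) \<Rightarrow> (name \<rightharpoonup> span)" where "g \<nu> = map_option name_span \<circ> \<nu>" for \<nu>
  have g: "g (name_tuple \<mu>) = \<mu>" for \<mu>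
    by (rule ext) (simp add: g_def name_tuple_def option.map_comp comp_def option.map_ident)
  have "map_of (map (\<lambda>p. (fst p, name_span (snd p))) a) = g (map_of a)" for a
    unfolding g_def map_of_map[symmetric] by (intro arg_cong[where f = map_of]) auto
  then have d: "map map_of (decode out) = map g (map map_of out)"
    by (simp add: decode_def)
  show "\<forall>a\<in>set (decode out). distinct (map fst a)"
    using assms(1) by (simp add: decode_def comp_def)
  have "inj_on g (name_tuple ` A)" using g by (auto simp: inj_on_def)
  then show "distinct (map map_of (decode out))"
    unfolding d using assms(2) set by (subst distinct_map) simp
  show "set (map map_of (decode out)) = A"
    unfolding d list.set_map[of g] set by (simp add: image_image g)
qed

text \<open>Brings bounds into the form demanded by \<open>poly_total_time\<close>:
  \<open>n + 1 \<le> 2 * n\<close> for positive \<open>n\<close> costs the factor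
  \<open>2 ^ k\<close>, and the additive constant takes care of 0.\<close>

lemma polybounded_nat_form:
  assumes "polybounded (f :: nat \<Rightarrow> nat)"
  obtains C k where "\<And>n. f n \<le> C * n ^ k + C"
proof -
  obtain C k where f: "\<And>n. f n \<le> C * (n + 1) ^ k"
    using assms by (auto simp: polybounded_def)
  have "f n \<le> (C * 2 ^ k) * n ^ k + C * 2 ^ k" for n
  proof (cases "n = 0")
    case True
    have "f n \<le> C" using f[of n] True by simp
    also have "C \<le> C * 2 ^ k" by simp
    finally show ?thesis by simp
  next
    case False
    then have "(n + 1) ^ k \<le> (2 * n) ^ k" by (intro power_mono) auto
    then have "C * (n + 1) ^ k \<le> C * (2 * n) ^ k" by (rule mult_le_mono2)
    moreover have "C * (2 * n) ^ k = C * 2 ^ k * n ^ k" by (simp add: power_mult_distrib)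
    ultimately show ?thesis using f[of n] by linarith
  qed
  then show thesis by (rule that)
qed

text \<open>The middle program is not bounded in its input alone, since its time also depends on the
  number \<open>N i\<close> of answers. All bounds are therefore expressed in the sum
  \<open>n\<close> of input size and \<open>N i\<close>, and \<open>P\<close> carries the
  correctness of the output along.\<close>

lemma poly_total_time_reduction:
  fixes pre :: "'x::encodable \<Rightarrow> 'y::encodable" and post :: "'o::encodable \<Rightarrow> 'p::encodable"
  assumes pre: "polytime pre" and post: "polytime post"
    and solve: "\<forall>i\<in>I. \<exists>out t. runs c (enc (pre (code i))) t (enc out) \<and>
      t \<le> C * (esize (pre (code i)) + N i) ^ k + C \<and> P i (post out)"
  shows "\<exists>c C k. \<forall>i\<in>I. \<exists>out t. runs c (enc (code i)) t (enc out) \<and>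
      t \<le> C * (esize (code i) + N i) ^ k + C \<and> P i out"
proof -
  obtain c1 T1 where 1: "polybounded T1" "\<And>x. \<exists>t\<le>T1 x. runs c1 (enc x) t (enc (pre x))"
    using pre by (auto simp: polytime_def)
  obtain c3 T3 where 3: "polybounded T3" "\<And>x. \<exists>t\<le>T3 x. runs c3 (enc x) t (enc (post x))"
    using post by (auto simp: polytime_def)
  obtain c12 K where c12: "\<And>x t y t' z. runs c1 x t y \<Longrightarrow> runs c y t' z \<Longrightarrow>
     \<exists>t''. runs c12 x t'' z \<and> t'' \<le> K * (t + t' + size x + 1)"
    using runs_seq[of c1 c] by blast
  obtain c123 K' where c123: "\<And>x t y t' z. runs c12 x t y \<Longrightarrow> runs c3 y t' z \<Longrightarrow>
     \<exists>t''. runs c123 x t'' z \<and> t'' \<le> K' * (t + t' + size x + 1)"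
    using runs_seq[of c12 c3] by blast
  have id: "polybounded (\<lambda>n::nat. n)"
    using polybounded_self[where 'a = nat] by (simp add: polybounded_def)
  obtain P1 where P1: "polybounded P1" "\<And>n x. esize x \<le> n \<Longrightarrow> T1 x \<le> P1 n"
    using polybounded_uniform[OF 1(1) id] by blast
  obtain S1 where S1: "polybounded S1" "\<And>n x. esize x \<le> n \<Longrightarrow> esize (pre x) \<le> S1 n"
    using polybounded_uniform[OF polytime_esize[OF pre] id] by blast
  define T2 where "T2 n = C * (S1 n + n) ^ k + C" for n
  have T2: "polybounded T2" unfolding T2_def by (intro polybounded_intros S1 id)
  have S2: "polybounded (\<lambda>n. S1 n + T2 n)" by (intro polybounded_intros S1 T2)
  obtain P3 where P3: "polybounded P3" "\<And>n x. esize x \<le> S1 n + T2 n \<Longrightarrow> T3 x \<le> P3 n"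
    using polybounded_uniform[OF 3(1) S2] by blast
  have "polybounded (\<lambda>n. K' * (K * (P1 n + T2 n + n + 1) + P3 n + n + 1))"
    by (intro polybounded_intros P1 T2 P3 id)
  then obtain D l where D: "\<And>n. K' * (K * (P1 n + T2 n + n + 1) + P3 n + n + 1) \<le> D * n ^ l + D"
    using polybounded_nat_form by blast
  have "\<exists>out t. runs c123 (enc (code i)) t (enc out) \<and> t \<le> D * (esize (code i) + N i) ^ l + D \<and> P i out"
    if i: "i \<in> I" for i
  proof -
    define n where "n = esize (code i) + N i"
    obtain out t where t: "runs c (enc (pre (code i))) t (enc out)"
      "t \<le> C * (esize (pre (code i)) + N i) ^ k + C" "P i (post out)"
      using solve i by blast
    have pre_le: "esize (pre (code i)) \<le> S1 n" by (rule S1(2)) (simp add: n_def)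
    have t2: "t \<le> T2 n"
    proof -
      have "C * (esize (pre (code i)) + N i) ^ k \<le> C * (S1 n + n) ^ k"
        using pre_le by (intro mult_le_mono2 power_mono) (auto simp: n_def)
      with t(2) show ?thesis unfolding T2_def by linarith
    qed
    obtain t1 where t1: "t1 \<le> T1 (code i)" "runs c1 (enc (code i)) t1 (enc (pre (code i)))"
      using 1 by blast
    have t1': "t1 \<le> P1 n" using t1(1) P1(2)[of "code i" n] by (simp add: n_def)
    \<comment> \<open>An output is no larger than the input plus the running time, so the
      postprocessing of all answers together is polynomial in \<open>n\<close> as well.\<close>
    have "esize out \<le> S1 n + T2 n"
      using runs_size[OF t(1)] pre_le t2 by (simp add: esize_def)
    then obtain t3 where t3: "t3 \<le> P3 n" "runs c3 (enc out) t3 (enc (post out))"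
      using 3(2)[of out] P3(2) by (meson order.trans)
    obtain t12 where t12: "runs c12 (enc (code i)) t12 (enc out)" "t12 \<le> K * (t1 + t + esize (code i) + 1)"
      using c12[OF t1(2) t(1)] by (auto simp: esize_def)
    obtain t123 where t123: "runs c123 (enc (code i)) t123 (enc (post out))"
      "t123 \<le> K' * (t12 + t3 + esize (code i) + 1)"
      using c123[OF t12(1) t3(2)] by (auto simp: esize_def)
    have "K * (t1 + t + esize (code i) + 1) \<le> K * (P1 n + T2 n + n + 1)"
      using t1' t2 by (intro mult_le_mono2) (simp add: n_def)
    with t12(2) have "t12 \<le> K * (P1 n + T2 n + n + 1)" by linarith
    with t3(1) have "K' * (t12 + t3 + esize (code i) + 1) \<le>
        K' * (K * (P1 n + T2 n + n + 1) + P3 n + n + 1)"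
      by (intro mult_le_mono2 add_mono) (simp_all add: n_def)
    with t123(2) D[of n] have "t123 \<le> D * n ^ l + D" by linarith
    with t123(1) t(3) show ?thesis unfolding n_def by blast
  qed
  then show ?thesis by blast
qed

theorem corollary5p3:
  fixes \<P> :: "'a::finite regex_ucq set"
    and \<A> :: "'a regex set"
    and \<Q> :: "rel_ucq set"
  assumes "card (UNIV :: 'a set) \<ge> 2"
    and "\<forall>u\<in>\<P>. wf_regex_ucq u"
    and "\<forall>u\<in>\<P>. \<forall>q\<in>set u. set (formulas q) \<subseteq> \<A>"
    and "polynomially_bounded \<A>"
    and "rel_ucq_class \<Q>"
    and "class_maps_to \<P> \<Q>"
    and "tractable \<Q>"
  shows "evaluable_in_poly_total_time \<P>"
proof -
  obtain C d where A: "\<forall>\<alpha>\<in>\<A>. \<forall>s. card (regex_eval \<alpha> s) \<le> C * (length s + 1) ^ d"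
    using assms(4) by (auto simp: polynomially_bounded_def)
  obtain c E k where c: "\<And>U D. U \<in> \<Q> \<Longrightarrow> db_for U D \<Longrightarrow> \<exists>out t.
        runs c (enc_pair (enc_list enc_rel_cq) enc_db (U, D)) t (enc_list (enc_list (enc_pair enc_name enc_name)) out) \<and>
        (\<forall>a\<in>set out. distinct (map fst a)) \<and> distinct (map map_of out) \<and>
        set (map map_of out) = rel_ucq_eval U D \<and>
        t \<le> E * (size (enc_pair (enc_list enc_rel_cq) enc_db (U, D)) + card (rel_ucq_eval U D)) ^ k + E"
    using assms(7) unfolding tractable_def poly_total_time_def by fastforce
  \<comment> \<open>\<open>C\<close> and \<open>d\<close> depend only on the class of formulas and
    are built into the program as constants.\<close>
  define pre where "pre x = (query_code C d (snd x) (fst x), database_code C d (snd x) (fst x))"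
    for x :: "cq_code list \<times> nat list"
  define code where "code i = (map cq_code (fst i), string_code (snd i))" for i :: "'a regex_ucq \<times> 'a list"
  define N where "N i = card (regex_ucq_eval (fst i) (snd i))" for i :: "'a regex_ucq \<times> 'a list"
  define P where "P i out \<longleftrightarrow> (\<forall>a\<in>set out. distinct (map fst a)) \<and> distinct (map map_of out) \<and>
      set (map map_of out) = regex_ucq_eval (fst i) (snd i)"
    for i :: "'a regex_ucq \<times> 'a list" and out :: "(name \<times> span) list list"
  have pre: "polytime pre"
    unfolding pre_def by (intro polytime_intros)
  have solve: "\<exists>out t. runs c (enc (pre (code i))) t (enc out) \<and>
      t \<le> E * (esize (pre (code i)) + N i) ^ k + E \<and> P i (decode out)" if i: "i \<in> \<P> \<times> UNIV" for i
  proof -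
    obtain u s where us: "i = (u, s)" "u \<in> \<P>" using i by auto
    have wf: "wf_regex_ucq u" using us assms(2) by blast
    have bounded: "bounded_formula \<alpha> C d" if "q \<in> set u" "\<alpha> \<in> set (formulas q)" for q \<alpha>
      using that us assms(3) wf by (intro bounded_formulaI[OF A]) (auto simp: wf_regex_ucq_def wf_regex_cq_def)
    interpret query_translation u s C d
      by (rule query_translation.intro[OF wf bounded])
    have Uc: "enc_pair (enc_list enc_rel_cq) enc_db (rel_query, rel_db) = enc (pre (code i))"
      by (simp add: rel_query_def rel_db_def enc_rel_query pre_def code_def us)
    \<comment> \<open>Existence of \<open>U\<close> is enough: closure under presentation passes
      membership on to the canonical query, which is the one evaluated.\<close>
    obtain U where "U \<in> \<Q>" "ucq_maps_to u U"
      using assms(6) us by (auto simp: class_maps_to_def)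
    then have "rel_query \<in> \<Q>"
      using assms(5) wf_rel_query same_presentation_rel_query
      unfolding rel_ucq_class_def by blast
    from c[OF this db_for_rel_query] obtain out t where
      out: "runs c (enc (pre (code i))) t (enc_list (enc_list (enc_pair enc_name enc_name)) out)"
        "\<forall>a\<in>set out. distinct (map fst a)" "distinct (map map_of out)"
        "set (map map_of out) = rel_ucq_eval rel_query rel_db"
        "t \<le> E * (size (enc (pre (code i))) + card (rel_ucq_eval rel_query rel_db)) ^ k + E"
      unfolding Uc by blast
    have ev: "rel_ucq_eval rel_query rel_db = name_tuple ` regex_ucq_eval u s"
      by (rule rel_ucq_eval_rel_query)
    \<comment> \<open>The number of answers is preserved, so total time relative to the relational
      answers is total time relative to the regex answers.\<close>
    then have "card (rel_ucq_eval rel_query rel_db) = N i"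
      using inj_name_tuple by (simp add: N_def us card_image inj_on_def inj_def)
    moreover have "enc_list (enc_list (enc_pair enc_name enc_name)) out = enc out"
      by (simp add: enc_list_inst enc_prod_inst enc_name_eq)
    moreover have "P i (decode out)"
      using decode_answers[OF out(2,3) out(4)[unfolded ev]] by (simp add: P_def us)
    ultimately show ?thesis using out(1,5) unfolding esize_def by metis
  qed
  have "\<exists>c C k. \<forall>i\<in>\<P> \<times> UNIV. \<exists>out t. runs c (enc (code i)) t (enc out) \<and>
      t \<le> C * (esize (code i) + N i) ^ k + C \<and> P i out"
    by (rule poly_total_time_reduction[OF pre polytime_decode, where c = c and C = E and k = k])
      (intro ballI solve)
  then obtain c' C' k' where fin: "\<And>i. i \<in> \<P> \<times> UNIV \<Longrightarrow> \<exists>out t. runs c' (enc (code i)) t (enc out) \<and>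
      t \<le> C' * (esize (code i) + N i) ^ k' + C' \<and> P i out" by blast
  have code: "enc (code i) = enc_pair (enc_list enc_regex_cq) (enc_list enc_letter) i" for i
    using enc_input[of "fst i" "snd i"] by (simp add: code_def)
  have out: "enc_list (enc_list (enc_pair enc_name (enc_pair enc_nat enc_nat))) out = enc out"
    for out :: "(name \<times> span) list list"
    by (simp add: enc_list_inst enc_prod_inst enc_name_eq enc_nat_inst)
  show ?thesis
    unfolding evaluable_in_poly_total_time_def poly_total_time_def out code[symmetric] split_beta
  proof (rule exI[of _ c'], rule exI[of _ C'], rule exI[of _ k'], rule ballI)
    fix i assume "i \<in> \<P> \<times> (UNIV :: 'a list set)"
    from fin[OF this] show "\<exists>out t. runs c' (enc (code i)) t (enc out) \<and>
        (\<forall>a\<in>set out. distinct (map fst a)) \<and> distinct (map map_of out) \<and>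
        set (map map_of out) = regex_ucq_eval (fst i) (snd i) \<and>
        t \<le> C' * (size (enc (code i)) + card (regex_ucq_eval (fst i) (snd i))) ^ k' + C'"
      unfolding P_def N_def esize_def by blast
  qed
qed

end
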